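(* Let $\Lambda=\{1,\dots,M\}$ with $M\ge1$. Let $D$ be a diagonal $\Lambda\times\Lambda$ matrix with diagonal entries $d_x>0$, let $J$ be a $\Lambda\times\Lambda$ matrix with zero diagonal and entries $J_{x,y}\ge0$, suppose that $D-J$ is diagonally dominant, and set $A=D-J$. Let $g>0$ and let $\lambda\in\mathbb R$ (possibly negative) be such that the expectation defining $G^{\rm wsaw}_{a,b}$ below converges. Then for all $a,b\in\Lambda$ the weakly self-avoiding walk two-point function $$G^{\rm wsaw}_{a,b}=\frac{1}{d_b\pi_{b,\partial}}\,\mathbb E_a\Big(e^{-g\sum_{x\in\Lambda}L_x^2}\,e^{-\lambda\zeta}\,\mathbb I_{X(\zeta^-)=b}\Big)$$ has the representation $$G^{\rm wsaw}_{a,b}=\int e^{-S_A}\,\bar\phi_a\phi_b\,e^{-g\sum_{x\in\Lambda}\tau_x^2-\lambda\sum_{x\in\Lambda}\tau_x}.$$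
   Context: Diagonal dominance of $D-J$ means $\max_{x\in\Lambda}\sum_{y\in\Lambda}|J_{x,y}/d_x|<1$. Markov chain: $X$ is the continuous-time Markov chain on $\Lambda\cup\{\partial\}$, with $\partial$ an absorbing cemetery state. On arriving at $x\in\Lambda$ it waits an ${\rm Exp}(d_x)$ holding time, then jumps to $y\in\Lambda$ with probability $\pi_{x,y}=d_x^{-1}J_{x,y}$ and to $\partial$ with probability $\pi_{x,\partial}=1-\sum_{y\in\Lambda}d_x^{-1}J_{x,y}$; holding times are independent of each other and of the jumps. $\zeta$ is the time of arrival at $\partial$ (almost surely finite), $X(\zeta^-)$ is the last state visited before $\partial$, $L_x=\int_0^\infty\mathbb I_{X(s)=x}\,ds$ is the total time spent at $x\in\Lambda$, and $\mathbb E_a$ is the expectation for $X$ started at $a\in\Lambda$. $\mathbb I$ denotes an indicator. Differential forms: let $u_1,v_1,\dots,u_M,v_M$ be standard coordinates on $\mathbb R^{2M}$; differentials are multiplied with the anticommuting wedge product (omitted from the notation). For $x\in\Lambda$ put $\phi_x=u_x+iv_x$, $\bar\phi_x=u_x-iv_x$, $d\phi_x=du_x+i\,dv_x$, $d\bar\phi_x=du_x-i\,dv_x$, $\psi_x=(2\pi i)^{-1/2}d\phi_x$, $\bar\psi_x=(2\pi i)^{-1/2}d\bar\phi_x$ (one fixed choice of the square root). Write $\phi A\bar\phi=\sum_{x,y}\phi_xA_{x,y}\bar\phi_y$, $\psi A\bar\psi=\sum_{x,y}A_{x,y}\psi_x\bar\psi_y$, and $$S_A=\phi A\bar\phi+\psi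 A\bar\psi,\qquad \tau_x=\phi_x\bar\phi_x+\psi_x\bar\psi_x .$$ Smooth functions of a finite collection $K=(K_j)_{j}$ of forms, each a sum of forms of even degree, are defined by the (terminating) Taylor expansion about the degree-zero part $K^{(0)}$: $F(K)=\sum_\alpha\frac1{\alpha!}F^{(\alpha)}(K^{(0)})(K-K^{(0)})^\alpha$, with $\alpha$ a multi-index. In particular $e^{-S_A}=e^{-\phi A\bar\phi}\sum_{n=0}^{M}\frac{(-1)^n}{n!}(\psi A\bar\psi)^n$. Integration: the integral of a form is computed from its degree-$2M$ part only (parts of other degree integrate to $0$), and $\int f(u,v)\,du_1dv_1\cdots du_Mdv_M$ is the Lebesgue integral of $f$ over $\mathbb R^{2M}$. *)

theory Defs
  imports "HOL-Probability.Probability"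
begin

section \<open>Differential forms on Euclidean space\<close>

text \<open>
  The coordinates of the space are indexed by a finite linearly ordered type \<open>'i\<close>. A form is
  given by its coefficients: \<open>coeff \<omega> p I\<close> is the coefficient at the point \<open>p\<close> of the wedge product
  of the differentials \<open>dx_i\<close> for \<open>i \<in> I\<close>, taken in increasing order.
\<close>

typedef 'i form = "UNIV :: (real ^ 'i \<Rightarrow> 'i set \<Rightarrow> complex) set"
  morphisms coeff Form ..

lemma coeff_Form [simp]: "coeff (Form f) = f"
  by (simp add: Form_inverse)

lemma form_eqI: "(\<And>p I. coeff f p I = coeff g p I) \<Longrightarrow> f = g"
  by (metis coeff_inject ext)

text \<open>The sign of the permutation sorting the concatenation of the increasing lists of
  \<open>A\<close> and \<open>B\<close> (for disjoint \<open>A\<close> and \<open>B\<close>).\<close>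

definition wedge_sign :: "'i::linorder set \<Rightarrow> 'i set \<Rightarrow> complex" where
  "wedge_sign A B = (-1) ^ card {(i, j). i \<in> A \<and> j \<in> B \<and> j < i}"

instantiation form :: ("{finite,linorder}") "{zero,one,plus,minus,uminus,times}"
begin
definition zero_form :: "'a form" where "0 = Form (\<lambda>p I. 0)"
definition one_form :: "'a form" where "1 = Form (\<lambda>p I. if I = {} then 1 else 0)"
definition plus_form :: "'a form \<Rightarrow> 'a form \<Rightarrow> 'a form" where
  "f + g = Form (\<lambda>p I. coeff f p I + coeff g p I)"
definition minus_form :: "'a form \<Rightarrow> 'a form \<Rightarrow> 'a form" where
  "f - g = Form (\<lambda>p I. coeff f p I - coeff g p I)"
definition uminus_form :: "'a form \<Rightarrow> 'a form" where
  "- f = Form (\<lambda>p I. - coeff f p I)"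
text \<open>Multiplication of forms is the wedge product.\<close>
definition times_form :: "'a form \<Rightarrow> 'a form \<Rightarrow> 'a form" where
  "f * g = Form (\<lambda>p I. \<Sum>B\<in>Pow I. wedge_sign B (I - B) * coeff f p B * coeff g p (I - B))"
instance ..
end

lemma coeff_simps [simp]:
  "coeff 0 p I = 0"
  "coeff 1 p I = (if I = {} then 1 else 0)"
  "coeff (f + g) p I = coeff f p I + coeff g p I"
  "coeff (f - g) p I = coeff f p I - coeff g p I"
  "coeff (- f) p I = - coeff f p I"
  by (simp_all add: zero_form_def one_form_def plus_form_def minus_form_def uminus_form_def)

lemma coeff_times:
  "coeff (f * g) p I = (\<Sum>B\<in>Pow I. wedge_sign B (I - B) * coeff f p B * coeff g p (I - B))"
  by (simp add: times_form_def)

lemma wedge_sign_empty [simp]: "wedge_sign {} B = 1" "wedge_sign A {} = 1"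
  by (simp_all add: wedge_sign_def)

lemma wedge_sign_Un_left:
  fixes A B C :: "'i::{finite,linorder} set"
  assumes "A \<inter> B = {}"
  shows "wedge_sign (A \<union> B) C = wedge_sign A C * wedge_sign B C"
proof -
  let ?S = "\<lambda>A. {(i, j). i \<in> A \<and> j \<in> C \<and> j < i}"
  have "?S (A \<union> B) = ?S A \<union> ?S B" "?S A \<inter> ?S B = {}" using assms by auto
  then have "card (?S (A \<union> B)) = card (?S A) + card (?S B)"
    by (simp add: card_Un_disjoint)
  then show ?thesis by (simp add: wedge_sign_def power_add)
qed

lemma wedge_sign_Un_right:
  fixes A B C :: "'i::{finite,linorder} set"
  assumes "B \<inter> C = {}"
  shows "wedge_sign A (B \<union> C) = wedge_sign A B * wedge_sign A C"
proof -
  let ?S = "\<lambda>B. {(i, j). i \<in> A \<and> j \<in> B \<and> j < i}"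
  have "?S (B \<union> C) = ?S B \<union> ?S C" "?S B \<inter> ?S C = {}" using assms by auto
  then have "card (?S (B \<union> C)) = card (?S B) + card (?S C)"
    by (simp add: card_Un_disjoint)
  then show ?thesis by (simp add: wedge_sign_def power_add)
qed

lemma form_mult_assoc: "(f * g) * h = f * (g * (h :: 'i::{finite,linorder} form))"
proof (rule form_eqI)
  fix p I
  let ?l = "\<lambda>B C. wedge_sign B (I - B) * (wedge_sign C (B - C) * coeff f p C * coeff g p (B - C))
     * coeff h p (I - B)"
  let ?r = "\<lambda>C E. wedge_sign C (I - C) * coeff f p C *
     (wedge_sign E (I - C - E) * coeff g p E * coeff h p (I - C - E))"
  have "coeff ((f * g) * h) p I = (\<Sum>B\<in>Pow I. \<Sum>C\<in>Pow B. ?l B C)"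
    by (simp add: coeff_times sum_distrib_left sum_distrib_right mult.assoc)
  also have "\<dots> = (\<Sum>(B, C)\<in>(SIGMA B:Pow I. Pow B). ?l B C)"
    by (rule sum.Sigma) auto
  also have "\<dots> = (\<Sum>(C, E)\<in>(SIGMA C:Pow I. Pow (I - C)). ?r C E)"
  proof (rule sum.reindex_bij_witness[where i = "\<lambda>(C, E). (C \<union> E, C)" and j = "\<lambda>(B, C). (C, B - C)"],
      goal_cases)
    case (5 z)
    obtain B C where z: "z = (B, C)" by (cases z)
    with 5 have BC: "B \<subseteq> I" "C \<subseteq> B" by auto
    have "wedge_sign B (I - B) = wedge_sign C (I - B) * wedge_sign (B - C) (I - B)"
      using wedge_sign_Un_left[of C "B - C" "I - B"] BC by (simp add: Un_absorb1)
    moreover have "I - C = (B - C) \<union> (I - B)" using BC by auto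
    then have "wedge_sign C (I - C) = wedge_sign C (B - C) * wedge_sign C (I - B)"
      using wedge_sign_Un_right[of "B - C" "I - B" C] by auto
    moreover have "I - C - (B - C) = I - B" using BC by auto
    ultimately show ?case by (simp add: z)
  qed auto
  also have "\<dots> = (\<Sum>C\<in>Pow I. \<Sum>E\<in>Pow (I - C). ?r C E)"
    by (rule sum.Sigma[symmetric]) auto
  also have "\<dots> = coeff (f * (g * h)) p I"
    by (simp add: coeff_times sum_distrib_left mult.assoc)
  finally show "coeff ((f * g) * h) p I = coeff (f * (g * h)) p I" .
qed

instance form :: ("{finite,linorder}") ring_1
proof
  fix f g h :: "'a form"
  show "(f * g) * h = f * (g * h)" by (rule form_mult_assoc)
  show "1 * f = f"
  proof (rule form_eqI)
    fix p I
    have "coeff (1 * f) p I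
        = (\<Sum>B\<in>Pow I. if B = {} then wedge_sign B (I - B) * coeff f p (I - B) else 0)"
      unfolding coeff_times by (intro sum.cong) auto
    then show "coeff (1 * f) p I = coeff f p I" by (simp add: sum.delta)
  qed
  show "f * 1 = f"
  proof (rule form_eqI)
    fix p I
    have "coeff (f * 1) p I
        = (\<Sum>B\<in>Pow I. if B = I then wedge_sign B (I - B) * coeff f p B else 0)"
      unfolding coeff_times by (intro sum.cong) auto
    then show "coeff (f * 1) p I = coeff f p I" by (simp add: sum.delta)
  qed
  show "(f + g) * h = f * h + g * h"
    by (rule form_eqI) (simp add: coeff_times algebra_simps sum.distrib)
  show "f * (g + h) = f * g + f * h"
    by (rule form_eqI) (simp add: coeff_times algebra_simps sum.distrib)
  show "(0 :: 'a form) \<noteq> 1"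
  proof
    assume "(0 :: 'a form) = 1"
    then have "coeff (0 :: 'a form) 0 {} = coeff 1 0 {}" by simp
    then show False by simp
  qed
qed (auto intro!: form_eqI)

definition form_fn :: "(real ^ 'i \<Rightarrow> complex) \<Rightarrow> 'i::finite form" where
  "form_fn f = Form (\<lambda>p I. if I = {} then f p else 0)"

abbreviation form_const :: "complex \<Rightarrow> 'i::finite form" where
  "form_const c \<equiv> form_fn (\<lambda>_. c)"

definition dcoord :: "'i \<Rightarrow> 'i::finite form" where
  "dcoord i = Form (\<lambda>p I. if I = {i} then 1 else 0)"

definition deg0 :: "'i::finite form \<Rightarrow> real ^ 'i \<Rightarrow> complex" where
  "deg0 K p = coeff K p {}"

text \<open>The top-degree coefficient refers to the product of all differentials in increasing order.\<close>

definition form_integrable :: "'i::finite form \<Rightarrow> bool" where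
  "form_integrable K \<longleftrightarrow> integrable lborel (\<lambda>p. coeff K p UNIV)"

definition form_integral :: "'i::finite form \<Rightarrow> complex" where
  "form_integral K = (LINT p|lborel. coeff K p UNIV)"

section \<open>Functions of forms\<close>

text \<open>Derivatives are complex ones, since the degree-zero part of \<open>S_A\<close> is complex when \<open>A\<close> is
  not symmetric.\<close>

definition partial_deriv ::
    "'j \<Rightarrow> (('j \<Rightarrow> complex) \<Rightarrow> complex) \<Rightarrow> ('j \<Rightarrow> complex) \<Rightarrow> complex" where
  "partial_deriv j F t = deriv (\<lambda>z. F (t(j := z))) (t j)"

definition multi_deriv ::
    "('j::{finite,linorder} \<Rightarrow> nat) \<Rightarrow> (('j \<Rightarrow> complex) \<Rightarrow> complex) \<Rightarrow> ('j \<Rightarrow> complex) \<Rightarrow> complex" where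
  "multi_deriv \<alpha> F = fold (\<lambda>j. partial_deriv j ^^ \<alpha> j) (sorted_list_of_set UNIV) F"

text \<open>\<open>F(K)\<close> for a finite collection \<open>K\<close> of even forms. The order of the factors
  \<open>(K_j - K_j^{(0)})^{\<alpha>_j}\<close> is immaterial because these are even; a product with total exponent
  \<open>|\<alpha>|\<close> has degree at least \<open>2|\<alpha>|\<close>, which is why the Taylor expansion terminates.\<close>

definition form_fun ::
    "(('j::{finite,linorder} \<Rightarrow> complex) \<Rightarrow> complex) \<Rightarrow> ('j \<Rightarrow> 'i form)
      \<Rightarrow> 'i::{finite,linorder} form" where
  "form_fun F K =
    (\<Sum>\<alpha> | 2 * (\<Sum>j\<in>UNIV. \<alpha> j) \<le> CARD('i).
        form_fn (\<lambda>p. multi_deriv \<alpha> F (\<lambda>j. deg0 (K j) p) / (\<Prod>j\<in>UNIV. fact (\<alpha> j)))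
        * prod_list (map (\<lambda>j. (K j - form_fn (deg0 (K j))) ^ \<alpha> j) (sorted_list_of_set UNIV)))"

definition form_exp :: "'i::{finite,linorder} form \<Rightarrow> 'i form" where
  "form_exp K = form_fun (\<lambda>t. exp (t ())) (\<lambda>_. K)"

lemma form_fn_divide:
  fixes f :: "real ^ 'i::{finite,linorder} \<Rightarrow> complex"
  shows "form_fn (\<lambda>p. f p / c) = form_fn f * form_const (1 / c)"
proof (rule form_eqI)
  fix p and I :: "'i set"
  have "coeff (form_fn f * form_const (1 / c)) p I
     = (\<Sum>B\<in>Pow I. if B = {} then coeff (form_fn (\<lambda>p. f p / c)) p I else 0)"
    unfolding coeff_times by (intro sum.cong) (auto simp: form_fn_def)
  then show "coeff (form_fn (\<lambda>p. f p / c)) p I = coeff (form_fn f * form_const (1 / c)) p I"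
    by simp
qed

lemma form_exp_eq:
  "form_exp K = form_fn (\<lambda>p. exp (deg0 K p)) *
     (\<Sum>n\<le>CARD('i) div 2. form_const (1 / fact n) * (K - form_fn (deg0 K)) ^ n)"
  for K :: "'i::{finite,linorder} form"
proof -
  let ?N = "CARD('i) div 2"
  have l: "sorted_list_of_set (UNIV :: unit set) = [()]" by (simp add: UNIV_unit)
  have "(partial_deriv () ^^ n) (\<lambda>t. exp (t ())) = (\<lambda>t. exp (t ()))" for n
    by (induction n) (simp_all add: partial_deriv_def fun_eq_iff DERIV_imp_deriv)
  then have d: "multi_deriv \<alpha> (\<lambda>t. exp (t ())) = (\<lambda>t. exp (t ()))" for \<alpha> :: "unit \<Rightarrow> nat"
    by (simp add: multi_deriv_def l)
  have "form_exp K = (\<Sum>\<alpha> | 2 * \<alpha> () \<le> CARD('i).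
      form_fn (\<lambda>p. exp (deg0 K p) / fact (\<alpha> ())) * (K - form_fn (deg0 K)) ^ \<alpha> ())"
    by (simp add: form_exp_def form_fun_def d l UNIV_unit)
  also have "\<dots> = (\<Sum>n\<le>?N. form_fn (\<lambda>p. exp (deg0 K p) / fact n) * (K - form_fn (deg0 K)) ^ n)"
    by (rule sum.reindex_bij_witness[where i = "\<lambda>n _. n" and j = "\<lambda>\<alpha>. \<alpha> ()"]) auto
  also have "\<dots> = form_fn (\<lambda>p. exp (deg0 K p)) *
     (\<Sum>n\<le>?N. form_const (1 / fact n) * (K - form_fn (deg0 K)) ^ n)"
    unfolding sum_distrib_left
    by (intro sum.cong refl, subst form_fn_divide) (simp only: mult.assoc)
  finally show ?thesis .
qed

section \<open>The forms attached to a finite index set\<close>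

text \<open>Coordinates \<open>u_x\<close>, \<open>v_x\<close>, ordered as \<open>u_1, v_1, u_2, v_2, \<dots>\<close>; this fixes the orientation.\<close>

datatype 'm coord = UC (site: 'm) | VC (site: 'm)

lemma UNIV_coord: "UNIV = UC ` UNIV \<union> VC ` UNIV"
  by (metis UNIV_eq_I UnCI coord.exhaust rangeI)

instance coord :: (finite) finite
  by standard (simp add: UNIV_coord)

lemma card_coord: "CARD('m::finite coord) = 2 * CARD('m)"
proof -
  have "card (range UC \<union> range (VC :: 'm \<Rightarrow> 'm coord)) = CARD('m) + CARD('m)"
    by (subst card_Un_disjoint) (auto simp: card_image inj_def)
  then show ?thesis by (simp add: UNIV_coord)
qed

instantiation coord :: (linorder) linorder
begin
definition less_eq_coord :: "'a coord \<Rightarrow> 'a coord \<Rightarrow> bool" where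
  "c \<le> c' \<longleftrightarrow> site c < site c' \<or> site c = site c' \<and> (is_UC c \<or> \<not> is_UC c')"
definition less_coord :: "'a coord \<Rightarrow> 'a coord \<Rightarrow> bool" where
  "c < c' \<longleftrightarrow> site c < site c' \<or> site c = site c' \<and> is_UC c \<and> \<not> is_UC c'"
instance
  by standard (auto simp: less_eq_coord_def less_coord_def intro: coord.expand)
end

definition \<phi> :: "'m \<Rightarrow> 'm::{finite,linorder} coord form" where
  "\<phi> x = form_fn (\<lambda>p. complex_of_real (p $ UC x) + \<i> * complex_of_real (p $ VC x))"

definition \<phi>bar :: "'m \<Rightarrow> 'm::{finite,linorder} coord form" where
  "\<phi>bar x = form_fn (\<lambda>p. complex_of_real (p $ UC x) - \<i> * complex_of_real (p $ VC x))"

definition \<psi> :: "'m \<Rightarrow> 'm::{finite,linorder} coord form" where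
  "\<psi> x = form_const (1 / csqrt (2 * pi * \<i>)) * (dcoord (UC x) + form_const \<i> * dcoord (VC x))"

definition \<psi>bar :: "'m \<Rightarrow> 'm::{finite,linorder} coord form" where
  "\<psi>bar x = form_const (1 / csqrt (2 * pi * \<i>)) * (dcoord (UC x) - form_const \<i> * dcoord (VC x))"

definition S_form :: "real ^ 'm::{finite,linorder} ^ 'm::{finite,linorder} \<Rightarrow> 'm::{finite,linorder} coord form" where
  "S_form A = (\<Sum>x\<in>UNIV. \<Sum>y\<in>UNIV. \<phi> x * form_const (complex_of_real (A $ x $ y)) * \<phi>bar y)
            + (\<Sum>x\<in>UNIV. \<Sum>y\<in>UNIV. form_const (complex_of_real (A $ x $ y)) * \<psi> x * \<psi>bar y)"

definition \<tau> :: "'m \<Rightarrow> 'm::{finite,linorder} coord form" where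
  "\<tau> x = \<phi> x * \<phi>bar x + \<psi> x * \<psi>bar x"

section \<open>The killed Markov chain and the two-point function\<close>

definition diagonally_dominant :: "real ^ 'm::finite ^ 'm \<Rightarrow> real ^ 'm ^ 'm \<Rightarrow> bool" where
  "diagonally_dominant D J \<longleftrightarrow> (MAX x. \<Sum>y\<in>UNIV. \<bar>J $ x $ y / D $ x $ x\<bar>) < 1"

text \<open>The state space is \<open>'m option\<close>, with \<open>None\<close> the cemetery.\<close>

fun jump_prob :: "real ^ 'm::finite ^ 'm \<Rightarrow> real ^ 'm ^ 'm \<Rightarrow> 'm option \<Rightarrow> 'm option \<Rightarrow> real" where
  "jump_prob D J (Some x) (Some y) = J $ x $ y / D $ x $ x"
| "jump_prob D J (Some x) None = 1 - (\<Sum>y\<in>UNIV. J $ x $ y / D $ x $ x)"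
| "jump_prob D J None (Some y) = 0"
| "jump_prob D J None None = 1"

text \<open>\<open>Y n\<close> is the state after the \<open>n\<close>-th jump and \<open>T n\<close> the holding time there: given
  \<open>Y 0, Y 1, \<dots>\<close>, the holding times in states of \<open>\<Lambda>\<close> are independent exponential variables, the one
  in \<open>x\<close> having rate \<open>D $ x $ x\<close>. The variable \<open>T n\<close> is irrelevant when \<open>Y n = None\<close>.\<close>

locale killed_chain = prob_space P for P :: "'w measure" +
  fixes D J :: "real ^ 'm::finite ^ 'm" and a :: 'm
    and Y :: "nat \<Rightarrow> 'w \<Rightarrow> 'm option" and T :: "nat \<Rightarrow> 'w \<Rightarrow> real"
  assumes measurable_Y: "\<And>n. Y n \<in> measurable P (count_space UNIV)"
    and measurable_T: "\<And>n. T n \<in> borel_measurable P"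
    and jumps: "\<And>n y. prob {\<omega> \<in> space P. \<forall>i\<le>n. Y i \<omega> = y i}
          = of_bool (y 0 = Some a) * (\<Prod>i<n. jump_prob D J (y i) (y (Suc i)))"
    and holding: "\<And>n y B. (\<And>i. B i \<in> sets borel) \<Longrightarrow>
          prob {\<omega> \<in> space P. \<forall>i\<le>n. Y i \<omega> = y i \<and> (y i \<noteq> None \<longrightarrow> T i \<omega> \<in> B i)}
          = prob {\<omega> \<in> space P. \<forall>i\<le>n. Y i \<omega> = y i}
            * (\<Prod>i\<le>n. case y i of None \<Rightarrow> 1
                 | Some x \<Rightarrow> measure (density lborel (exponential_density (D $ x $ x))) (B i))"

text \<open>Positivity of the holding times, and absorption in \<open>None\<close>, hold almost surely only. On the
  exceptional null event the index of the sojourn containing \<open>s\<close> need not be unique, \<open>death_index\<close>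
  may be meaningless, and \<open>local_time\<close> is \<open>0\<close> if the occupation time is infinite.\<close>

definition jump_time :: "(nat \<Rightarrow> 'w \<Rightarrow> real) \<Rightarrow> nat \<Rightarrow> 'w \<Rightarrow> real" where
  "jump_time T n \<omega> = (\<Sum>i<n. T i \<omega>)"

definition chain_at ::
    "(nat \<Rightarrow> 'w \<Rightarrow> 'm option) \<Rightarrow> (nat \<Rightarrow> 'w \<Rightarrow> real) \<Rightarrow> real \<Rightarrow> 'w \<Rightarrow> 'm option" where
  "chain_at Y T s \<omega> =
    (let sojourn = (\<lambda>n. Y n \<omega> \<noteq> None \<and> jump_time T n \<omega> \<le> s \<and> s < jump_time T (Suc n) \<omega>)
     in if \<exists>n. sojourn n then Y (LEAST n. sojourn n) \<omega> else None)"

definition death_index :: "(nat \<Rightarrow> 'w \<Rightarrow> 'm option) \<Rightarrow> 'w \<Rightarrow> nat" where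
  "death_index Y \<omega> = (LEAST n. Y n \<omega> = None)"

definition lifetime :: "(nat \<Rightarrow> 'w \<Rightarrow> 'm option) \<Rightarrow> (nat \<Rightarrow> 'w \<Rightarrow> real) \<Rightarrow> 'w \<Rightarrow> real" where
  "lifetime Y T \<omega> = jump_time T (death_index Y \<omega>) \<omega>"

definition last_state :: "(nat \<Rightarrow> 'w \<Rightarrow> 'm option) \<Rightarrow> 'w \<Rightarrow> 'm option" where
  "last_state Y \<omega> = Y (death_index Y \<omega> - 1) \<omega>"

definition local_time ::
    "(nat \<Rightarrow> 'w \<Rightarrow> 'm option) \<Rightarrow> (nat \<Rightarrow> 'w \<Rightarrow> real) \<Rightarrow> 'm \<Rightarrow> 'w \<Rightarrow> real" where
  "local_time Y T x \<omega> = (LINT s:{0..}|lborel. indicat_real {s. chain_at Y T s \<omega> = Some x} s)"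

definition wsaw_weight ::
    "(nat \<Rightarrow> 'w \<Rightarrow> 'm::finite option) \<Rightarrow> (nat \<Rightarrow> 'w \<Rightarrow> real) \<Rightarrow> real \<Rightarrow> real \<Rightarrow> 'm \<Rightarrow> 'w \<Rightarrow> real" where
  "wsaw_weight Y T g lam b \<omega> =
     exp (- g * (\<Sum>x\<in>UNIV. (local_time Y T x \<omega>)\<^sup>2)) * exp (- lam * lifetime Y T \<omega>)
     * indicat_real {\<omega>. last_state Y \<omega> = Some b} \<omega>"

definition G_wsaw ::
    "'w measure \<Rightarrow> real ^ 'm ^ 'm \<Rightarrow> real ^ 'm ^ 'm \<Rightarrow> (nat \<Rightarrow> 'w \<Rightarrow> 'm::finite option)
      \<Rightarrow> (nat \<Rightarrow> 'w \<Rightarrow> real) \<Rightarrow> real \<Rightarrow> real \<Rightarrow> 'm \<Rightarrow> real" where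
  "G_wsaw P D J Y T g lam b =
     1 / (D $ b $ b * jump_prob D J (Some b) None) * (LINT \<omega>|P. wsaw_weight Y T g lam b \<omega>)"

end

(* Linearising the quartic weight by a Gaussian Fourier transform turns
   exp (- g t^2 - lam t) into a superposition of exponentials exp ((i s - c) t), for a constant c
   as large as we like. For each fixed frequency both sides are the same matrix element of the
   inverse of V = A + c - i s, a matrix whose Hermitian part is positive definite when c is large
   (that of A itself need not be positive semidefinite, since A is not symmetric):

   - on the probabilistic side, summing over the paths of the chain gives the Neumann series of
     the inverse of V;
   - on the side of forms, the bosonic integral with the weight exp (- phi V phibar) satisfies
     V I = Z by integration by parts, and the fermionic top coefficient is alternating and
     multilinear in the rows of V, so that its product with Z is constant along the segment from
     the identity matrix to V. This is the cancellation of determinants, obtained here by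
     differentiation without mentioning determinants. *)
theory Submission
  imports Defs
begin

section \<open>Gaussian integrals\<close>

text \<open>The weight enters not only through its value at the bosonic part of \<tau> but also,
  because \<tau> has a nilpotent part, through its derivatives. Each
  \<open>\<psi> x * \<psi>bar x\<close> squares to zero, so at most one derivative per site occurs
  and the Taylor expansion is a sum over sets \<open>S\<close> of sites. Under the Fourier transform
  a derivative at a site becomes multiplication by the frequency there; this lets the sum over
  \<open>S\<close> reassemble, for each choice of frequencies, into the fermionic top coefficient of
  the shifted matrix V. There is one independent frequency per site, so V differs from
  \<open>A\<close> by a diagonal matrix only.

  The exchanges of integrals rest on bounds that are uniform in the frequencies: the Fourier weight
  has constant modulus, and the real part of phi V phibar does not see the imaginary diagonal. The
  same constant c, being nonnegative, keeps the discount along the chain bounded by 1 whatever the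
  sign of \<open>lam\<close>.\<close>

lemma has_vector_derivative_iff_quotient:
  fixes f :: "real \<Rightarrow> 'b::real_normed_vector"
  shows "(f has_vector_derivative D) (at x within S) \<longleftrightarrow>
    ((\<lambda>y. (f y - f x) /\<^sub>R (y - x)) \<longlongrightarrow> D) (at x within S)"
proof -
  have "norm (f y - f x - (y - x) *\<^sub>R D) / norm (y - x) = norm ((f y - f x) /\<^sub>R (y - x) - D)"
    if "y \<noteq> x" for y
  proof -
    have "(f y - f x) /\<^sub>R (y - x) - D = (f y - f x - (y - x) *\<^sub>R D) /\<^sub>R (y - x)"
      using that by (simp add: scaleR_diff_right)
    then show ?thesis by (simp add: divide_inverse mult.commute)
  qed
  then have "((\<lambda>y. norm (f y - f x - (y - x) *\<^sub>R D) / norm (y - x)) \<longlongrightarrow> 0) (at x within S) \<longleftrightarrow>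
      ((\<lambda>y. norm ((f y - f x) /\<^sub>R (y - x) - D)) \<longlongrightarrow> 0) (at x within S)"
    by (intro filterlim_cong refl) (auto simp: eventually_at_filter)
  then show ?thesis
    by (simp add: has_vector_derivative_def has_derivative_iff_norm tendsto_norm_zero_iff
        bounded_linear_scaleR_left LIM_zero_iff)
qed

text \<open>The mean value inequality on the convex set \<open>S\<close> turns the bound on the
  derivative into the same bound on the difference quotients, and dominated convergence along
  sequences finishes. Derivatives are taken within \<open>S\<close> so that the endpoints of a
  closed interval are covered.\<close>

lemma has_vector_derivative_integral:
  fixes f f' :: "real \<Rightarrow> 'p \<Rightarrow> 'b::{banach, second_countable_topology}"
  assumes S: "convex S" "x \<in> S"
    and deriv: "\<And>h p. h \<in> S \<Longrightarrow> ((\<lambda>h. f h p) has_vector_derivative f' h p) (at h within S)"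
    and bound: "\<And>h p. h \<in> S \<Longrightarrow> norm (f' h p) \<le> B p"
    and B: "integrable M B"
    and f: "\<And>h. h \<in> S \<Longrightarrow> integrable M (f h)"
    and f': "f' x \<in> borel_measurable M"
  shows "((\<lambda>h. \<integral>p. f h p \<partial>M) has_vector_derivative (\<integral>p. f' x p \<partial>M)) (at x within S)"
  unfolding has_vector_derivative_iff_quotient tendsto_at_iff_sequentially comp_def
proof (intro allI impI)
  fix X :: "nat \<Rightarrow> real" assume X: "\<forall>i. X i \<in> S - {x}" "X \<longlonglongrightarrow> x"
  have Xi: "X i \<in> S" "X i \<noteq> x" for i using X by auto
  let ?q = "\<lambda>i p. (f (X i) p - f x p) /\<^sub>R (X i - x)"
  have "(\<lambda>i. \<integral>p. ?q i p \<partial>M) \<longlonglongrightarrow> (\<integral>p. f' x p \<partial>M)"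
  proof (rule integral_dominated_convergence[OF f' _ B])
    show "?q i \<in> borel_measurable M" for i
      using f[OF Xi(1)] f[OF S(2)] by measurable
    show "AE p in M. (\<lambda>i. ?q i p) \<longlonglongrightarrow> f' x p"
      using deriv[OF S(2)] X
      unfolding has_vector_derivative_iff_quotient tendsto_at_iff_sequentially comp_def by auto
    show "AE p in M. norm (?q i p) \<le> B p" for i
    proof (rule AE_I2)
      fix p
      have B0: "0 \<le> B p" using bound[OF S(2), of p] by (meson norm_ge_zero order_trans)
      have "norm (f (X i) p - f x p) \<le> B p * norm (X i - x)"
      proof (rule differentiable_bound[OF S(1) _ _ Xi(1) S(2)])
        fix h assume h: "h \<in> S"
        show "((\<lambda>h. f h p) has_derivative (\<lambda>t. t *\<^sub>R f' h p)) (at h within S)"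
          using deriv[OF h] by (simp add: has_vector_derivative_def)
        show "onorm (\<lambda>t. t *\<^sub>R f' h p) \<le> B p"
          using bound[OF h, of p] by (intro onorm_bound[OF B0]) (simp add: mult.commute[of "B p"] mult_left_mono)
      qed
      then show "norm (?q i p) \<le> B p" using Xi(2)[of i] by (simp add: divide_simps mult.commute)
    qed
  qed
  moreover have "(\<integral>p. ?q i p \<partial>M) = ((\<integral>p. f (X i) p \<partial>M) - (\<integral>p. f x p \<partial>M)) /\<^sub>R (X i - x)" for i
    using f[OF Xi(1)] f[OF S(2)] by (subst Bochner_Integration.integral_diff[symmetric]) auto
  ultimately show "(\<lambda>i. ((\<integral>p. f (X i) p \<partial>M) - (\<integral>p. f x p \<partial>M)) /\<^sub>R (X i - x)) \<longlonglongrightarrow> (\<integral>p. f' x p \<partial>M)"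
    by (simp only:)
qed

lemma integral_translate:
  fixes G :: "'a::euclidean_space \<Rightarrow> 'b::{banach, second_countable_topology}"
  assumes [measurable]: "G \<in> borel_measurable borel"
  shows "(\<integral>p. G (p + e) \<partial>lborel) = (\<integral>p. G p \<partial>lborel)"
    and "integrable lborel (\<lambda>p. G (p + e)) \<longleftrightarrow> integrable lborel G"
proof -
  have "(\<integral>p. G p \<partial>lborel) = (\<integral>p. G p \<partial>distr lborel borel ((+) e))"
    by (simp add: lborel_distr_plus)
  also have "\<dots> = (\<integral>p. G (e + p) \<partial>lborel)"
    by (subst integral_distr) auto
  finally show "(\<integral>p. G (p + e) \<partial>lborel) = (\<integral>p. G p \<partial>lborel)" by (simp add: add.commute)
  have "integrable lborel G \<longleftrightarrow> integrable (distr lborel borel ((+) e)) G"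
    by (simp add: lborel_distr_plus)
  also have "\<dots> \<longleftrightarrow> integrable lborel (\<lambda>p. G (e + p))"
    by (subst integrable_distr_eq) auto
  finally show "integrable lborel (\<lambda>p. G (p + e)) \<longleftrightarrow> integrable lborel G"
    by (simp add: add.commute)
qed

section \<open>Real Gaussian integrals in finite dimension\<close>

lemma has_bochner_integral_gaussian_1d:
  assumes "k > (0::real)"
  shows "has_bochner_integral lborel (\<lambda>x::real. exp (- (k * x\<^sup>2))) (sqrt (pi / k))"
proof -
  let ?s = "sqrt (1 / (2 * k))"
  have s: "?s\<^sup>2 = 1 / (2 * k)" using assms by simp
  have "has_bochner_integral lborel (normal_density 0 ?s) 1"
    using assms by (simp add: has_bochner_integral_iff)
  then have "has_bochner_integral lborel (\<lambda>x. sqrt (pi / k) * normal_density 0 ?s x) (sqrt (pi / k) * 1)"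
    by (rule has_bochner_integral_mult_right)
  moreover have "sqrt (pi / k) * normal_density 0 ?s x = exp (- (k * x\<^sup>2))" for x
    using assms by (simp add: normal_density_def s real_sqrt_divide field_simps)
  ultimately show ?thesis by simp
qed

lemma has_bochner_integral_gaussian:
  assumes "k > (0::real)"
  shows "has_bochner_integral lborel (\<lambda>p::'a::euclidean_space. exp (- (k * (norm p)\<^sup>2)))
    (sqrt (pi / k) ^ DIM('a))"
proof -
  interpret product_sigma_finite "\<lambda>_::'a. lborel :: real measure"
    by standard
  let ?g = "\<lambda>x::real. exp (- (k * x\<^sup>2))"
  have g: "integrable lborel ?g" "(\<integral>x. ?g x \<partial>lborel) = sqrt (pi / k)"
    using has_bochner_integral_gaussian_1d[OF assms] by (auto simp: has_bochner_integral_iff)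
  have eq: "exp (- (k * (norm (\<Sum>b\<in>Basis. f b *\<^sub>R b))\<^sup>2)) = (\<Prod>b\<in>Basis. ?g (f b))" for f :: "'a \<Rightarrow> real"
  proof -
    have "(norm (\<Sum>b\<in>Basis. f b *\<^sub>R b))\<^sup>2 = (\<Sum>b\<in>Basis. (f b)\<^sup>2)"
      unfolding power2_norm_eq_inner by (subst euclidean_inner) (simp add: power2_eq_square)
    then show ?thesis by (simp add: sum_distrib_left exp_sum[symmetric] sum_negf[symmetric])
  qed
  have "has_bochner_integral (\<Pi>\<^sub>M b\<in>Basis. lborel) (\<lambda>f::'a \<Rightarrow> real. \<Prod>b\<in>Basis. ?g (f b)) (sqrt (pi / k) ^ DIM('a))"
    unfolding has_bochner_integral_iff using g(1)
    by (intro conjI product_integrable_prod, simp_all) (subst product_integral_prod, simp_all add: g(2))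
  then show ?thesis
    unfolding eq[symmetric]
    by (subst lborel_eq) (subst has_bochner_integral_distr; measurable)
qed

section \<open>Complex vectors, sesquilinear forms and coercivity\<close>

definition cvec :: "real ^ 'm::finite coord \<Rightarrow> complex ^ 'm" where
  "cvec p = (\<chi> x. Complex (p $ UC x) (p $ VC x))"

text \<open>Linear in the first argument and conjugate-linear in the second: at
  \<open>z = w = cvec p\<close> it is the bosonic action phi V phibar.\<close>

definition sesq :: "complex ^ 'm ^ 'm \<Rightarrow> complex ^ 'm::finite \<Rightarrow> complex ^ 'm \<Rightarrow> complex" where
  "sesq V z w = (\<Sum>x\<in>UNIV. \<Sum>y\<in>UNIV. z $ x * V $ x $ y * cnj (w $ y))"

text \<open>The fixed constant 1 gives one Gaussian majorant for all such matrices, which makes the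
  estimates uniform along segments and over frequencies.\<close>

definition coercive :: "complex ^ 'm::finite ^ 'm \<Rightarrow> bool" where
  "coercive V \<longleftrightarrow> (\<forall>z. (norm z)\<^sup>2 \<le> Re (sesq V z z))"

lemma sum_coord: "(\<Sum>c\<in>(UNIV::'m::finite coord set). f c) = (\<Sum>x\<in>UNIV. f (UC x) + f (VC x))"
  by (subst UNIV_coord, subst sum.union_disjoint)
     (auto simp: sum.reindex inj_def sum.distrib)

lemma norm_cvec [simp]: "norm (cvec p) = norm p"
proof -
  have "(norm (cvec p))\<^sup>2 = (norm p)\<^sup>2"
    by (simp add: norm_vec_def L2_set_def sum_nonneg cvec_def cmod_power2 sum_coord)
  then show ?thesis by simp
qed

lemma norm_cvec_nth_le: "norm (cvec p $ x) \<le> norm p"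
  using Finite_Cartesian_Product.norm_nth_le[of "cvec p" x] by simp

lemma cvec_add: "cvec (p + q) = cvec p + cvec q"
  and cvec_scaleR: "cvec (h *\<^sub>R p) = h *\<^sub>R cvec p"
  by (simp_all add: cvec_def vec_eq_iff complex_eq_iff)

lemma surj_cvec: "\<exists>p. cvec p = z"
  by (rule exI[of _ "\<chi> c. case c of UC x \<Rightarrow> Re (z $ x) | VC x \<Rightarrow> Im (z $ x)"])
     (simp add: cvec_def vec_eq_iff)

lemma continuous_on_cvec_nth [continuous_intros]: "continuous_on S (\<lambda>p. cvec p $ x)"
  unfolding cvec_def Complex_eq by (simp, intro continuous_intros)

lemma measurable_cvec_nth [measurable]: "(\<lambda>p. cvec p $ x) \<in> borel_measurable borel"
  by (intro borel_measurable_continuous_onI continuous_intros)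

lemma measurable_cnj [measurable (raw)]:
  "f \<in> borel_measurable M \<Longrightarrow> (\<lambda>x. cnj (f x)) \<in> borel_measurable M"
  by (rule borel_measurable_continuous_on) (intro continuous_intros)

lemma norm_sesq_le: "norm (sesq V z w) \<le> (\<Sum>x\<in>UNIV. \<Sum>y\<in>UNIV. norm (V $ x $ y)) * norm z * norm w"
proof -
  have "norm (sesq V z w) \<le> (\<Sum>x\<in>UNIV. \<Sum>y\<in>UNIV. norm (z $ x * V $ x $ y * cnj (w $ y)))"
    unfolding sesq_def by (rule order_trans[OF norm_sum], rule sum_mono, rule norm_sum)
  also have "\<dots> \<le> (\<Sum>x\<in>UNIV. \<Sum>y\<in>UNIV. norm (V $ x $ y) * norm z * norm w)"
  proof (intro sum_mono)
    fix x y
    have "norm (z $ x) * norm (V $ x $ y) * norm (w $ y) \<le> norm z * norm (V $ x $ y) * norm w"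
      by (intro mult_mono Finite_Cartesian_Product.norm_nth_le) auto
    then show "norm (z $ x * V $ x $ y * cnj (w $ y)) \<le> norm (V $ x $ y) * norm z * norm w"
      unfolding norm_mult complex_mod_cnj by (simp only: mult_ac)
  qed
  finally show ?thesis by (simp add: sum_distrib_right)
qed

lemma sesq_simps:
  fixes z w z' w' :: "complex ^ 'm::finite"
  shows
  "sesq V (z + z') w = sesq V z w + sesq V z' w"
  "sesq V z (w + w') = sesq V z w + sesq V z w'"
  "sesq V (h *\<^sub>R z) w = of_real h * sesq V z w"
  "sesq V z (h *\<^sub>R w) = of_real h * sesq V z w"
  "sesq (V + W) z w = sesq V z w + sesq W z w"
  "sesq (V - W) z w = sesq V z w - sesq W z w"
  "sesq (h *\<^sub>R V) z w = of_real h * sesq V z w"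
  unfolding sesq_def vector_add_component vector_minus_component vector_scaleR_component
  by (simp_all add: algebra_simps sum.distrib sum_subtractf sum_distrib_left scaleR_conv_of_real)

lemma continuous_on_sesq_cvec [continuous_intros]: "continuous_on S (\<lambda>p. sesq V (cvec p) (cvec p))"
  unfolding sesq_def by (intro continuous_intros)

lemma measurable_sesq_cvec [measurable]: "(\<lambda>p. sesq V (cvec p) (cvec p)) \<in> borel_measurable borel"
  by (intro borel_measurable_continuous_onI continuous_intros)

lemma coercive_norm_exp:
  assumes "coercive V"
  shows "norm (exp (- sesq V (cvec p) (cvec p))) \<le> exp (- (norm p)\<^sup>2)"
  using assms[unfolded coercive_def, rule_format, of "cvec p"] by simp

text \<open>Half of the Gaussian decay is spent on the quadratic prefactor, through x \<le> exp x at
  half the squared radius.\<close>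

lemma poly_exp_bound:
  fixes r :: real
  shows "r\<^sup>2 * exp (- r\<^sup>2) \<le> 2 * exp (- (r\<^sup>2 / 2))"
proof -
  have "r\<^sup>2 / 2 \<le> exp (r\<^sup>2 / 2)" using exp_ge_add_one_self[of "r\<^sup>2/2"] by linarith
  then have "(r\<^sup>2 / 2) * exp (- r\<^sup>2) \<le> exp (r\<^sup>2 / 2) * exp (- r\<^sup>2)" by (intro mult_right_mono) auto
  also have "\<dots> = exp (- (r\<^sup>2 / 2))" by (simp add: exp_add[symmetric])
  finally show ?thesis by simp
qed

section \<open>Partition function and covariance of a complex Gaussian weight\<close>

definition gauss_Z :: "complex ^ 'm::finite ^ 'm \<Rightarrow> complex" where
  "gauss_Z V = (\<integral>p. exp (- sesq V (cvec p) (cvec p)) \<partial>lborel)"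

text \<open>The unnormalised covariance. The conjugate sits on the first index, which makes it a
  multiple of the inverse of \<open>V\<close> and not of the transposed inverse.\<close>

definition gauss_I :: "complex ^ 'm::finite ^ 'm \<Rightarrow> 'm \<Rightarrow> 'm \<Rightarrow> complex" where
  "gauss_I V a b = (\<integral>p. exp (- sesq V (cvec p) (cvec p)) * (cnj (cvec p $ a) * cvec p $ b) \<partial>lborel)"

lemma sesq_mat_1: "sesq (mat 1) z w = (\<Sum>x\<in>UNIV. z $ x * cnj (w $ x))"
proof -
  have "(\<Sum>y\<in>UNIV. z $ x * (mat 1 :: complex ^ 'a ^ 'a) $ x $ y * cnj (w $ y)) = z $ x * cnj (w $ x)" for x
  proof -
    have "(\<Sum>y\<in>UNIV. z $ x * (mat 1 :: complex ^ 'a ^ 'a) $ x $ y * cnj (w $ y))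
      = (\<Sum>y\<in>UNIV. if x = y then z $ x * cnj (w $ y) else 0)"
      by (intro sum.cong) (auto simp: mat_def)
    then show ?thesis by simp
  qed
  then show ?thesis by (simp add: sesq_def)
qed

lemma sesq_mat_1_self: "sesq (mat 1) z z = of_real ((norm z)\<^sup>2)"
  by (simp add: sesq_mat_1 norm_vec_def L2_set_def sum_nonneg complex_norm_square del: of_real_power)

lemma coercive_mat_1: "coercive (mat 1)"
  by (simp add: coercive_def sesq_mat_1_self)

lemma gauss_Z_mat_1: "gauss_Z (mat 1 :: complex ^ 'm::finite ^ 'm) = of_real (pi ^ CARD('m))"
proof -
  have "has_bochner_integral lborel (\<lambda>p::real^('m coord). exp (- (1 * (norm p)\<^sup>2)))
      (sqrt (pi / 1) ^ DIM(real^('m coord)))"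
    by (rule has_bochner_integral_gaussian) simp
  then have "(\<integral>p. exp (- (norm p)\<^sup>2) \<partial>(lborel :: (real^('m coord)) measure)) = sqrt pi ^ (2 * CARD('m))"
    by (simp add: has_bochner_integral_iff card_coord)
  then show ?thesis
    unfolding gauss_Z_def sesq_mat_1_self
    unfolding of_real_minus[symmetric] exp_of_real integral_complex_of_real by (simp add: power_mult)
qed

lemma coercive_convex:
  fixes V W :: "complex ^ 'm::finite ^ 'm"
  assumes "coercive V" "coercive W" "0 \<le> t" "t \<le> (1::real)"
  shows "coercive (V + t *\<^sub>R (W - V))"
  unfolding coercive_def
proof
  fix z :: "complex ^ 'm"
  have "(norm z)\<^sup>2 = (1 - t) * (norm z)\<^sup>2 + t * (norm z)\<^sup>2" by (simp add: algebra_simps)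
  also have "\<dots> \<le> (1 - t) * Re (sesq V z z) + t * Re (sesq W z z)"
    using assms by (intro add_mono mult_left_mono) (auto simp: coercive_def)
  also have "\<dots> = Re (sesq (V + t *\<^sub>R (W - V)) z z)" by (simp add: sesq_simps algebra_simps)
  finally show "(norm z)\<^sup>2 \<le> Re (sesq (V + t *\<^sub>R (W - V)) z z)" .
qed


lemma gauss_integrable_bound:
  fixes k :: real
  assumes "0 < k"
  shows "integrable lborel (\<lambda>p::'a::euclidean_space. C * exp (- (k * (norm p)\<^sup>2)))"
  using has_bochner_integral_gaussian[OF assms] by (auto simp: has_bochner_integral_iff)

lemma gauss_quadratic_bound:
  assumes "coercive V" and h: "norm h \<le> norm p * norm p"
  shows "norm (exp (- sesq V (cvec p) (cvec p)) * h) \<le> 2 * exp (- (1 / 2 * (norm p)\<^sup>2))"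
proof -
  have "norm (exp (- sesq V (cvec p) (cvec p)) * h) \<le> exp (- (norm p)\<^sup>2) * (norm p * norm p)"
    unfolding norm_mult using h by (intro mult_mono coercive_norm_exp assms) auto
  also have "\<dots> \<le> 2 * exp (- (1 / 2 * (norm p)\<^sup>2))"
    using poly_exp_bound[of "norm p"] by (simp add: power2_eq_square mult_ac)
  finally show ?thesis .
qed

lemma gauss_integrable:
  assumes "coercive V"
  shows "integrable lborel (\<lambda>p. exp (- sesq V (cvec p) (cvec p)))"
  by (rule Bochner_Integration.integrable_bound[OF gauss_integrable_bound[of 1 1]])
     (use coercive_norm_exp[OF assms] in auto)

lemma gauss_integrable_quadratic:
  assumes "coercive V" and [measurable]: "h \<in> borel_measurable borel"
    and h: "\<And>p. norm (h p) \<le> norm p * norm p"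
  shows "integrable lborel (\<lambda>p. exp (- sesq V (cvec p) (cvec p)) * h p)"
  by (rule Bochner_Integration.integrable_bound[OF gauss_integrable_bound[of "1/2" 2]])
     (use gauss_quadratic_bound[OF assms(1) h] in auto)

lemma norm_cvec_mult_le:
  "norm (cvec p $ x * cnj (cvec p $ y)) \<le> norm p * norm p"
  "norm (cnj (cvec p $ x) * cvec p $ y) \<le> norm p * norm p"
  "norm (cvec p $ x * cvec p $ y) \<le> norm p * norm p"
  unfolding norm_mult complex_mod_cnj by (auto intro!: mult_mono norm_cvec_nth_le)

text \<open>By translation invariance the integral of \<open>G (p + h *\<^sub>R e)\<close> does not
  depend on \<open>h\<close>; differentiating under the integral sign at \<open>h = 0\<close> gives
  zero, with no boundary terms to discuss.\<close>

lemma integral_directional_derivative_eq_0: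
  fixes G G' :: "'a::euclidean_space \<Rightarrow> complex"
  assumes [measurable]: "G \<in> borel_measurable borel" "G' \<in> borel_measurable borel"
    and G: "integrable lborel G"
    and deriv: "\<And>p. ((\<lambda>h. G (p + h *\<^sub>R e)) has_vector_derivative G' p) (at 0)"
    and bound: "\<And>p. norm (G' p) \<le> C * exp (- (k * (norm p)\<^sup>2))"
    and k: "0 < k"
  shows "(\<integral>p. G' p \<partial>lborel) = 0"
proof -
  have deriv': "((\<lambda>h. G (p + h *\<^sub>R e)) has_vector_derivative G' (p + h *\<^sub>R e)) (at h)" for p h
  proof -
    have "((\<lambda>t. G ((p + h *\<^sub>R e) + t *\<^sub>R e)) has_vector_derivative G' (p + h *\<^sub>R e)) (at (h - h))"
      using deriv by simp
    moreover have "((\<lambda>t. t - h) has_vector_derivative 1) (at h)"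
      by (auto intro!: derivative_eq_intros)
    ultimately have "((\<lambda>t. G ((p + h *\<^sub>R e) + t *\<^sub>R e)) \<circ> (\<lambda>t. t - h) has_vector_derivative 1 *\<^sub>R G' (p + h *\<^sub>R e)) (at h)"
      by (intro vector_diff_chain_at)
    then show ?thesis
      by (simp add: o_def algebra_simps)
  qed
  have C: "0 \<le> C"
  proof -
    have "0 \<le> C * exp (- (k * (norm (0::'a))\<^sup>2))" using bound by (rule order_trans[OF norm_ge_zero])
    then show ?thesis by simp
  qed
  \<comment> \<open>For \<open>h\<close> in [-1, 1], |p|^2 is at most 2 |p + h e|^2 + 2 |e|^2, so
    the bound at the shifted point is dominated by a Gaussian of half the rate, independent of
    \<open>h\<close>; the factor exp(k |e|^2) pays for the shift.\<close>
  have "((\<lambda>h. \<integral>p. G (p + h *\<^sub>R e) \<partial>lborel) has_vector_derivative (\<integral>p. G' (p + 0 *\<^sub>R e) \<partial>lborel)) (at 0 within {-1..1})"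
  proof (rule has_vector_derivative_integral[where B="\<lambda>p. (C * exp (k * (norm e)\<^sup>2)) * exp (- (k / 2 * (norm p)\<^sup>2))"])
    show "integrable lborel (\<lambda>p::'a. (C * exp (k * (norm e)\<^sup>2)) * exp (- (k / 2 * (norm p)\<^sup>2)))"
      using k by (intro gauss_integrable_bound) simp
    fix h :: real and p assume h: "h \<in> {-1..1}"
    show "((\<lambda>h. G (p + h *\<^sub>R e)) has_vector_derivative G' (p + h *\<^sub>R e)) (at h within {- 1..1})"
      by (rule has_vector_derivative_at_within[OF deriv'])
    have "norm p = norm ((p + h *\<^sub>R e) + (- h) *\<^sub>R e)" by simp
    also have "\<dots> \<le> norm (p + h *\<^sub>R e) + norm ((- h) *\<^sub>R e)" by (rule norm_triangle_ineq)
    also have "\<dots> \<le> norm (p + h *\<^sub>R e) + norm e"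
      using h by (auto simp: abs_le_iff intro: mult_left_le_one_le)
    finally have "(norm p)\<^sup>2 \<le> (norm (p + h *\<^sub>R e) + norm e)\<^sup>2" by (simp add: power_mono)
    also have "\<dots> \<le> 2 * (norm (p + h *\<^sub>R e))\<^sup>2 + 2 * (norm e)\<^sup>2"
      using sum_squares_bound[of "norm (p + h *\<^sub>R e)" "norm e"] by (simp add: power2_sum)
    finally have "k * (norm p)\<^sup>2 \<le> k * (2 * (norm (p + h *\<^sub>R e))\<^sup>2 + 2 * (norm e)\<^sup>2)"
      using k by simp
    then have "exp (- (k * (norm (p + h *\<^sub>R e))\<^sup>2)) \<le> exp (k * (norm e)\<^sup>2) * exp (- (k / 2 * (norm p)\<^sup>2))"
      by (simp add: exp_add[symmetric] algebra_simps)
    then have "C * exp (- (k * (norm (p + h *\<^sub>R e))\<^sup>2)) \<le> C * (exp (k * (norm e)\<^sup>2) * exp (- (k / 2 * (norm p)\<^sup>2)))"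
      using C by (rule mult_left_mono)
    then show "norm (G' (p + h *\<^sub>R e)) \<le> (C * exp (k * (norm e)\<^sup>2)) * exp (- (k / 2 * (norm p)\<^sup>2))"
      using bound[of "p + h *\<^sub>R e"] by (simp add: mult.assoc)
  qed (use G in \<open>auto simp: integral_translate\<close>)
  then have "((\<lambda>h::real. \<integral>p. G p \<partial>lborel) has_vector_derivative (\<integral>p. G' p \<partial>lborel)) (at 0 within {-1..1})"
    by (simp add: integral_translate)
  moreover have "((\<lambda>h::real. \<integral>p. G p \<partial>lborel) has_vector_derivative 0) (at 0 within {-1..1})"
    by (rule has_vector_derivative_const)
  ultimately show ?thesis
    by (rule vector_derivative_unique_within[rotated]) (simp add: trivial_limit_within islimpt_Icc)
qed


lemma has_vector_derivative_sesq:
  "((\<lambda>h. sesq V (cvec (p + h *\<^sub>R e)) (cvec (p + h *\<^sub>R e))) has_vector_derivative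
    sesq V (cvec e) (cvec p) + sesq V (cvec p) (cvec e)) (at 0)"
proof -
  have "(\<lambda>h. sesq V (cvec (p + h *\<^sub>R e)) (cvec (p + h *\<^sub>R e))) =
     (\<lambda>h. sesq V (cvec p) (cvec p) + of_real h * (sesq V (cvec e) (cvec p) + sesq V (cvec p) (cvec e))
        + of_real h * of_real h * sesq V (cvec e) (cvec e))"
    by (simp add: cvec_add cvec_scaleR sesq_simps algebra_simps)
  then show ?thesis
    by (auto intro!: derivative_eq_intros)
qed

lemma sesq_axis_left: "sesq V (axis z \<alpha>) w = \<alpha> * (\<Sum>y\<in>UNIV. V $ z $ y * cnj (w $ y))"
proof -
  have "sesq V (axis z \<alpha>) w = (\<Sum>x\<in>UNIV. if x = z then \<alpha> * (\<Sum>y\<in>UNIV. V $ z $ y * cnj (w $ y)) else 0)"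
    unfolding sesq_def by (intro sum.cong) (auto simp: axis_def sum_distrib_left mult.assoc)
  then show ?thesis by simp
qed

lemma sesq_axis_right: "sesq V w (axis z \<alpha>) = cnj \<alpha> * (\<Sum>x\<in>UNIV. w $ x * V $ x $ z)"
proof -
  have "sesq V w (axis z \<alpha>) = (\<Sum>x\<in>UNIV. \<Sum>y\<in>UNIV. if y = z then w $ x * V $ x $ z * cnj \<alpha> else 0)"
    unfolding sesq_def by (intro sum.cong) (auto simp: axis_def)
  then show ?thesis by (simp add: sum_distrib_left mult_ac)
qed

text \<open>Integration by parts for exp(- phi V phibar) phi_b along a real direction
  \<open>e\<close> that moves phi_z alone, by \<alpha>. The values 1 and i of \<alpha> are the
  directions u_z and v_z.\<close>

lemma gauss_ibp_direction:
  assumes V: "coercive V" and e: "cvec e = axis z \<alpha>"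
  shows "(\<integral>p. exp (- sesq V (cvec p) (cvec p)) * (axis z \<alpha> $ b
     - cvec p $ b * (sesq V (cvec e) (cvec p) + sesq V (cvec p) (cvec e))) \<partial>lborel) = 0"
proof -
  let ?E = "\<lambda>p. exp (- sesq V (cvec p) (cvec p))"
  let ?D = "\<lambda>p. sesq V (cvec e) (cvec p) + sesq V (cvec p) (cvec e)"
  let ?n = "\<Sum>x\<in>UNIV. \<Sum>y\<in>UNIV. norm (V $ x $ y)"
  let ?C = "norm \<alpha> + 4 * ?n * norm e"
  have n0: "0 \<le> ?n" by (intro sum_nonneg) auto
  have [measurable]: "(\<lambda>p. sesq V (cvec e) (cvec p)) \<in> borel_measurable borel"
      "(\<lambda>p. sesq V (cvec p) (cvec e)) \<in> borel_measurable borel"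
    unfolding sesq_def by measurable
  show ?thesis
  proof (rule integral_directional_derivative_eq_0[where G="\<lambda>p. ?E p * cvec p $ b" and e=e and k="1/2" and C="?C"])
    have "norm (?E p * cvec p $ b) \<le> 2 * exp (- (1 / 2 * (norm p)\<^sup>2))" for p
    proof -
      have "norm (?E p * cvec p $ b) \<le> exp (- (norm p)\<^sup>2) * norm p"
        unfolding norm_mult by (intro mult_mono coercive_norm_exp V norm_cvec_nth_le) auto
      also have "\<dots> \<le> exp (- (norm p)\<^sup>2) * exp (1 / 2 * (norm p)\<^sup>2)"
      proof (intro mult_left_mono)
        have "norm p \<le> 1 + 1 / 2 * (norm p)\<^sup>2"
          using zero_le_power2[of "norm p - 1"] by (simp add: power2_diff)
        also have "\<dots> \<le> exp (1 / 2 * (norm p)\<^sup>2)" by (rule exp_ge_add_one_self)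
        finally show "norm p \<le> exp (1 / 2 * (norm p)\<^sup>2)" .
      qed simp
      also have "\<dots> = exp (- (1 / 2 * (norm p)\<^sup>2))" by (simp add: exp_add[symmetric])
      also have "\<dots> \<le> 2 * \<dots>" by simp
      finally show ?thesis .
    qed
    then show "integrable lborel (\<lambda>p. ?E p * cvec p $ b)"
      by (intro Bochner_Integration.integrable_bound[OF gauss_integrable_bound[of "1/2" 2]]) auto
    fix p
    have cv: "cvec (p + h *\<^sub>R e) $ b = cvec p $ b + of_real h * axis z \<alpha> $ b" for h
      by (simp only: cvec_add cvec_scaleR e vector_add_component vector_scaleR_component)
         (simp add: scaleR_conv_of_real)
    have "((\<lambda>h. exp (- sesq V (cvec (p + h *\<^sub>R e)) (cvec (p + h *\<^sub>R e)))) has_vector_derivative - ?D p * ?E p) (at 0)"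
      using field_vector_diff_chain_at[OF has_vector_derivative_minus[OF has_vector_derivative_sesq[of V p e]] DERIV_exp]
      by (simp add: o_def mult_ac)
    moreover have "((\<lambda>h. cvec p $ b + of_real h * axis z \<alpha> $ b) has_vector_derivative axis z \<alpha> $ b) (at 0)"
      by (auto intro!: derivative_eq_intros)
    ultimately have "((\<lambda>h. exp (- sesq V (cvec (p + h *\<^sub>R e)) (cvec (p + h *\<^sub>R e))) * (cvec p $ b + of_real h * axis z \<alpha> $ b))
       has_vector_derivative ?E p * axis z \<alpha> $ b + (- ?D p * ?E p) * cvec p $ b) (at 0)"
      by (auto intro!: derivative_eq_intros)
    then show "((\<lambda>h. ?E (p + h *\<^sub>R e) * cvec (p + h *\<^sub>R e) $ b) has_vector_derivative
        ?E p * (axis z \<alpha> $ b - cvec p $ b * ?D p)) (at 0)"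
      unfolding cv by (simp add: algebra_simps)
    have "norm (?E p * (axis z \<alpha> $ b - cvec p $ b * ?D p))
        \<le> exp (- (norm p)\<^sup>2) * (norm \<alpha> + norm p * (?n * norm e * norm p + ?n * norm p * norm e))"
    proof (subst norm_mult, intro mult_mono coercive_norm_exp V)
      have "norm (?D p) \<le> ?n * norm e * norm p + ?n * norm p * norm e"
        using norm_sesq_le[of V "cvec e" "cvec p"] norm_sesq_le[of V "cvec p" "cvec e"]
        by (intro order_trans[OF norm_triangle_ineq] add_mono) auto
      then have "norm (cvec p $ b * ?D p) \<le> norm p * (?n * norm e * norm p + ?n * norm p * norm e)"
        unfolding norm_mult by (intro mult_mono norm_cvec_nth_le) auto
      moreover have "norm (axis z \<alpha> $ b) \<le> norm \<alpha>" by (simp add: axis_def)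
      ultimately show "norm (axis z \<alpha> $ b - cvec p $ b * ?D p)
          \<le> norm \<alpha> + norm p * (?n * norm e * norm p + ?n * norm p * norm e)"
        using norm_triangle_ineq4[of "axis z \<alpha> $ b" "cvec p $ b * ?D p"] by linarith
    qed auto
    also have "\<dots> = norm \<alpha> * exp (- (norm p)\<^sup>2) + 2 * (?n * norm e) * ((norm p)\<^sup>2 * exp (- (norm p)\<^sup>2))"
      by (simp add: algebra_simps power2_eq_square)
    also have "\<dots> \<le> norm \<alpha> * exp (- (1 / 2 * (norm p)\<^sup>2)) + 2 * (?n * norm e) * (2 * exp (- (1 / 2 * (norm p)\<^sup>2)))"
      using n0 poly_exp_bound[of "norm p"] by (intro add_mono mult_left_mono) auto
    also have "\<dots> = ?C * exp (- (1 / 2 * (norm p)\<^sup>2))" by (simp add: algebra_simps)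
    finally show "norm (?E p * (axis z \<alpha> $ b - cvec p $ b * ?D p)) \<le> ?C * exp (- (1 / 2 * (norm p)\<^sup>2))" .
  qed (measurable; simp)+
qed

text \<open>Adding the identities for the directions \<open>u_z\<close> and \<open>v_z\<close> with weights \<open>1\<close> and \<open>- \<i>\<close> isolates
  the derivative with respect to \<open>\<phi>_z\<close>.\<close>

lemma gauss_ibp:
  assumes V: "coercive V"
  shows "(\<Sum>a\<in>UNIV. V $ z $ a * gauss_I V a b) = (if z = b then gauss_Z V else 0)"
proof -
  let ?E = "\<lambda>p. exp (- sesq V (cvec p) (cvec p))"
  let ?P = "\<lambda>p. \<Sum>y\<in>UNIV. V $ z $ y * cnj (cvec p $ y)"
  let ?Q = "\<lambda>p. \<Sum>x\<in>UNIV. cvec p $ x * V $ x $ z"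
  obtain e1 e2 where e: "cvec e1 = axis z 1" "cvec e2 = axis z \<i>" using surj_cvec by metis
  let ?\<delta> = "(if z = b then 1 else 0 :: complex)"
  let ?f = "\<lambda>p. ?E p * (cvec p $ b * ?P p)" and ?g = "\<lambda>p. ?E p * (cvec p $ b * ?Q p)"
  have f_eq: "?f = (\<lambda>p. \<Sum>y\<in>UNIV. V $ z $ y * (?E p * (cnj (cvec p $ y) * cvec p $ b)))"
    by (simp add: fun_eq_iff sum_distrib_left mult_ac)
  have g_eq: "?g = (\<lambda>p. \<Sum>y\<in>UNIV. V $ y $ z * (?E p * (cvec p $ y * cvec p $ b)))"
    by (simp add: fun_eq_iff sum_distrib_left mult_ac)
  have E: "integrable lborel (\<lambda>p. ?E p * ?\<delta>)"
    by (intro integrable_mult_left gauss_integrable V)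
  have f: "integrable lborel ?f"
    unfolding f_eq
    by (intro Bochner_Integration.integrable_sum integrable_mult_right gauss_integrable_quadratic[OF V]
        norm_cvec_mult_le) measurable
  have g: "integrable lborel ?g"
    unfolding g_eq
    by (intro Bochner_Integration.integrable_sum integrable_mult_right gauss_integrable_quadratic[OF V]
        norm_cvec_mult_le) measurable
  have ax: "axis z \<alpha> $ b = \<alpha> * ?\<delta>" for \<alpha> by (auto simp: axis_def)
  have I1: "(\<integral>p. ?E p * (1 * ?\<delta> - cvec p $ b * (1 * ?P p + cnj 1 * ?Q p)) \<partial>lborel) = 0"
    using gauss_ibp_direction[OF V e(1), of b] by (simp only: e(1) sesq_axis_left sesq_axis_right ax)
  have I2: "(\<integral>p. ?E p * (\<i> * ?\<delta> - cvec p $ b * (\<i> * ?P p + cnj \<i> * ?Q p)) \<partial>lborel) = 0"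
    using gauss_ibp_direction[OF V e(2), of b] by (simp only: e(2) sesq_axis_left sesq_axis_right ax)
  have lin: "(\<integral>p. ?E p * (\<alpha> * ?\<delta> - cvec p $ b * (\<alpha> * ?P p + cnj \<alpha> * ?Q p)) \<partial>lborel)
      = \<alpha> * (\<integral>p. ?E p * ?\<delta> \<partial>lborel) - \<alpha> * (\<integral>p. ?f p \<partial>lborel) - cnj \<alpha> * (\<integral>p. ?g p \<partial>lborel)" for \<alpha>
  proof -
    have "(\<lambda>p. ?E p * (\<alpha> * ?\<delta> - cvec p $ b * (\<alpha> * ?P p + cnj \<alpha> * ?Q p)))
        = (\<lambda>p. \<alpha> * (?E p * ?\<delta>) - \<alpha> * ?f p - cnj \<alpha> * ?g p)"
      by (simp only: fun_eq_iff) (simp only: algebra_simps, simp)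
    moreover have "has_bochner_integral lborel (\<lambda>p. \<alpha> * (?E p * ?\<delta>) - \<alpha> * ?f p - cnj \<alpha> * ?g p)
       (\<alpha> * (\<integral>p. ?E p * ?\<delta> \<partial>lborel) - \<alpha> * (\<integral>p. ?f p \<partial>lborel) - cnj \<alpha> * (\<integral>p. ?g p \<partial>lborel))"
      by (intro has_bochner_integral_diff has_bochner_integral_mult_right has_bochner_integral_integrable E f g)
    ultimately show ?thesis by (simp only: has_bochner_integral_integral_eq)
  qed
  have "(\<integral>p. ?E p * ?\<delta> \<partial>lborel) = (\<integral>p. ?f p \<partial>lborel)"
  proof -
    let ?e = "\<integral>p. ?E p * ?\<delta> \<partial>lborel" and ?F = "\<integral>p. ?f p \<partial>lborel" and ?G = "\<integral>p. ?g p \<partial>lborel"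
    have a: "1 * ?e - 1 * ?F - cnj 1 * ?G = 0" using I1 unfolding lin .
    have b: "\<i> * ?e - \<i> * ?F - cnj \<i> * ?G = 0" using I2 unfolding lin .
    have "e = F" if "1 * e - 1 * F - cnj 1 * G = 0" "\<i> * e - \<i> * F - cnj \<i> * G = 0" for e F G :: complex
      using that by (simp add: complex_eq_iff)
    from this[OF a b] show ?thesis .
  qed
  moreover have "(\<integral>p. ?f p \<partial>lborel) = (\<Sum>a\<in>UNIV. V $ z $ a * gauss_I V a b)"
    unfolding f_eq gauss_I_def
    by (subst Bochner_Integration.integral_sum)
       (auto intro!: integrable_mult_right gauss_integrable_quadratic[OF V] norm_cvec_mult_le)
  moreover have "(\<integral>p. ?E p * ?\<delta> \<partial>lborel) = (if z = b then gauss_Z V else 0)"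
    by (simp add: gauss_Z_def)
  ultimately show ?thesis by (simp only:)
qed


section \<open>The covariance as inverse matrix and the derivative of the partition function\<close>

lemma coercive_invertible:
  fixes V :: "complex ^ 'm::finite ^ 'm"
  assumes "coercive V"
  obtains U where "U ** V = mat 1" "V ** U = mat 1"
proof -
  have "w = 0" if "V *v w = 0" for w
  proof -
    \<comment> \<open>\<open>sesq\<close> conjugates its second argument, so the test vector is the
      conjugate of \<open>w\<close>; the form then contains \<open>V *v w\<close> as a
      factor.\<close>
    let ?c = "\<chi> i. cnj (w $ i)"
    have "sesq V ?c ?c = (\<Sum>x\<in>UNIV. cnj (w $ x) * (V *v w) $ x)"
      by (simp add: sesq_def matrix_vector_mult_def sum_distrib_left mult.assoc)
    then have "(norm ?c)\<^sup>2 \<le> 0" using assms[unfolded coercive_def, rule_format, of ?c] that by simp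
    then have "?c = 0" by simp
    then show "w = 0" by (simp add: vec_eq_iff)
  qed
  then have "inj ((*v) V)" by (simp add: vec.inj_iff_eq_0)
  then show ?thesis using that
    by (metis matrix_left_invertible_injective matrix_left_right_inverse)
qed

text \<open>\<open>gauss_ibp\<close> says that \<open>V\<close> times the matrix of the
  \<open>gauss_I V a b\<close> is \<open>gauss_Z V\<close> times the identity; a left inverse of
  \<open>V\<close> solves this whether or not \<open>gauss_Z V\<close> vanishes.\<close>

lemma gauss_I_eq:
  fixes U V :: "complex ^ 'm::finite ^ 'm"
  assumes V: "coercive V" and U: "U ** V = mat 1"
  shows "gauss_I V a b = U $ a $ b * gauss_Z V"
proof -
  let ?I = "(\<chi> a b. gauss_I V a b) :: complex ^ 'm ^ 'm"
  have VI: "V ** ?I = (\<chi> a b. if a = b then gauss_Z V else 0)"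
    by (simp add: matrix_matrix_mult_def gauss_ibp[OF V])
  have "?I = (U ** V) ** ?I" by (simp add: U)
  also have "\<dots> = U ** (\<chi> a b. if a = b then gauss_Z V else 0)"
    by (simp add: VI flip: matrix_mul_assoc)
  finally have "?I $ a $ b = (U ** (\<chi> a b. if a = b then gauss_Z V else 0)) $ a $ b" by simp
  then show ?thesis
    by (simp add: matrix_matrix_mult_def if_distrib[of "\<lambda>x. _ * x"] cong: if_cong)
qed

text \<open>The derivative brings down minus \<open>sesq (W - V)\<close>, whose integral is the
  trace of \<open>W - V\<close> times the matrix of \<open>gauss_I\<close>; hence the transposed
  indices \<open>y x\<close>. Convexity of coercivity supplies one majorant for the whole
  segment.\<close>

lemma gauss_Z_deriv:
  fixes V W :: "complex ^ 'm::finite ^ 'm"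
  assumes V: "coercive V" and W: "coercive W" and t: "t \<in> {0..1}"
  shows "((\<lambda>t. gauss_Z (V + t *\<^sub>R (W - V))) has_vector_derivative
    - (\<Sum>x\<in>UNIV. \<Sum>y\<in>UNIV. (W - V) $ x $ y * gauss_I (V + t *\<^sub>R (W - V)) y x)) (at t within {0..1})"
proof -
  let ?V = "\<lambda>t. V + t *\<^sub>R (W - V)"
  let ?E = "\<lambda>t p. exp (- sesq (?V t) (cvec p) (cvec p))"
  let ?D = "\<lambda>p. sesq (W - V) (cvec p) (cvec p)"
  let ?n = "\<Sum>x\<in>UNIV. \<Sum>y\<in>UNIV. norm ((W - V) $ x $ y)"
  have c: "coercive (?V t)" if "t \<in> {0..1}" for t
    using that by (intro coercive_convex V W) auto
  have n0: "0 \<le> ?n" by (intro sum_nonneg) auto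
  have "((\<lambda>t. gauss_Z (?V t)) has_vector_derivative (\<integral>p. - ?D p * ?E t p \<partial>lborel)) (at t within {0..1})"
    unfolding gauss_Z_def
  proof (rule has_vector_derivative_integral[where B = "\<lambda>p. ?n * (2 * exp (- (1 / 2 * (norm p)\<^sup>2)))"])
    fix h :: real and p assume h: "h \<in> {0..1}"
    have "((\<lambda>h. - (sesq V (cvec p) (cvec p) + of_real h * ?D p)) has_vector_derivative - ?D p) (at h within {0..1})"
      by (auto intro!: derivative_eq_intros)
    from field_vector_diff_chain_within[OF this DERIV_subset[OF DERIV_exp subset_UNIV]]
    have "((\<lambda>h. exp (- (sesq V (cvec p) (cvec p) + of_real h * ?D p))) has_vector_derivative
        - ?D p * exp (- (sesq V (cvec p) (cvec p) + of_real h * ?D p))) (at h within {0..1})"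
      by (simp add: o_def)
    then show "((\<lambda>h. ?E h p) has_vector_derivative - ?D p * ?E h p) (at h within {0..1})"
      by (simp only: sesq_simps)
    show "norm (- ?D p * ?E h p) \<le> ?n * (2 * exp (- (1 / 2 * (norm p)\<^sup>2)))"
    proof -
      have "norm (- ?D p * ?E h p) = norm (?D p) * norm (?E h p)" by (simp add: norm_mult)
      also have "\<dots> \<le> (?n * norm p * norm p) * exp (- (norm p)\<^sup>2)"
        using norm_sesq_le[of "W - V" "cvec p" "cvec p"] n0
        by (intro mult_mono coercive_norm_exp c h) auto
      also have "\<dots> = ?n * ((norm p)\<^sup>2 * exp (- (norm p)\<^sup>2))" by (simp add: power2_eq_square)
      also have "\<dots> \<le> ?n * (2 * exp (- (1 / 2 * (norm p)\<^sup>2)))"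
        using poly_exp_bound[of "norm p"] n0 by (intro mult_left_mono) auto
      finally show ?thesis .
    qed
    show "integrable lborel (?E h)" by (intro gauss_integrable c h)
  next
    show "integrable lborel (\<lambda>p::real^('m coord). ?n * (2 * exp (- (1 / 2 * (norm p)\<^sup>2))))"
      by (intro integrable_mult_right gauss_integrable_bound[of "1/2" 2]) simp
  qed (use t in \<open>auto\<close>)
  moreover have "(\<integral>p. - ?D p * ?E t p \<partial>lborel)
      = - (\<Sum>x\<in>UNIV. \<Sum>y\<in>UNIV. (W - V) $ x $ y * gauss_I (?V t) y x)"
  proof -
    have "(\<lambda>p. - ?D p * ?E t p)
      = (\<lambda>p. - (\<Sum>x\<in>UNIV. \<Sum>y\<in>UNIV. (W - V) $ x $ y * (?E t p * (cnj (cvec p $ y) * cvec p $ x))))"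
      unfolding sesq_def[of "W - V"]
      by (simp add: fun_eq_iff sum_distrib_left sum_distrib_right mult_ac)
    moreover have "has_bochner_integral lborel
       (\<lambda>p. - (\<Sum>x\<in>UNIV. \<Sum>y\<in>UNIV. (W - V) $ x $ y * (?E t p * (cnj (cvec p $ y) * cvec p $ x))))
       (- (\<Sum>x\<in>UNIV. \<Sum>y\<in>UNIV. (W - V) $ x $ y * gauss_I (?V t) y x))"
      unfolding gauss_I_def
      by (intro has_bochner_integral_minus has_bochner_integral_sum has_bochner_integral_mult_right
          has_bochner_integral_integrable gauss_integrable_quadratic c t norm_cvec_mult_le) measurable
    ultimately show ?thesis by (simp only: has_bochner_integral_integral_eq)
  qed
  ultimately show ?thesis by (simp only:)
qed

section \<open>Row-multilinear forms and Jacobi's formula\<close>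

definition mform :: "(('m \<Rightarrow> 'm) \<Rightarrow> complex) \<Rightarrow> complex ^ 'm ^ 'm::finite \<Rightarrow> complex" where
  "mform \<kappa> V = (\<Sum>f\<in>UNIV. \<kappa> f * (\<Prod>x\<in>UNIV. V $ x $ f x))"

lemma mform_row_sum:
  fixes w :: "'m::finite \<Rightarrow> complex" and r :: "'m \<Rightarrow> complex ^ 'm"
  shows "mform \<kappa> (\<chi> i. if i = j then (\<Sum>k\<in>UNIV. w k *s r k) else V $ i)
    = (\<Sum>k\<in>UNIV. w k * mform \<kappa> (\<chi> i. if i = j then r k else V $ i))"
proof -
  have p: "(\<Prod>x\<in>UNIV. (\<chi> i. if i = j then q else V $ i) $ x $ f x) = q $ f j * (\<Prod>x\<in>UNIV - {j}. V $ x $ f x)"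
    for q :: "complex ^ 'm" and f
    by (subst prod.remove[of _ j]) (auto intro!: prod.cong)
  show ?thesis
    unfolding mform_def p
    by (simp add: sum_distrib_left sum_distrib_right mult_ac) (rule sum.swap)
qed

lemma mform_deriv:
  "((\<lambda>t. mform \<kappa> (V + t *\<^sub>R B)) has_vector_derivative
    (\<Sum>j\<in>UNIV. mform \<kappa> (\<chi> i. if i = j then B $ i else (V + t *\<^sub>R B) $ i))) (at t within S)"
proof -
  have d: "((\<lambda>t. \<Prod>x\<in>UNIV. (V + t *\<^sub>R B) $ x $ f x) has_vector_derivative
     (\<Sum>j\<in>UNIV. B $ j $ f j * (\<Prod>x\<in>UNIV - {j}. (V + t *\<^sub>R B) $ x $ f x))) (at t within S)" for f
    unfolding has_vector_derivative_def
    by (rule has_derivative_eq_rhs, rule has_derivative_prod[where f' = "\<lambda>x y. y *\<^sub>R (B $ x $ f x)"])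
       (auto intro!: derivative_eq_intros simp: scaleR_sum_right fun_eq_iff)
  have p: "(\<Prod>x\<in>UNIV. (\<chi> i. if i = j then B $ i else (V + t *\<^sub>R B) $ i) $ x $ f x)
     = B $ j $ f j * (\<Prod>x\<in>UNIV - {j}. (V + t *\<^sub>R B) $ x $ f x)" for j f
    by (subst prod.remove[of _ j]) (auto intro!: prod.cong)
  have "((\<lambda>t. mform \<kappa> (V + t *\<^sub>R B)) has_vector_derivative
     (\<Sum>f\<in>UNIV. \<kappa> f * (\<Sum>j\<in>UNIV. B $ j $ f j * (\<Prod>x\<in>UNIV - {j}. (V + t *\<^sub>R B) $ x $ f x)))) (at t within S)"
    unfolding mform_def
    by (intro has_vector_derivative_sum has_vector_derivative_mult_right d)
  also have "(\<Sum>f\<in>UNIV. \<kappa> f * (\<Sum>j\<in>UNIV. B $ j $ f j * (\<Prod>x\<in>UNIV - {j}. (V + t *\<^sub>R B) $ x $ f x)))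
     = (\<Sum>j\<in>UNIV. mform \<kappa> (\<chi> i. if i = j then B $ i else (V + t *\<^sub>R B) $ i))"
    unfolding mform_def p by (simp add: sum_distrib_left) (rule sum.swap)
  finally show ?thesis .
qed

lemma matrix_mult_row:
  fixes W V :: "'a::comm_semiring_1 ^ 'm::finite ^ 'm"
  shows "(W ** V) $ j = (\<Sum>k\<in>UNIV. W $ j $ k *s V $ k)"
  by (simp add: vec_eq_iff matrix_matrix_mult_def)

text \<open>Row \<open>j\<close> of \<open>W ** V\<close> is a combination of the rows of
  \<open>V\<close>, and every term except the multiple \<open>W $ j $ j\<close> of row
  \<open>j\<close> repeats a row. Summed over \<open>j\<close> this is Jacobi's formula: the
  derivative in the direction \<open>W ** V\<close> is the trace of \<open>W\<close> times the
  form.\<close>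

lemma mform_replace_row:
  fixes V W :: "complex ^ 'm::finite ^ 'm"
  assumes alt: "\<And>V i j. i \<noteq> j \<Longrightarrow> V $ i = V $ j \<Longrightarrow> mform \<kappa> V = 0"
  shows "mform \<kappa> (\<chi> i. if i = j then (W ** V) $ i else V $ i) = W $ j $ j * mform \<kappa> V"
proof -
  have "(\<chi> i. if i = j then (W ** V) $ i else V $ i)
      = (\<chi> i. if i = j then (\<Sum>k\<in>UNIV. W $ j $ k *s V $ k) else V $ i)"
    by (simp only: vec_eq_iff[of "\<chi> i. _ i"] vec_lambda_beta) (auto simp: matrix_mult_row)
  also have "mform \<kappa> \<dots> = (\<Sum>k\<in>UNIV. W $ j $ k * mform \<kappa> (\<chi> i. if i = j then V $ k else V $ i))"
    by (rule mform_row_sum)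
  also have "\<dots> = (\<Sum>k\<in>UNIV. if k = j then W $ j $ j * mform \<kappa> V else 0)"
  proof (intro sum.cong refl)
    fix k
    show "W $ j $ k * mform \<kappa> (\<chi> i. if i = j then V $ k else V $ i)
        = (if k = j then W $ j $ j * mform \<kappa> V else 0)"
    proof (cases "k = j")
      case True
      then have "(\<chi> i. if i = j then V $ k else V $ i) = V" by (simp add: vec_eq_iff)
      then show ?thesis using True by simp
    next
      case False
      then have "mform \<kappa> (\<chi> i. if i = j then V $ k else V $ i) = 0"
        by (intro alt[of k j]) auto
      then show ?thesis using False by simp
    qed
  qed
  finally show ?thesis by simp
qed

text \<open>The product on the left is constant along the segment from \<open>mat 1\<close> to \<open>V\<close>: the logarithmic
  derivatives of the two factors are minus and plus the trace of the same matrix.\<close>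

theorem gauss_Z_mform:
  fixes V :: "complex ^ 'm::finite ^ 'm"
  assumes V: "coercive V"
    and alt: "\<And>V i j. i \<noteq> j \<Longrightarrow> V $ i = V $ j \<Longrightarrow> mform \<kappa> V = 0"
  shows "gauss_Z V * mform \<kappa> V = of_real (pi ^ CARD('m)) * mform \<kappa> (mat 1)"
proof -
  let ?B = "V - mat 1"
  let ?V = "\<lambda>t. mat 1 + t *\<^sub>R ?B"
  let ?F = "\<lambda>t. gauss_Z (?V t) * mform \<kappa> (?V t)"
  have "(?F has_vector_derivative 0) (at t within {0..1})" if t: "t \<in> {0..1}" for t
  proof -
    have c: "coercive (?V t)" using t by (intro coercive_convex coercive_mat_1 V) auto
    then obtain U where U: "U ** ?V t = mat 1" "?V t ** U = mat 1" by (rule coercive_invertible)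
    let ?W = "?B ** U"
    \<comment> \<open>The direction of the segment is written as a multiple of the current matrix,
      so \<open>mform_replace_row\<close> produces the diagonal of \<open>?W\<close>. The derivative
      of \<open>gauss_Z\<close> yields the same diagonal, because \<open>gauss_I\<close> is
      \<open>U\<close> times \<open>gauss_Z\<close>.\<close>
    have B: "?B = ?W ** ?V t" by (metis U(1) matrix_mul_assoc matrix_mul_rid)
    have "mform \<kappa> (\<chi> i. if i = j then ?B $ i else ?V t $ i) = ?W $ j $ j * mform \<kappa> (?V t)" for j
      using mform_replace_row[OF alt, where W="?W" and V="?V t" and j=j] by (simp only: B[symmetric])
    then have dm: "((\<lambda>t. mform \<kappa> (?V t)) has_vector_derivative (\<Sum>j\<in>UNIV. ?W $ j $ j * mform \<kappa> (?V t)))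
        (at t within {0..1})"
      using mform_deriv[of \<kappa> "mat 1" ?B t "{0..1}"] by (simp only:)
    have "(\<Sum>x\<in>UNIV. \<Sum>y\<in>UNIV. ?B $ x $ y * gauss_I (?V t) y x) = (\<Sum>j\<in>UNIV. ?W $ j $ j * gauss_Z (?V t))"
      by (simp add: gauss_I_eq[OF c U(1)] matrix_matrix_mult_def sum_distrib_right mult.assoc)
    with gauss_Z_deriv[OF coercive_mat_1 V t]
    have dz: "((\<lambda>t. gauss_Z (?V t)) has_vector_derivative - (\<Sum>j\<in>UNIV. ?W $ j $ j * gauss_Z (?V t)))
        (at t within {0..1})" by (simp only:)
    have "(?F has_vector_derivative (gauss_Z (?V t) * (\<Sum>j\<in>UNIV. ?W $ j $ j * mform \<kappa> (?V t))
        + (- (\<Sum>j\<in>UNIV. ?W $ j $ j * gauss_Z (?V t))) * mform \<kappa> (?V t))) (at t within {0..1})"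
      by (rule has_vector_derivative_mult[OF dz dm])
    moreover have "gauss_Z (?V t) * (\<Sum>j\<in>UNIV. ?W $ j $ j * mform \<kappa> (?V t))
        + (- (\<Sum>j\<in>UNIV. ?W $ j $ j * gauss_Z (?V t))) * mform \<kappa> (?V t) = 0"
    proof -
      have "z * (s * m) + (- (s * z)) * m = 0" for z s m :: complex by (simp add: algebra_simps)
      then show ?thesis unfolding sum_distrib_right[symmetric] .
    qed
    ultimately show ?thesis by (simp only:)
  qed
  then obtain C where C: "\<And>t. t \<in> {0..1} \<Longrightarrow> ?F t = C"
    using has_vector_derivative_zero_constant[of "{0..1}" ?F] by (auto simp: convex_closed_interval)
  have "?F 1 = ?F 0" using C[of 0] C[of 1] by simp
  then show ?thesis by (simp add: gauss_Z_mat_1)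
qed

section \<open>The commutative ring of even forms\<close>

definition homog :: "nat \<Rightarrow> 'i::finite form \<Rightarrow> bool" where
  "homog k f \<longleftrightarrow> (\<forall>p I. card I \<noteq> k \<longrightarrow> coeff f p I = 0)"

definition even_form :: "'i::finite form \<Rightarrow> bool" where
  "even_form f \<longleftrightarrow> (\<forall>p I. odd (card I) \<longrightarrow> coeff f p I = 0)"

text \<open>The fermionic factors have coefficients independent of the point, so their top
  coefficient is a number that may be computed at any point, such as 0.\<close>

definition const_form :: "'i::finite form \<Rightarrow> bool" where
  "const_form f \<longleftrightarrow> (\<forall>p q I. coeff f p I = coeff f q I)"

text \<open>The inversions of the pair \<open>A\<close>, \<open>B\<close> and the swapped inversions
  of \<open>B\<close>, \<open>A\<close> partition the product \<open>A \<times> B\<close>.\<close>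

lemma wedge_sign_swap:
  fixes A B :: "'i::{finite,linorder} set"
  assumes "A \<inter> B = {}"
  shows "wedge_sign A B = (-1) ^ (card A * card B) * wedge_sign B A"
proof -
  let ?S = "\<lambda>A B. {(i, j). i \<in> A \<and> j \<in> B \<and> j < i}"
  have "?S A B \<union> prod.swap ` ?S B A = A \<times> B"
    using assms by (force simp: image_iff)
  moreover have "?S A B \<inter> prod.swap ` ?S B A = {}" by auto
  then have "card (?S A B \<union> prod.swap ` ?S B A) = card (?S A B) + card (prod.swap ` ?S B A)"
    by (intro card_Un_disjoint) auto
  ultimately have "card (?S A B) + card (prod.swap ` ?S B A) = card A * card B"
    by (simp only: card_cartesian_product)
  moreover have "card (prod.swap ` ?S B A) = card (?S B A)"
    by (rule card_image) (auto simp: inj_on_def)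
  ultimately have "(-1 :: complex) ^ (card A * card B) = wedge_sign A B * wedge_sign B A"
    by (simp add: wedge_sign_def power_add[symmetric])
  moreover have "wedge_sign B A * wedge_sign B A = 1"
    by (simp add: wedge_sign_def power_mult_distrib[symmetric])
  ultimately show ?thesis by (simp add: mult.assoc)
qed

lemma coeff_times_swap:
  fixes f g :: "'i::{finite,linorder} form"
  shows "coeff (g * f) p I = (\<Sum>B\<in>Pow I. (-1) ^ (card B * card (I - B))
      * (wedge_sign B (I - B) * coeff f p B * coeff g p (I - B)))"
  unfolding coeff_times
proof (rule sum.reindex_bij_witness[where i = "\<lambda>B. I - B" and j = "\<lambda>B. I - B"], goal_cases)
  case (5 B)
  then have "I - (I - B) = B" by auto
  moreover have "wedge_sign B (I - B) = (-1) ^ (card B * card (I - B)) * wedge_sign (I - B) B"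
    by (rule wedge_sign_swap) auto
  ultimately show ?case by (simp only: mult_ac)
qed auto

lemma card_eq_card_add_Diff: "finite I \<Longrightarrow> B \<subseteq> I \<Longrightarrow> card I = card B + card (I - B)"
  by (simp add: card_Diff_subset card_mono finite_subset)

lemma homog_times:
  fixes f g :: "'i::{finite,linorder} form"
  assumes "homog j f" "homog k g"
  shows "homog (j + k) (f * g)"
  unfolding homog_def coeff_times
proof (intro allI impI sum.neutral ballI)
  fix p and I B :: "'i set" assume I: "card I \<noteq> j + k" and B: "B \<in> Pow I"
  then have "card I = card B + card (I - B)"
    by (intro card_eq_card_add_Diff) auto
  then have "card B \<noteq> j \<or> card (I - B) \<noteq> k" using I by auto
  then show "wedge_sign B (I - B) * coeff f p B * coeff g p (I - B) = 0"
    using assms by (auto simp: homog_def)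
qed

lemma homog_anticommute:
  fixes f g :: "'i::{finite,linorder} form"
  assumes "homog 1 f" "homog 1 g"
  shows "f * g = - (g * f)"
proof (rule form_eqI)
  fix p I
  show "coeff (f * g) p I = coeff (- (g * f)) p I"
    unfolding coeff_simps coeff_times[of f g] coeff_times_swap[of g f] sum_negf[symmetric]
  proof (intro sum.cong refl)
    fix B
    show "wedge_sign B (I - B) * coeff f p B * coeff g p (I - B) =
       - ((-1) ^ (card B * card (I - B)) * (wedge_sign B (I - B) * coeff f p B * coeff g p (I - B)))"
      using assms unfolding homog_def
      by (cases "card B = 1"; cases "card (I - B) = 1") auto
  qed
qed

lemma homog_square:
  fixes f :: "'i::{finite,linorder} form"
  assumes "homog 1 f"
  shows "f * f = 0"
proof (rule form_eqI)
  fix p I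
  have "coeff (f * f) p I = - coeff (f * f) p I"
    using homog_anticommute[OF assms assms] by (metis coeff_simps(5))
  then show "coeff (f * f) p I = coeff 0 p I" by (simp add: eq_neg_iff_add_eq_0)
qed

lemma homog_even_form: "homog k f \<Longrightarrow> even k \<Longrightarrow> even_form f"
  by (auto simp: homog_def even_form_def)

lemma even_form_0: "even_form 0" and even_form_1: "even_form 1"
  and even_form_add: "even_form f \<Longrightarrow> even_form g \<Longrightarrow> even_form (f + g)"
  and even_form_diff: "even_form f \<Longrightarrow> even_form g \<Longrightarrow> even_form (f - g)"
  and even_form_uminus: "even_form f \<Longrightarrow> even_form (- f)"
  by (auto simp: even_form_def)

lemma even_form_times:
  fixes f g :: "'i::{finite,linorder} form"
  assumes "even_form f" "even_form g"
  shows "even_form (f * g)"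
  unfolding even_form_def coeff_times
proof (intro allI impI sum.neutral ballI)
  fix p and I B :: "'i set" assume I: "odd (card I)" and B: "B \<in> Pow I"
  then have "card I = card B + card (I - B)"
    by (intro card_eq_card_add_Diff) auto
  then have "odd (card B) \<or> odd (card (I - B))" using I by auto
  then show "wedge_sign B (I - B) * coeff f p B * coeff g p (I - B) = 0"
    using assms by (auto simp: even_form_def)
qed

lemma even_form_commute:
  fixes f g :: "'i::{finite,linorder} form"
  assumes "even_form f" "even_form g"
  shows "f * g = g * f"
proof (rule form_eqI)
  fix p I
  show "coeff (f * g) p I = coeff (g * f) p I"
    unfolding coeff_times[of f g] coeff_times_swap[of g f]
  proof (intro sum.cong refl)
    fix B
    show "wedge_sign B (I - B) * coeff f p B * coeff g p (I - B) =
         (-1) ^ (card B * card (I - B)) * (wedge_sign B (I - B) * coeff f p B * coeff g p (I - B))"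
      using assms by (cases "even (card B)") (auto simp: even_form_def)
  qed
qed

text \<open>Even forms commute, so this type becomes a \<open>comm_ring_1\<close>, where products
  over finite sets and their expansions need no order of the factors; the forms themselves are only
  a \<open>ring_1\<close>.\<close>

typedef (overloaded) 'i eform = "{f :: 'i::{finite,linorder} form. even_form f}"
  morphisms form_of Eform
  using even_form_0 by blast

lemma even_form_form_of [simp]: "even_form (form_of f)"
  using form_of by simp

lemma form_of_Eform: "even_form f \<Longrightarrow> form_of (Eform f) = f"
  by (simp add: Eform_inverse)

instantiation eform :: ("{finite,linorder}") comm_ring_1
begin
definition zero_eform :: "'a eform" where "0 = Eform 0"
definition one_eform :: "'a eform" where "1 = Eform 1"
definition plus_eform :: "'a eform \<Rightarrow> 'a eform \<Rightarrow> 'a eform" where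
  "f + g = Eform (form_of f + form_of g)"
definition minus_eform :: "'a eform \<Rightarrow> 'a eform \<Rightarrow> 'a eform" where
  "f - g = Eform (form_of f - form_of g)"
definition uminus_eform :: "'a eform \<Rightarrow> 'a eform" where
  "- f = Eform (- form_of f)"
definition times_eform :: "'a eform \<Rightarrow> 'a eform \<Rightarrow> 'a eform" where
  "f * g = Eform (form_of f * form_of g)"

lemma form_of_simps:
  "form_of (0 :: 'a eform) = 0"
  "form_of (1 :: 'a eform) = 1"
  "form_of (f + g :: 'a eform) = form_of f + form_of g"
  "form_of (f - g :: 'a eform) = form_of f - form_of g"
  "form_of (- f :: 'a eform) = - form_of f"
  "form_of (f * g :: 'a eform) = form_of f * form_of g"
  by (simp_all add: zero_eform_def one_eform_def plus_eform_def minus_eform_def uminus_eform_def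
      times_eform_def form_of_Eform even_form_0 even_form_1 even_form_add even_form_diff even_form_uminus even_form_times)

instance
proof
  fix f g h :: "'a eform"
  show "f * g = g * f"
    by (simp add: form_of_inject[symmetric] form_of_simps even_form_commute)
qed (simp_all add: form_of_inject[symmetric] form_of_simps algebra_simps)
end

lemma form_of_sum: "form_of (sum f A) = (\<Sum>x\<in>A. form_of (f x))"
  by (induction A rule: infinite_finite_induct) (simp_all add: form_of_simps)

lemma form_of_power: "form_of (f ^ n) = form_of f ^ n"
  by (induction n) (simp_all add: form_of_simps)

lemma form_of_prod_list: "form_of (prod_list (map f xs)) = prod_list (map (\<lambda>x. form_of (f x)) xs)"
  by (induction xs) (simp_all add: form_of_simps)

text \<open>Lets the ordered product over sites in \<open>form_fun\<close> be treated as an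
  unordered one.\<close>

lemma form_of_prod:
  fixes f :: "'j::linorder \<Rightarrow> 'i::{finite,linorder} eform"
  assumes "finite A"
  shows "form_of (prod f A) = prod_list (map (\<lambda>x. form_of (f x)) (sorted_list_of_set A))"
  using assms by (simp add: form_of_prod_list[symmetric] prod.distinct_set_conv_list[symmetric])

lemma coeff_form_fn: "coeff (form_fn g) p I = (if I = {} then g p else 0)"
  by (simp add: form_fn_def)

lemma coeff_form_fn_times:
  fixes f :: "'i::{finite,linorder} form"
  shows "coeff (form_fn g * f) p I = g p * coeff f p I"
proof -
  have "coeff (form_fn g * f) p I = (\<Sum>B\<in>Pow I. if B = {} then g p * coeff f p I else 0)"
    unfolding coeff_times by (intro sum.cong) (auto simp: coeff_form_fn)
  then show ?thesis by simp
qed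

lemma coeff_times_form_fn:
  fixes f :: "'i::{finite,linorder} form"
  shows "coeff (f * form_fn g) p I = g p * coeff f p I"
proof -
  have "coeff (f * form_fn g) p I = (\<Sum>B\<in>Pow I. if B = I then g p * coeff f p I else 0)"
    unfolding coeff_times by (intro sum.cong) (auto simp: coeff_form_fn)
  then show ?thesis by simp
qed

lemma form_fn_commute: "form_fn g * f = f * form_fn (g :: real ^ 'i::{finite,linorder} \<Rightarrow> complex)"
  by (rule form_eqI) (simp add: coeff_form_fn_times coeff_times_form_fn)

lemma form_fn_times: "form_fn g * form_fn h = form_fn (\<lambda>p. g p * h p :: complex)"
  for g :: "real ^ 'i::{finite,linorder} \<Rightarrow> complex"
  by (rule form_eqI) (simp add: coeff_form_fn_times coeff_form_fn)

lemma form_fn_add: "form_fn g + form_fn h = form_fn (\<lambda>p. g p + h p :: complex)"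
  for g :: "real ^ 'i::{finite,linorder} \<Rightarrow> complex"
  by (rule form_eqI) (simp add: coeff_form_fn)

lemma form_fn_minus: "- form_fn g = form_fn (\<lambda>p. - g p :: complex)"
  for g :: "real ^ 'i::{finite,linorder} \<Rightarrow> complex"
  by (rule form_eqI) (simp add: coeff_form_fn)

lemma form_fn_0: "form_fn (\<lambda>_. 0) = (0 :: 'i::{finite,linorder} form)"
  by (rule form_eqI) (simp add: coeff_form_fn)

lemma form_fn_sum: "(\<Sum>x\<in>A. form_fn (g x)) = form_fn (\<lambda>p. \<Sum>x\<in>A. g x p :: complex)"
  for g :: "'a \<Rightarrow> real ^ 'i::{finite,linorder} \<Rightarrow> complex"
  by (induction A rule: infinite_finite_induct) (simp_all add: form_fn_add form_fn_0)

lemma coeff_sum: "coeff (sum f A) p I = (\<Sum>x\<in>A. coeff (f x :: 'i::{finite,linorder} form) p I)"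
  by (induction A rule: infinite_finite_induct) simp_all

definition efn :: "(real ^ 'i::{finite,linorder} \<Rightarrow> complex) \<Rightarrow> 'i eform" where
  "efn g = Eform (form_fn g)"

lemma form_of_efn: "form_of (efn g) = form_fn g"
  by (simp add: efn_def form_of_Eform even_form_def coeff_form_fn)

lemma efn_hom:
  "efn (\<lambda>_. 1) = 1" "efn (\<lambda>_. 0) = 0"
  "efn g * efn h = efn (\<lambda>p. g p * h p)" "efn g + efn h = efn (\<lambda>p. g p + h p)"
  "- efn g = efn (\<lambda>p. - g p)"
  by (auto simp: form_of_inject[symmetric] form_of_simps form_of_efn form_fn_times form_fn_add
      form_fn_minus form_fn_0 coeff_form_fn intro!: form_eqI)

definition top_coeff :: "'i::{finite,linorder} eform \<Rightarrow> real ^ 'i::{finite,linorder} \<Rightarrow> complex" where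
  "top_coeff f p = coeff (form_of f) p UNIV"

lemma top_coeff_simps:
  "top_coeff (efn g * f) p = g p * top_coeff f p"
  "top_coeff (f + h) p = top_coeff f p + top_coeff h p"
  "top_coeff (- f) p = - top_coeff f p"
  "top_coeff 0 p = 0"
  by (simp_all add: top_coeff_def form_of_simps form_of_efn coeff_form_fn_times)

lemma top_coeff_sum: "top_coeff (sum f A) p = (\<Sum>x\<in>A. top_coeff (f x) p)"
  by (simp add: top_coeff_def form_of_sum coeff_sum)

text \<open>Meant for arguments of degree one, whose product is even, as \<open>Eform\<close>
  requires.\<close>

definition pair_prod :: "'i::{finite,linorder} form \<Rightarrow> 'i form \<Rightarrow> 'i eform" where
  "pair_prod a b = Eform (a * b)"

lemma form_of_pair_prod:
  assumes "homog 1 a" "homog 1 b"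
  shows "form_of (pair_prod a b) = a * b"
  using homog_even_form[OF homog_times[OF assms]] by (simp add: pair_prod_def form_of_Eform)

lemma pair_prod_same_left:
  assumes "homog 1 a" "homog 1 b" "homog 1 c"
  shows "pair_prod a b * pair_prod a c = 0"
proof -
  have "a * b * (a * c) = - (a * (a * b) * c)"
    using homog_anticommute[OF assms(2,1)] by (simp add: mult.assoc[symmetric]) (simp add: mult.assoc)
  also have "\<dots> = 0" by (simp only: mult.assoc[symmetric] homog_square[OF assms(1)] mult_zero_left minus_zero)
  finally show ?thesis
    by (simp only: form_of_inject[symmetric] form_of_simps form_of_pair_prod[OF assms(1,2)] form_of_pair_prod[OF assms(1,3)])
qed

lemma pair_prod_same_right:
  assumes "homog 1 a" "homog 1 b" "homog 1 c"
  shows "pair_prod a b * pair_prod c b = 0"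
proof -
  have "a * b * (c * b) = a * (b * c) * b" by (simp add: mult.assoc)
  also have "\<dots> = - (a * c * (b * b))"
    using homog_anticommute[OF assms(2,3)] by (simp add: mult.assoc)
  also have "\<dots> = 0" by (simp only: homog_square[OF assms(2)] mult_zero_right minus_zero)
  finally show ?thesis
    by (simp only: form_of_inject[symmetric] form_of_simps form_of_pair_prod[OF assms(1,2)] form_of_pair_prod[OF assms(3,2)])
qed

lemma homog_form_fn_times:
  fixes f :: "'i::{finite,linorder} form"
  shows "homog k f \<Longrightarrow> homog k (form_fn g * f)"
  by (auto simp: homog_def coeff_form_fn_times)

lemma homog_add: "homog k f \<Longrightarrow> homog k g \<Longrightarrow> homog k (f + g)"
  and homog_diff: "homog k f \<Longrightarrow> homog k g \<Longrightarrow> homog k (f - g)"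
  and homog_0: "homog k 0"
  and homog_uminus: "homog k f \<Longrightarrow> homog k (- f)"
  for f g :: "'i::{finite,linorder} form"
  by (auto simp: homog_def)

lemma homog_sum: "(\<And>x. x \<in> A \<Longrightarrow> homog k (f x)) \<Longrightarrow> homog k (sum f A :: 'i::{finite,linorder} form)"
  by (induction A rule: infinite_finite_induct) (auto intro: homog_add homog_0)

lemma homog_prod:
  fixes f :: "'a \<Rightarrow> 'i::{finite,linorder} eform"
  assumes "finite A" "\<And>x. x \<in> A \<Longrightarrow> homog k (form_of (f x))"
  shows "homog (k * card A) (form_of (prod f A))"
  using assms
  by (induction A rule: finite_induct)
     (auto simp: form_of_simps intro!: homog_times, simp add: homog_def)

lemma homog_dcoord: "homog 1 (dcoord i)"
  by (auto simp: homog_def dcoord_def)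

lemma homog_psi: "homog 1 (\<psi> x)" "homog 1 (\<psi>bar x)"
  unfolding \<psi>_def \<psi>bar_def
  by (intro homog_form_fn_times homog_add homog_diff homog_dcoord)+

lemma const_form_simps:
  fixes f g :: "'i::{finite,linorder} form"
  shows "const_form f \<Longrightarrow> const_form g \<Longrightarrow> const_form (f * g)"
    "const_form f \<Longrightarrow> const_form g \<Longrightarrow> const_form (f + g)"
    "const_form f \<Longrightarrow> const_form g \<Longrightarrow> const_form (f - g)"
    "const_form f \<Longrightarrow> const_form (- f)"
    "const_form 0" "const_form (1 :: 'i form)"
    "const_form (form_const c :: 'i form)" "const_form (dcoord i)"
  unfolding const_form_def coeff_times coeff_simps
  by (auto simp: form_fn_def dcoord_def intro!: sum.cong arg_cong2[of _ _ _ _ "(*)"] arg_cong2[of _ _ _ _ "(+)"] arg_cong2[of _ _ _ _ "(-)"])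

lemma const_form_psi: "const_form (\<psi> x)" "const_form (\<psi>bar x)"
  unfolding \<psi>_def \<psi>bar_def by (intro const_form_simps)+

lemma const_form_prod:
  fixes f :: "'a \<Rightarrow> 'i::{finite,linorder} eform"
  shows "(\<And>x. x \<in> A \<Longrightarrow> const_form (form_of (f x))) \<Longrightarrow> const_form (form_of (prod f A))"
  by (induction A rule: infinite_finite_induct) (auto simp: form_of_simps intro!: const_form_simps)

lemma const_form_top_coeff: "const_form (form_of f) \<Longrightarrow> top_coeff f p = top_coeff f q"
  by (auto simp: const_form_def top_coeff_def)


section \<open>Fermionic rows and their top coefficient\<close>

definition epsi :: "'m \<Rightarrow> 'm \<Rightarrow> 'm::{finite,linorder} coord eform" where
  "epsi x y = pair_prod (\<psi> x) (\<psi>bar y)"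

definition yrow :: "'m \<Rightarrow> complex ^ 'm::{finite,linorder} \<Rightarrow> 'm coord eform" where
  "yrow x r = (\<Sum>y\<in>UNIV. efn (\<lambda>_. r $ y) * epsi x y)"

lemma form_of_epsi: "form_of (epsi x y) = \<psi> x * \<psi>bar y"
  by (simp only: epsi_def form_of_pair_prod homog_psi)

lemma homog_chi: "homog 1 (\<Sum>y\<in>UNIV. form_const (r $ y) * \<psi>bar y)"
  by (intro homog_sum homog_form_fn_times homog_psi)

text \<open>A row is \<open>\<psi> x\<close> times a single one-form that depends on the
  coefficients alone. A shared site therefore gives a repeated factor \<open>\<psi> x\<close>, and
  equal coefficients give a repeated one-form: the sources of square zero and of
  alternation.\<close>

lemma yrow_pair_prod: "yrow x r = pair_prod (\<psi> x) (\<Sum>y\<in>UNIV. form_const (r $ y) * \<psi>bar y)"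
proof -
  have "form_const (r $ y) * (\<psi> x * \<psi>bar y) = \<psi> x * (form_const (r $ y) * \<psi>bar y)" for y
    by (metis form_fn_commute mult.assoc)
  then have "form_of (yrow x r) = \<psi> x * (\<Sum>y\<in>UNIV. form_const (r $ y) * \<psi>bar y)"
    by (simp add: yrow_def form_of_sum form_of_simps form_of_efn form_of_epsi sum_distrib_left)
  then show ?thesis
    by (simp only: form_of_inject[symmetric] form_of_pair_prod homog_psi homog_chi)
qed

lemma yrow_mult_yrow: "yrow x r * yrow x s = 0" and yrow_mult_yrow': "yrow x r * yrow y r = 0"
  unfolding yrow_pair_prod by (intro pair_prod_same_left pair_prod_same_right homog_psi homog_chi)+

lemma yrow_add: "yrow x (r + s) = yrow x r + yrow x s"
  by (simp add: yrow_def sum.distrib distrib_right flip: efn_hom)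

lemma yrow_axis: "yrow x (axis y c) = efn (\<lambda>_. c) * epsi x y"
proof -
  have "yrow x (axis y c) = (\<Sum>z\<in>UNIV. if z = y then efn (\<lambda>_. c) * epsi x y else 0)"
    unfolding yrow_def by (intro sum.cong) (auto simp: axis_def efn_hom)
  then show ?thesis by simp
qed

text \<open>The sign comes from the exponent - S_A; the point 0 stands for any point, because the
  coefficients are constant.\<close>

definition berezin :: "('m::{finite,linorder} \<Rightarrow> 'm) \<Rightarrow> complex" where
  "berezin f = top_coeff (\<Prod>x\<in>(UNIV :: 'm::{finite,linorder} set). - epsi x (f x)) 0"

lemma top_coeff_prod_uminus_yrow:
  fixes V :: "complex ^ 'm::{finite,linorder} ^ 'm::{finite,linorder}"
  shows "top_coeff (\<Prod>x\<in>UNIV. - yrow x (V $ x)) p = mform berezin V"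
proof -
  have const: "top_coeff (\<Prod>x\<in>UNIV. - epsi x (f x)) p = berezin f" for f :: "'m \<Rightarrow> 'm"
    unfolding berezin_def
    by (intro const_form_top_coeff const_form_prod) (auto simp: form_of_simps form_of_epsi intro!: const_form_simps const_form_psi)
  have "(\<Prod>x\<in>UNIV. - yrow x (V $ x)) = (\<Prod>x\<in>UNIV. \<Sum>y\<in>UNIV. efn (\<lambda>_. V $ x $ y) * - epsi x y)"
    by (simp add: yrow_def sum_negf)
  also have "\<dots> = (\<Sum>f\<in>PiE UNIV (\<lambda>_. UNIV). \<Prod>x\<in>UNIV. efn (\<lambda>_. V $ x $ f x) * - epsi x (f x))"
    by (rule prod_sum_PiE) auto
  also have "\<dots> = (\<Sum>f\<in>UNIV. (\<Prod>x\<in>UNIV. efn (\<lambda>_. V $ x $ f x)) * (\<Prod>x\<in>UNIV. - epsi x (f x)))"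
    by (simp only: PiE_UNIV_domain Pi_UNIV prod.distrib)
  also have "\<dots> = (\<Sum>f\<in>UNIV. efn (\<lambda>_. \<Prod>x\<in>UNIV. V $ x $ f x) * (\<Prod>x\<in>UNIV. - epsi x (f x)))"
  proof -
    have "(\<Prod>x\<in>A. efn (\<lambda>_. h x)) = (efn (\<lambda>_. \<Prod>x\<in>A. h x) :: 'm coord eform)" for h :: "'m \<Rightarrow> complex" and A
      by (induction A rule: infinite_finite_induct) (auto simp: efn_hom)
    then show ?thesis by simp
  qed
  finally show ?thesis by (simp add: top_coeff_sum top_coeff_simps const mform_def) (simp add: mult.commute)
qed

text \<open>In the expansion over subsets \<open>S\<close> of the sites the term of \<open>S\<close>
  has degree 2 |S|, so only the full set reaches the top degree.\<close>

lemma top_coeff_prod_yrow: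
  fixes V :: "complex ^ 'm::{finite,linorder} ^ 'm::{finite,linorder}"
  shows "top_coeff (\<Prod>x\<in>UNIV. 1 - yrow x (V $ x)) p = mform berezin V"
proof -
  have hd: "homog 2 (form_of (- yrow x (V $ x)))" for x
    unfolding form_of_simps yrow_pair_prod form_of_pair_prod[OF homog_psi(1) homog_chi]
    using homog_times[OF homog_psi(1)[of x] homog_chi[of "V $ x"]] by (intro homog_uminus) (simp only: one_add_one)
  have "(\<Prod>x\<in>UNIV. 1 - yrow x (V $ x)) = (\<Prod>x\<in>UNIV. - yrow x (V $ x) + 1)" by simp
  also have "\<dots> = (\<Sum>S\<in>Pow UNIV. \<Prod>x\<in>S. - yrow x (V $ x))"
    by (subst prod_add) simp_all
  finally have "top_coeff (\<Prod>x\<in>UNIV. 1 - yrow x (V $ x)) p = (\<Sum>S\<in>Pow UNIV. top_coeff (\<Prod>x\<in>S. - yrow x (V $ x)) p)"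
    by (simp add: top_coeff_sum)
  also have "\<dots> = (\<Sum>S\<in>{UNIV}. top_coeff (\<Prod>x\<in>S. - yrow x (V $ x)) p)"
  proof (intro sum.mono_neutral_right ballI)
    fix S :: "'m set" assume "S \<in> Pow UNIV - {UNIV}"
    then have "card S < CARD('m)" by (intro psubset_card_mono) auto
    moreover have "homog (2 * card S) (form_of (\<Prod>x\<in>S. - yrow x (V $ x)))"
      by (intro homog_prod hd) simp
    ultimately show "top_coeff (\<Prod>x\<in>S. - yrow x (V $ x)) p = 0"
      by (simp add: homog_def top_coeff_def card_coord)
  qed auto
  finally show ?thesis by (simp add: top_coeff_prod_uminus_yrow)
qed

text \<open>Two rows with the same coefficients share a one-form, whose square vanishes. Alternation
  is thus read off from the product of forms, without computing \<open>berezin\<close>.\<close>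

lemma mform_berezin_alternating:
  fixes V :: "complex ^ 'm::{finite,linorder} ^ 'm::{finite,linorder}"
  assumes "i \<noteq> j" "V $ i = V $ j"
  shows "mform berezin V = 0"
proof -
  have "(\<Prod>x\<in>UNIV. - yrow x (V $ x)) = - yrow i (V $ i) * (- yrow j (V $ j) * (\<Prod>x\<in>UNIV - {i} - {j}. - yrow x (V $ x)))"
    using assms(1) by (simp add: prod.remove[of UNIV i] prod.remove[of "UNIV - {i}" j])
  also have "\<dots> = (yrow i (V $ i) * yrow j (V $ i)) * (\<Prod>x\<in>UNIV - {i} - {j}. - yrow x (V $ x))"
    by (simp add: assms(2) mult.assoc)
  also have "\<dots> = 0" by (simp add: yrow_mult_yrow')
  finally show ?thesis using top_coeff_prod_uminus_yrow[of V 0] by (simp add: top_coeff_simps)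
qed

section \<open>Orientation and the volume form\<close>

definition dmonomial :: "'i set \<Rightarrow> 'i::finite form" where
  "dmonomial A = Form (\<lambda>p I. if I = A then 1 else 0)"

lemma dmonomial_times:
  fixes A B :: "'i::{finite,linorder} set"
  assumes "A \<inter> B = {}" "wedge_sign A B = 1"
  shows "dmonomial A * dmonomial B = dmonomial (A \<union> B)"
proof (rule form_eqI)
  fix p I
  have "coeff (dmonomial A * dmonomial B) p I
     = (\<Sum>C\<in>Pow I. if C = A then (if I - A = B then 1 else 0) else 0)"
    unfolding coeff_times using assms(2) by (intro sum.cong) (auto simp: dmonomial_def)
  also have "\<dots> = (if A \<subseteq> I \<and> I - A = B then 1 else 0)" by simp
  also have "\<dots> = coeff (dmonomial (A \<union> B)) p I"
    using assms(1) by (auto simp: dmonomial_def)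
  finally show "coeff (dmonomial A * dmonomial B) p I = coeff (dmonomial (A \<union> B)) p I" .
qed

lemma dcoord_UV: "dcoord (UC x) * dcoord (VC x) = dmonomial {UC x, VC x :: 'm::{finite,linorder} coord}"
proof -
  have "{(i, j). i \<in> {UC x} \<and> j \<in> {VC x} \<and> j < i} = {}" by (auto simp: less_coord_def)
  then have "wedge_sign {UC x} {VC x} = 1" by (simp only: wedge_sign_def card.empty power_0)
  then have "dmonomial {UC x} * dmonomial {VC x} = dmonomial ({UC x} \<union> {VC x})" by (intro dmonomial_times) auto
  then show ?thesis by (simp add: dmonomial_def dcoord_def insert_commute)
qed

text \<open>(du + i dv)(du - i dv) = - 2 i du dv, and the normalisations multiply to 1 / (2 pi i)
  for either choice of the root; the result is du dv / pi.\<close>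

lemma uminus_epsi_same: "- epsi x x = efn (\<lambda>_. 1 / pi) * pair_prod (dcoord (UC x)) (dcoord (VC x))"
proof -
  let ?c = "1 / csqrt (2 * pi * \<i>)" and ?u = "dcoord (UC x)" and ?v = "dcoord (VC x)"
  have cc: "?c * ?c = 1 / (2 * pi * \<i>)"
    by (simp add: power2_eq_square[symmetric] power_divide del: csqrt.simps)
  have uu: "?u * ?u = 0" "?v * ?v = 0" by (intro homog_square homog_dcoord)+
  have vu: "?v * ?u = - (?u * ?v)" by (intro homog_anticommute homog_dcoord)
  have central: "f * (form_fn g * h) = form_fn g * (f * h)" for f g h
    by (metis form_fn_commute mult.assoc)
  have cm: "form_fn g * (form_fn h * f) = form_fn (\<lambda>p. g p * h p) * f" for f g h
    by (simp add: form_fn_times flip: mult.assoc)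
  have "\<psi> x * \<psi>bar x = form_const ?c * (form_const ?c * ((?u + form_const \<i> * ?v) * (?u - form_const \<i> * ?v)))"
    unfolding \<psi>_def \<psi>bar_def by (simp only: mult.assoc central[of "?u + form_const \<i> * ?v"])
  also have "(?u + form_const \<i> * ?v) * (?u - form_const \<i> * ?v) = - (form_const \<i> * (?u * ?v)) + form_const \<i> * (?v * ?u)"
    by (simp add: distrib_left distrib_right left_diff_distrib right_diff_distrib mult.assoc central[of ?u] central[of ?v] uu)
  also have "\<dots> = form_const (- 2 * \<i>) * (?u * ?v)"
    by (rule form_eqI) (simp add: vu coeff_form_fn_times)
  finally have "\<psi> x * \<psi>bar x = form_const (?c * ?c * (- 2 * \<i>)) * (?u * ?v)"
    by (simp add: cm mult.assoc)
  also have "?c * ?c * (- 2 * \<i>) = - (1 / pi)" unfolding cc by simp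
  finally have "form_of (- epsi x x) = form_of (efn (\<lambda>_. 1 / pi) * pair_prod ?u ?v)"
    unfolding form_of_simps form_of_epsi form_of_efn form_of_pair_prod[OF homog_dcoord homog_dcoord]
    by (intro form_eqI) (simp add: coeff_form_fn_times)
  then show ?thesis by (simp only: form_of_inject)
qed

text \<open>\<open>UC x\<close> and \<open>VC x\<close> exceed the same coordinates of the other
  sites, so inversions come in pairs and no sign arises, in whatever order the sites are
  inserted.\<close>

lemma prod_volume:
  fixes S :: "'m::{finite,linorder} set"
  assumes "finite S"
  shows "form_of (\<Prod>x\<in>S. pair_prod (dcoord (UC x)) (dcoord (VC x))) = dmonomial (UC ` S \<union> VC ` S)"
  using assms
proof (induction S rule: finite_induct)
  case empty
  then show ?case by (simp add: form_of_simps) (rule form_eqI, simp add: dmonomial_def)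
next
  case (insert x S)
  let ?U = "UC ` S \<union> VC ` S" and ?L = "{j \<in> UC ` S \<union> VC ` S. site j < x}"
  have "{(i, j). i \<in> {UC x, VC x} \<and> j \<in> ?U \<and> j < i} = {UC x, VC x} \<times> ?L"
    using insert(2) by (auto simp: less_coord_def)
  then have "card {(i, j). i \<in> {UC x, VC x} \<and> j \<in> ?U \<and> j < i} = 2 * card ?L"
    by (simp only: card_cartesian_product) simp
  then have "wedge_sign {UC x, VC x} ?U = 1" by (simp only: wedge_sign_def) simp
  then have "dmonomial {UC x, VC x} * dmonomial ?U = dmonomial ({UC x, VC x} \<union> ?U)"
    using insert(2) by (intro dmonomial_times) auto
  also have "{UC x, VC x} \<union> ?U = UC ` insert x S \<union> VC ` insert x S" by auto
  finally show ?case
    using insert by (simp add: form_of_simps form_of_pair_prod[OF homog_dcoord homog_dcoord] dcoord_UV)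
qed

lemma mform_berezin_mat_1: "mform berezin (mat 1 :: complex ^ 'm::{finite,linorder} ^ 'm::{finite,linorder}) = 1 / of_real (pi ^ CARD('m::{finite,linorder}))"
proof -
  have "yrow x ((mat 1 :: complex ^ 'm::{finite,linorder} ^ 'm::{finite,linorder}) $ x) = epsi x x" for x
  proof -
    have "(mat 1 :: complex ^ 'm::{finite,linorder} ^ 'm::{finite,linorder}) $ x = axis x 1" by (auto simp: vec_eq_iff mat_def axis_def)
    then show ?thesis by (simp add: yrow_axis efn_hom)
  qed
  then have "mform berezin (mat 1 :: complex ^ 'm::{finite,linorder} ^ 'm::{finite,linorder}) = top_coeff (\<Prod>x\<in>(UNIV::'m set). - epsi x x) 0"
    by (subst top_coeff_prod_uminus_yrow[of "mat 1" 0, symmetric]) simp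
  also have "(\<Prod>x\<in>(UNIV::'m set). - epsi x x) = (efn (\<lambda>_. 1 / pi)) ^ CARD('m) * (\<Prod>x\<in>UNIV. pair_prod (dcoord (UC x)) (dcoord (VC x)))"
    by (simp add: uminus_epsi_same prod.distrib)
  also have "(efn (\<lambda>_. 1 / pi)) ^ n = (efn (\<lambda>_. (1 / pi) ^ n) :: 'm coord eform)" for n
    by (induction n) (auto simp: efn_hom)
  finally show ?thesis
    by (simp add: top_coeff_simps) (simp add: top_coeff_def prod_volume dmonomial_def UNIV_coord power_divide)
qed

section \<open>The top_coeff-degree part of the integrand\<close>

definition cmat :: "real ^ 'm::finite ^ 'm::finite \<Rightarrow> complex ^ 'm ^ 'm" where
  "cmat A = (\<chi> x y. complex_of_real (A $ x $ y))"

lemma \<phi>_eq: "\<phi> x = form_fn (\<lambda>p. cvec p $ x)" and \<phi>bar_eq: "\<phi>bar x = form_fn (\<lambda>p. cnj (cvec p $ x))"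
  by (simp_all add: \<phi>_def \<phi>bar_def cvec_def Complex_eq)

lemma S_form_eq:
  "S_form A = form_fn (\<lambda>p. sesq (cmat A) (cvec p) (cvec p)) + form_of (\<Sum>x\<in>UNIV. yrow x (cmat A $ x))"
  unfolding S_form_def sesq_def
  by (simp add: \<phi>_eq \<phi>bar_eq form_fn_times form_fn_sum cmat_def form_of_sum yrow_def form_of_simps
      form_of_efn form_of_epsi mult.assoc)

lemma \<tau>_eq: "\<tau> x = form_fn (\<lambda>p. cvec p $ x * cnj (cvec p $ x)) + form_of (epsi x x)"
  by (simp add: \<tau>_def \<phi>_eq \<phi>bar_eq form_fn_times form_of_epsi)

lemma deg0_form_of_homog:
  assumes "homog k f" "k \<noteq> 0"
  shows "deg0 (form_fn g + f) = g"
  using assms by (auto simp: deg0_def homog_def fun_eq_iff coeff_form_fn)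

lemma homog_yrow: "homog 2 (form_of (yrow x r))"
  unfolding yrow_pair_prod form_of_pair_prod[OF homog_psi(1) homog_chi]
  using homog_times[OF homog_psi(1)[of x] homog_chi[of r]] by (simp only: one_add_one)

lemma homog_epsi: "homog 2 (form_of (epsi x y))"
  unfolding form_of_epsi
  using homog_times[OF homog_psi(1)[of x] homog_psi(2)[of y]] by (simp only: one_add_one)

text \<open>Since the square of \<open>y x\<close> vanishes, the powers of a sum of \<open>n\<close> such elements vanish beyond
  degree \<open>n\<close>.\<close>

lemma exp_sum_square_zero:
  fixes y :: "'a \<Rightarrow> 'i::{finite,linorder} eform"
  assumes "finite S" "\<And>x. x \<in> S \<Longrightarrow> y x * y x = 0" "card S \<le> N"
  shows "(\<Sum>n\<le>N. efn (\<lambda>_. 1 / fact n) * (\<Sum>x\<in>S. y x) ^ n) = (\<Prod>x\<in>S. 1 + y x)"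
  using assms
proof (induction S arbitrary: N rule: finite_induct)
  case empty
  have "(\<Sum>n\<le>N. efn (\<lambda>_. 1 / fact n) * (0 :: 'i eform) ^ n) = (\<Sum>n\<le>N. if n = 0 then 1 else 0)"
    by (intro sum.cong) (auto simp: efn_hom power_0_left)
  then show ?case by simp
next
  case (insert x S)
  let ?X = "\<Sum>x\<in>S. y x"
  obtain M where M: "N = Suc M" using insert by (cases N) auto
  have pow: "(y x + ?X) ^ n = ?X ^ n + of_nat n * y x * ?X ^ (n - 1)" for n
  proof (induction n)
    case (Suc n)
    have "(y x + ?X) ^ Suc n = (y x + ?X) * (?X ^ n + of_nat n * y x * ?X ^ (n - 1))"
      by (simp add: Suc)
    also have "\<dots> = ?X ^ Suc n + y x * ?X ^ n + of_nat n * (y x * y x) * ?X ^ (n - 1) + of_nat n * y x * (?X * ?X ^ (n - 1))"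
      by (simp add: algebra_simps)
    also have "of_nat n * y x * (?X * ?X ^ (n - 1)) = of_nat n * y x * ?X ^ n"
      by (cases n) auto
    finally show ?case using insert by (simp add: algebra_simps)
  qed simp
  have efn_nat: "efn (\<lambda>_. 1 / fact (Suc n)) * of_nat (Suc n) = (efn (\<lambda>_. 1 / fact n) :: 'i eform)" for n
  proof -
    have "(of_nat k :: 'i eform) = efn (\<lambda>_. of_nat k)" for k
    proof (induction k)
      case (Suc k)
      then show ?case by (simp only: of_nat_Suc efn_hom(1)[symmetric] efn_hom(4))
    qed (simp add: efn_hom)
    then have "efn (\<lambda>_. 1 / fact (Suc n)) * of_nat (Suc n) = (efn (\<lambda>_. 1 / fact (Suc n) * of_nat (Suc n)) :: 'i eform)"
      by (simp only: efn_hom)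
    also have "1 / fact (Suc n) * of_nat (Suc n) = (1 / fact n :: complex)" by (simp del: of_nat_Suc)
    finally show ?thesis .
  qed
  have "(\<Sum>n\<le>N. efn (\<lambda>_. 1 / fact n) * (\<Sum>x\<in>insert x S. y x) ^ n)
    = (\<Sum>n\<le>N. efn (\<lambda>_. 1 / fact n) * ?X ^ n) + (\<Sum>n\<le>Suc M. efn (\<lambda>_. 1 / fact n) * of_nat n * y x * ?X ^ (n - 1))"
    using insert by (simp add: pow distrib_left sum.distrib M mult.assoc)
  also have "(\<Sum>n\<le>Suc M. efn (\<lambda>_. 1 / fact n) * of_nat n * y x * ?X ^ (n - 1))
    = (\<Sum>n\<le>M. efn (\<lambda>_. 1 / fact (Suc n)) * of_nat (Suc n) * y x * ?X ^ n)"
    by (subst sum.atMost_Suc_shift) (simp del: fact_Suc of_nat_Suc)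
  also have "\<dots> = y x * (\<Sum>n\<le>M. efn (\<lambda>_. 1 / fact n) * ?X ^ n)"
    unfolding efn_nat by (simp add: sum_distrib_left mult_ac)
  also have "(\<Sum>n\<le>M. efn (\<lambda>_. 1 / fact n) * ?X ^ n) = (\<Prod>x\<in>S. 1 + y x)"
    using insert by (intro insert.IH) (auto simp: M)
  also have "(\<Sum>n\<le>N. efn (\<lambda>_. 1 / fact n) * ?X ^ n) = (\<Prod>x\<in>S. 1 + y x)"
    using insert by (intro insert.IH) (auto simp: M)
  finally show ?case using insert by (simp add: algebra_simps)
qed

text \<open>The Taylor expansion stops at half the number of coordinates, which is the number of
  sites. As there is one row per site and each squares to zero, nothing is cut off and the series is
  a product.\<close>

lemma form_exp_S_form:
  fixes A :: "real ^ 'm::{finite,linorder} ^ 'm::{finite,linorder}"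
  shows "form_exp (- S_form A) = form_of (efn (\<lambda>p. exp (- sesq (cmat A) (cvec p) (cvec p)))
    * (\<Prod>x\<in>UNIV. 1 - yrow x (cmat A $ x)))"
proof -
  let ?q = "\<lambda>p. - sesq (cmat A) (cvec p) (cvec p)"
  let ?Y = "\<Sum>x\<in>UNIV. - yrow x (cmat A $ x)"
  have S: "- S_form A = form_fn ?q + form_of ?Y"
    by (simp add: S_form_eq form_of_sum form_of_simps form_fn_minus[symmetric] sum_negf)
  have "homog 2 (form_of ?Y)"
    unfolding form_of_sum form_of_simps by (intro homog_sum homog_uminus homog_yrow)
  then have d: "deg0 (- S_form A) = ?q"
    unfolding S by (rule deg0_form_of_homog) simp
  have "(\<Sum>n\<le>CARD('m coord) div 2. form_const (1 / fact n) * (- S_form A - form_fn (deg0 (- S_form A))) ^ n)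
     = form_of (\<Sum>n\<le>CARD('m). efn (\<lambda>_. 1 / fact n) * ?Y ^ n)"
    unfolding d by (simp add: S form_of_sum form_of_simps form_of_efn form_of_power card_coord)
  also have "(\<Sum>n\<le>CARD('m). efn (\<lambda>_. 1 / fact n) * ?Y ^ n) = (\<Prod>x\<in>UNIV. 1 + - yrow x (cmat A $ x))"
    by (rule exp_sum_square_zero) (auto simp: yrow_mult_yrow)
  finally show ?thesis
    unfolding form_exp_eq d by (simp only: form_of_simps form_of_efn) (simp add: form_of_simps)
qed

text \<open>For a function that factorises over the coordinates each partial derivative touches one
  factor only; with exponents at most 1, one derivative of each \<open>h j\<close> suffices.\<close>

lemma multi_deriv_prod:
  fixes h :: "'j::{finite,linorder} \<Rightarrow> complex \<Rightarrow> complex"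
  assumes h: "\<And>j z. h j field_differentiable at z"
    and \<alpha>: "\<And>j. \<alpha> j \<le> 1"
  shows "multi_deriv \<alpha> (\<lambda>t. \<Prod>j\<in>UNIV. h j (t j)) t
    = (\<Prod>j\<in>UNIV. if \<alpha> j = 1 then deriv (h j) (t j) else h j (t j))"
proof -
  have pd: "partial_deriv i (\<lambda>t. \<Prod>j\<in>UNIV. k j (t j)) = (\<lambda>t. \<Prod>j\<in>UNIV. (if j = i then deriv (k j) else k j) (t j))"
    if k: "\<And>z. k i field_differentiable at z" for i and k :: "'j \<Rightarrow> complex \<Rightarrow> complex"
  proof
    fix t
    have "(\<lambda>z. \<Prod>j\<in>UNIV. k j ((t(i := z)) j)) = (\<lambda>z. k i z * (\<Prod>j\<in>UNIV - {i}. k j (t j)))"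
      by (auto simp: fun_eq_iff prod.remove[of UNIV i] intro!: prod.cong)
    then have "partial_deriv i (\<lambda>t. \<Prod>j\<in>UNIV. k j (t j)) t = deriv (k i) (t i) * (\<Prod>j\<in>UNIV - {i}. k j (t j))"
      unfolding partial_deriv_def using k by (simp add: deriv_cmult_right)
    also have "\<dots> = (\<Prod>j\<in>UNIV. (if j = i then deriv (k j) else k j) (t j))"
      by (auto simp: prod.remove[of UNIV i] intro!: prod.cong)
    finally show "partial_deriv i (\<lambda>t. \<Prod>j\<in>UNIV. k j (t j)) t = (\<Prod>j\<in>UNIV. (if j = i then deriv (k j) else k j) (t j))" .
  qed
  \<comment> \<open>The list \<open>ys\<close> holds the coordinates that the fold has already
    processed; its disjointness from \<open>xs\<close> ensures that no factor is differentiated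
    twice.\<close>
  have "fold (\<lambda>j. partial_deriv j ^^ \<alpha> j) xs (\<lambda>t. \<Prod>j\<in>UNIV. (if j \<in> set ys \<and> \<alpha> j = 1 then deriv (h j) else h j) (t j))
     = (\<lambda>t. \<Prod>j\<in>UNIV. (if j \<in> set xs \<union> set ys \<and> \<alpha> j = 1 then deriv (h j) else h j) (t j))"
    if "distinct xs" "set xs \<inter> set ys = {}" for xs ys
    using that
  proof (induction xs arbitrary: ys)
    case (Cons i xs)
    have "(partial_deriv i ^^ \<alpha> i) (\<lambda>t. \<Prod>j\<in>UNIV. (if j \<in> set ys \<and> \<alpha> j = 1 then deriv (h j) else h j) (t j))
      = (\<lambda>t. \<Prod>j\<in>UNIV. (if j \<in> set (i # ys) \<and> \<alpha> j = 1 then deriv (h j) else h j) (t j))"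
    proof (cases "\<alpha> i = 1")
      case True
      have "i \<notin> set ys" using Cons by auto
      then have "partial_deriv i (\<lambda>t. \<Prod>j\<in>UNIV. (if j \<in> set ys \<and> \<alpha> j = 1 then deriv (h j) else h j) (t j))
        = (\<lambda>t. \<Prod>j\<in>UNIV. (if j = i then deriv (if j \<in> set ys \<and> \<alpha> j = 1 then deriv (h j) else h j)
             else (if j \<in> set ys \<and> \<alpha> j = 1 then deriv (h j) else h j)) (t j))"
        using h by (intro pd) auto
      also have "\<dots> = (\<lambda>t. \<Prod>j\<in>UNIV. (if j \<in> set (i # ys) \<and> \<alpha> j = 1 then deriv (h j) else h j) (t j))"
        using True \<open>i \<notin> set ys\<close> by (intro ext prod.cong) auto
      finally show ?thesis using True by simp
    next
      case False
      then have "\<alpha> i = 0" using \<alpha>[of i] by auto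
      then show ?thesis by (simp, intro ext prod.cong) auto
    qed
    moreover have "fold (\<lambda>j. partial_deriv j ^^ \<alpha> j) xs (\<lambda>t. \<Prod>j\<in>UNIV. (if j \<in> set (i # ys) \<and> \<alpha> j = 1 then deriv (h j) else h j) (t j))
     = (\<lambda>t. \<Prod>j\<in>UNIV. (if j \<in> set xs \<union> set (i # ys) \<and> \<alpha> j = 1 then deriv (h j) else h j) (t j))"
      using Cons.prems by (intro Cons.IH) auto
    ultimately show ?case by simp
  qed simp
  from this[of "sorted_list_of_set UNIV" "[]"]
  show ?thesis by (simp add: multi_deriv_def if_distrib[of "\<lambda>f. f _"] cong: if_cong)
qed

text \<open>The nilpotent part \<open>epsi x x\<close> of \<open>\<tau> x\<close> squares to zero,
  so only exponents 0 and 1 survive, all factorials are 1, and exponent vectors become sets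
  \<open>S\<close> of sites.\<close>

lemma form_fun_prod_\<tau>:
  fixes h :: "'m::{finite,linorder} \<Rightarrow> complex \<Rightarrow> complex"
  assumes h: "\<And>j z. h j field_differentiable at z"
  shows "form_fun (\<lambda>t. \<Prod>j\<in>UNIV. h j (t j)) \<tau> = form_of (\<Sum>S\<in>UNIV.
     efn (\<lambda>p. \<Prod>x\<in>UNIV. if x \<in> S then deriv (h x) (cvec p $ x * cnj (cvec p $ x)) else h x (cvec p $ x * cnj (cvec p $ x)))
     * (\<Prod>x\<in>S. epsi x x))"
proof -
  let ?t = "\<lambda>p x. cvec p $ x * cnj (cvec p $ x)"
  let ?F = "\<lambda>t. \<Prod>j\<in>UNIV. h j (t j)"
  let ?R = "{\<alpha> :: 'm \<Rightarrow> nat. 2 * (\<Sum>j\<in>UNIV. \<alpha> j) \<le> CARD('m coord)}"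
  let ?e = "\<lambda>\<alpha>. efn (\<lambda>p. multi_deriv \<alpha> ?F (\<lambda>j. ?t p j) / (\<Prod>j\<in>UNIV. fact (\<alpha> j))) * (\<Prod>j\<in>UNIV. epsi j j ^ \<alpha> j)"
  have d: "deg0 (\<tau> j) = (\<lambda>p. ?t p j)" for j
    unfolding \<tau>_eq by (rule deg0_form_of_homog[OF homog_epsi]) simp
  have "prod_list (map (\<lambda>j. (\<tau> j - form_fn (deg0 (\<tau> j))) ^ \<alpha> j) (sorted_list_of_set UNIV))
      = form_of (\<Prod>j\<in>UNIV. epsi j j ^ \<alpha> j)" for \<alpha> :: "'m \<Rightarrow> nat"
    by (subst form_of_prod) (simp_all add: form_of_power d, simp add: \<tau>_eq)
  then have "form_fun ?F \<tau> = form_of (\<Sum>\<alpha>\<in>?R. ?e \<alpha>)"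
    unfolding form_fun_def d by (simp add: form_of_sum form_of_simps form_of_efn)
  also have "(\<Sum>\<alpha>\<in>?R. ?e \<alpha>) = (\<Sum>\<alpha>\<in>?R \<inter> {\<alpha>. \<forall>j. \<alpha> j \<le> 1}. ?e \<alpha>)"
  proof (intro sum.mono_neutral_right ballI)
    have "?R \<subseteq> PiE UNIV (\<lambda>_. {..CARD('m coord)})"
    proof
      fix \<alpha> assume \<alpha>: "\<alpha> \<in> ?R"
      have "\<alpha> j \<le> CARD('m coord)" for j
      proof -
        have "\<alpha> j \<le> (\<Sum>j\<in>UNIV. \<alpha> j)" by (rule member_le_sum) auto
        moreover have "2 * (\<Sum>j\<in>UNIV. \<alpha> j) \<le> CARD('m coord)" using \<alpha> by simp
        ultimately show ?thesis by linarith
      qed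
      then show "\<alpha> \<in> PiE UNIV (\<lambda>_. {..CARD('m coord)})" by auto
    qed
    then show "finite ?R" by (rule finite_subset) (intro finite_PiE, auto)
    fix \<alpha> assume "\<alpha> \<in> ?R - ?R \<inter> {\<alpha>. \<forall>j. \<alpha> j \<le> 1}"
    then obtain j where "\<not> \<alpha> j \<le> 1" by auto
    then have k: "\<alpha> j = Suc (Suc (\<alpha> j - 2))" by arith
    have "epsi j j * epsi j j = 0" unfolding epsi_def by (intro pair_prod_same_left homog_psi)
    then have "epsi j j ^ \<alpha> j = 0" by (subst k) (simp add: mult.assoc[symmetric])
    then have "(\<Prod>j\<in>UNIV. epsi j j ^ \<alpha> j) = 0" by (intro prod_zero) auto
    then show "?e \<alpha> = 0" by simp
  qed auto
  \<comment> \<open>The degree cutoff admits a total exponent up to the number of sites, so it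
    excludes no vector of zeros and ones.\<close>
  also have "?R \<inter> {\<alpha>. \<forall>j. \<alpha> j \<le> 1} = {\<alpha>. \<forall>j. \<alpha> j \<le> 1}"
  proof -
    have "\<alpha> \<in> ?R" if "\<forall>j. \<alpha> j \<le> 1" for \<alpha> :: "'m \<Rightarrow> nat"
    proof -
      have "(\<Sum>j\<in>UNIV. \<alpha> j) \<le> (\<Sum>j\<in>(UNIV::'m set). 1)" using that by (intro sum_mono) auto
      then show ?thesis by (simp add: card_coord)
    qed
    then show ?thesis by auto
  qed
  also have "(\<Sum>\<alpha>\<in>{\<alpha>. \<forall>j. \<alpha> j \<le> 1}. ?e \<alpha>) = (\<Sum>S\<in>UNIV.
     efn (\<lambda>p. \<Prod>x\<in>UNIV. if x \<in> S then deriv (h x) (?t p x) else h x (?t p x)) * (\<Prod>x\<in>S. epsi x x))"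
  proof (rule sum.reindex_bij_witness[where i = "\<lambda>S j. if j \<in> S then 1 else 0" and j = "\<lambda>\<alpha>. {j. \<alpha> j = 1}"], goal_cases)
    case (1 \<alpha>)
    show ?case
    proof
      fix j show "(if j \<in> {j. \<alpha> j = 1} then 1 else 0) = \<alpha> j"
        using 1 by (cases "\<alpha> j = 1") (auto dest!: spec[of _ j] simp: le_Suc_eq)
    qed
  next
    case (5 \<alpha>)
    have a01: "\<alpha> j = 0 \<or> \<alpha> j = 1" for j using 5 by (auto dest!: spec[of _ j] simp: le_Suc_eq)
    have f: "fact (\<alpha> j) = (1::complex)" for j using a01[of j] by auto
    have "(\<Prod>x\<in>{j. \<alpha> j = 1}. epsi x x) = (\<Prod>j\<in>UNIV. epsi j j ^ \<alpha> j)"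
    proof (intro prod.mono_neutral_cong_left ballI)
      show "epsi j j ^ \<alpha> j = 1" if "j \<in> UNIV - {j. \<alpha> j = 1}" for j using that a01[of j] by auto
    qed auto
    then show ?case using 5 h by (simp add: multi_deriv_prod f)
  qed auto
  finally show ?thesis .
qed


text \<open>The sites of \<open>S\<close> take their pair of differentials from \<tau>. Since
  \<open>yrow x r\<close> and \<open>epsi x x\<close> share the factor \<open>\<psi> x\<close>, only
  the rows outside \<open>S\<close> contribute.\<close>

definition fermion_coeff :: "complex ^ 'm::{finite,linorder} ^ 'm::{finite,linorder} \<Rightarrow> 'm set \<Rightarrow> complex" where
  "fermion_coeff V S = top_coeff ((\<Prod>x\<in>UNIV. 1 - yrow x (V $ x)) * (\<Prod>x\<in>S. epsi x x)) 0"

lemma const_form_sum: "(\<And>x. x \<in> A \<Longrightarrow> const_form (f x)) \<Longrightarrow> const_form (sum f A :: 'i::{finite,linorder} form)"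
  by (induction A rule: infinite_finite_induct) (auto intro!: const_form_simps)

lemma const_form_yrow: "const_form (form_of (yrow x r))"
  unfolding yrow_def form_of_sum form_of_simps form_of_efn form_of_epsi
  by (intro const_form_sum const_form_simps const_form_psi)

lemma fermion_coeff_eq:
  "top_coeff ((\<Prod>x\<in>UNIV. 1 - yrow x (V $ x)) * (\<Prod>x\<in>S. epsi x x)) p = fermion_coeff V S"
  unfolding fermion_coeff_def
proof (rule const_form_top_coeff)
  show "const_form (form_of ((\<Prod>x\<in>UNIV. 1 - yrow x (V $ x)) * (\<Prod>x\<in>S. epsi x x)))"
    unfolding form_of_simps
    by (intro const_form_simps const_form_prod) (auto simp: form_of_simps form_of_epsi intro!: const_form_simps const_form_yrow const_form_psi)
qed

text \<open>The factor \<open>1 + z x * epsi x x\<close> is absorbed into row \<open>x\<close> because both contain \<open>\<psi> x\<close>.\<close>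

lemma sum_fermion_coeff:
  fixes V :: "complex ^ 'm::{finite,linorder} ^ 'm::{finite,linorder}"
  shows "(\<Sum>S\<in>UNIV. (\<Prod>x\<in>S. z x) * fermion_coeff V S) = mform berezin (\<chi> x. V $ x - axis x (z x))"
proof -
  have efn_prod: "(\<Prod>x\<in>S. efn (\<lambda>_. z x)) = (efn (\<lambda>_. \<Prod>x\<in>S. z x) :: 'm coord eform)" for S :: "'m set"
    by (induction S rule: infinite_finite_induct) (auto simp: efn_hom)
  have row: "(1 - yrow x (V $ x)) * (efn (\<lambda>_. z x) * epsi x x + 1) = 1 - yrow x (V $ x - axis x (z x))" for x
  proof -
    have "yrow x (V $ x) * (efn (\<lambda>_. z x) * epsi x x) = 0"
      using yrow_mult_yrow[of x "V $ x" "axis x (z x)"] by (simp add: yrow_axis)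
    moreover have "yrow x (V $ x - axis x (z x)) = yrow x (V $ x) - efn (\<lambda>_. z x) * epsi x x"
      using yrow_add[of x "V $ x - axis x (z x)" "axis x (z x)"] by (simp add: yrow_axis)
    ultimately show ?thesis by (simp add: algebra_simps)
  qed
  have "(\<Sum>S\<in>UNIV. (\<Prod>x\<in>S. z x) * fermion_coeff V S)
    = top_coeff (\<Sum>S\<in>Pow UNIV. (\<Prod>x\<in>UNIV. 1 - yrow x (V $ x)) * (\<Prod>x\<in>S. efn (\<lambda>_. z x) * epsi x x)) 0"
    by (simp add: top_coeff_sum prod.distrib efn_prod mult.left_commute[of _ "efn _"] top_coeff_simps fermion_coeff_eq)
  also have "(\<Sum>S\<in>Pow UNIV. (\<Prod>x\<in>UNIV. 1 - yrow x (V $ x)) * (\<Prod>x\<in>S. efn (\<lambda>_. z x) * epsi x x))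
     = (\<Prod>x\<in>UNIV. 1 - yrow x (V $ x)) * (\<Prod>x\<in>UNIV. efn (\<lambda>_. z x) * epsi x x + 1)"
    by (subst prod_add) (simp_all add: sum_distrib_left)
  also have "\<dots> = (\<Prod>x\<in>UNIV. 1 - yrow x ((\<chi> x. V $ x - axis x (z x)) $ x))"
    by (simp only: prod.distrib[symmetric] row vec_lambda_beta)
  finally show ?thesis by (simp only: top_coeff_prod_yrow)
qed

text \<open>Functions are central and the fermionic factors have constant coefficients, so the point
  enters each term only through a scalar, with \<open>fermion_coeff\<close> as a constant
  multiplier.\<close>

lemma coeff_integrand:
  fixes h :: "'m::{finite,linorder} \<Rightarrow> complex \<Rightarrow> complex"
  assumes h: "\<And>j z. h j field_differentiable at z"
  shows "coeff (form_exp (- S_form A) * \<phi>bar a * \<phi> b * form_fun (\<lambda>t. \<Prod>j\<in>UNIV. h j (t j)) \<tau>) p UNIV =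
    (\<Sum>S\<in>UNIV. exp (- sesq (cmat A) (cvec p) (cvec p)) * (cnj (cvec p $ a) * cvec p $ b)
      * (\<Prod>x\<in>UNIV. if x \<in> S then deriv (h x) (cvec p $ x * cnj (cvec p $ x)) else h x (cvec p $ x * cnj (cvec p $ x)))
      * fermion_coeff (cmat A) S)"
proof -
  let ?h = "\<lambda>S p. \<Prod>x\<in>UNIV. if x \<in> S then deriv (h x) (cvec p $ x * cnj (cvec p $ x)) else h x (cvec p $ x * cnj (cvec p $ x))"
  let ?Y = "\<Prod>x\<in>UNIV. 1 - yrow x (cmat A $ x)"
  let ?K = "efn (\<lambda>p. exp (- sesq (cmat A) (cvec p) (cvec p))) * ?Y * efn (\<lambda>p. cnj (cvec p $ a)) * efn (\<lambda>p. cvec p $ b)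
       * (\<Sum>S\<in>UNIV. efn (?h S) * (\<Prod>x\<in>S. epsi x x))"
  have K: "form_exp (- S_form A) * \<phi>bar a * \<phi> b * form_fun (\<lambda>t. \<Prod>j\<in>UNIV. h j (t j)) \<tau> = form_of ?K"
    unfolding form_exp_S_form form_fun_prod_\<tau>[OF h] \<phi>_eq \<phi>bar_eq by (simp only: form_of_simps form_of_efn)
  have "?K = (\<Sum>S\<in>UNIV. efn (\<lambda>p. exp (- sesq (cmat A) (cvec p) (cvec p))) * (efn (\<lambda>p. cnj (cvec p $ a)) *
      (efn (\<lambda>p. cvec p $ b) * (efn (?h S) * (?Y * (\<Prod>x\<in>S. epsi x x))))))"
    unfolding sum_distrib_left by (intro sum.cong refl) (simp only: mult_ac)
  then have "top_coeff ?K p = (\<Sum>S\<in>UNIV. exp (- sesq (cmat A) (cvec p) (cvec p)) * (cnj (cvec p $ a) *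
      (cvec p $ b * (?h S p * fermion_coeff (cmat A) S))))"
    by (simp only: top_coeff_sum top_coeff_simps fermion_coeff_eq)
  then show ?thesis unfolding K by (simp only: top_coeff_def mult.assoc)
qed

section \<open>The Fourier representation of the quartic weight\<close>

abbreviation std_gauss :: "real measure" where
  "std_gauss \<equiv> std_normal_distribution"

text \<open>The scale sqrt(2 g) is chosen because the characteristic function of the standard normal
  law at sqrt(2 g) t is exp(- g t^2).\<close>

definition freq :: "real \<Rightarrow> real \<Rightarrow> real \<Rightarrow> complex" where
  "freq g c \<xi> = \<i> * of_real (sqrt (2 * g) * \<xi>) - of_real c"

text \<open>The modulus does not depend on the frequency; the phase moves the centre of the Gaussian
  in t to \<open>(c - lam) / (2 * g)\<close>.\<close>

definition wgt :: "real \<Rightarrow> real \<Rightarrow> real \<Rightarrow> real \<Rightarrow> complex" where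
  "wgt g lam c \<xi> = of_real (exp ((c - lam)\<^sup>2 / (4 * g))) * iexp (- (\<xi> * (c - lam) / sqrt (2 * g)))"

definition quart :: "real \<Rightarrow> real \<Rightarrow> complex \<Rightarrow> complex" where
  "quart g lam z = exp (- of_real g * z\<^sup>2 - of_real lam * z)"

interpretation std_gauss: real_distribution std_gauss
  by (rule real_dist_normal_dist)

lemma measurable_freq [measurable]: "freq g c \<in> borel_measurable borel"
  unfolding freq_def by measurable

lemma measurable_wgt [measurable]: "wgt g lam c \<in> borel_measurable borel"
  unfolding wgt_def by measurable

lemma norm_wgt: "norm (wgt g lam c \<xi>) = exp ((c - lam)\<^sup>2 / (4 * g))"
  unfolding wgt_def norm_mult by simp

lemma norm_exp_freq: "norm (exp (freq g c \<xi> * of_real t)) = exp (- (c * t))"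
  by (simp add: freq_def)

lemma norm_freq_le: "norm (freq g c \<xi>) \<le> sqrt (2 * \<bar>g\<bar>) * \<bar>\<xi>\<bar> + \<bar>c\<bar>"
proof -
  have "norm (freq g c \<xi>) \<le> norm (\<i> * complex_of_real (sqrt (2 * g) * \<xi>)) + norm (complex_of_real c)"
    unfolding freq_def by (rule norm_triangle_ineq4)
  also have "\<dots> = \<bar>sqrt (2 * g)\<bar> * \<bar>\<xi>\<bar> + \<bar>c\<bar>" by (simp add: norm_mult)
  also have "\<bar>sqrt (2 * g)\<bar> = sqrt (2 * \<bar>g\<bar>)" by (cases "0 \<le> g") (auto simp: real_sqrt_minus[symmetric])
  finally show ?thesis .
qed

lemma integrable_stdn_abs: "integrable std_gauss (\<lambda>\<xi>. \<bar>\<xi>\<bar>)"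
  using integrable_std_normal_moment_abs[of 1]
  by (subst integrable_density) (auto simp: normal_density_nonneg)

lemma integrable_stdn_freq_bound: "integrable std_gauss (\<lambda>\<xi>. C * (sqrt (2 * \<bar>g\<bar>) * \<bar>\<xi>\<bar> + \<bar>c\<bar>))"
  by (intro integrable_mult_right Bochner_Integration.integrable_add integrable_stdn_abs) simp

lemma integrable_wgt_exp:
  "integrable std_gauss (\<lambda>\<xi>. wgt g lam c \<xi> * exp (freq g c \<xi> * of_real t))"
  by (rule std_gauss.integrable_const_bound[where B = "exp ((c - lam)\<^sup>2 / (4 * g)) * exp (- (c * t))"])
     (auto simp: norm_mult norm_wgt norm_exp_freq simp del: norm_exp_eq_Re)

lemma integrable_wgt_freq_exp:
  "integrable std_gauss (\<lambda>\<xi>. wgt g lam c \<xi> * (freq g c \<xi> * exp (freq g c \<xi> * of_real t)))"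
proof (rule Bochner_Integration.integrable_bound)
  show "integrable std_gauss (\<lambda>\<xi>. (exp ((c - lam)\<^sup>2 / (4 * g)) * exp (- (c * t))) * (sqrt (2 * \<bar>g\<bar>) * \<bar>\<xi>\<bar> + \<bar>c\<bar>))"
    by (rule integrable_stdn_freq_bound)
  show "AE \<xi> in std_gauss. norm (wgt g lam c \<xi> * (freq g c \<xi> * exp (freq g c \<xi> * of_real t)))
      \<le> norm ((exp ((c - lam)\<^sup>2 / (4 * g)) * exp (- (c * t))) * (sqrt (2 * \<bar>g\<bar>) * \<bar>\<xi>\<bar> + \<bar>c\<bar>))"
  proof (rule AE_I2)
    fix \<xi>
    have "norm (wgt g lam c \<xi> * (freq g c \<xi> * exp (freq g c \<xi> * of_real t)))
      = (exp ((c - lam)\<^sup>2 / (4 * g)) * exp (- (c * t))) * norm (freq g c \<xi>)"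
      unfolding norm_mult norm_wgt norm_exp_freq by simp
    also have "\<dots> \<le> (exp ((c - lam)\<^sup>2 / (4 * g)) * exp (- (c * t))) * (sqrt (2 * \<bar>g\<bar>) * \<bar>\<xi>\<bar> + \<bar>c\<bar>)"
      by (intro mult_left_mono norm_freq_le) auto
    finally show "norm (wgt g lam c \<xi> * (freq g c \<xi> * exp (freq g c \<xi> * of_real t)))
      \<le> norm ((exp ((c - lam)\<^sup>2 / (4 * g)) * exp (- (c * t))) * (sqrt (2 * \<bar>g\<bar>) * \<bar>\<xi>\<bar> + \<bar>c\<bar>))"
      by simp
  qed
qed auto

text \<open>Completing the square, \<open>- g t\<^sup>2 - lam t = (c - lam)\<^sup>2 / (4 g) - g (t - (c - lam) / (2 g))\<^sup>2 - c t\<close>,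
  reduces this to the characteristic function of the normal distribution. The exponent \<open>c\<close> is free and
  is chosen later so that all Gaussian integrals converge.\<close>

lemma quart_eq:
  assumes g: "0 < g"
  shows "quart g lam (of_real t) = (\<integral>\<xi>. wgt g lam c \<xi> * exp (freq g c \<xi> * of_real t) \<partial>std_gauss)"
proof -
  define u where "u = sqrt (2 * g) * (t - (c - lam) / (2 * g))"
  have u2: "u\<^sup>2 / 2 = g * (t - (c - lam) / (2 * g))\<^sup>2"
    using g by (simp add: u_def power_mult_distrib)
  have "wgt g lam c \<xi> * exp (freq g c \<xi> * of_real t)
     = of_real (exp ((c - lam)\<^sup>2 / (4 * g) - c * t)) * iexp (u * \<xi>)" for \<xi>
  proof -
    have "sqrt (2 * g) * ((c - lam) / (2 * g)) = (c - lam) / sqrt (2 * g)"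
      using g by (simp add: field_simps)
    then have "u * \<xi> = sqrt (2 * g) * \<xi> * t - \<xi> * (c - lam) / sqrt (2 * g)"
      by (simp add: u_def right_diff_distrib left_diff_distrib mult_ac)
    then have iu: "\<i> * complex_of_real (u * \<xi>) = \<i> * of_real (sqrt (2 * g) * \<xi> * t) + \<i> * of_real (- (\<xi> * (c - lam) / sqrt (2 * g)))"
      by (simp only: of_real_diff of_real_minus) (simp add: algebra_simps)
    have "freq g c \<xi> * of_real t = \<i> * of_real (sqrt (2 * g) * \<xi> * t) + of_real (- (c * t))"
      by (simp add: freq_def algebra_simps)
    then have f: "exp (freq g c \<xi> * of_real t) = exp (\<i> * of_real (sqrt (2 * g) * \<xi> * t)) * of_real (exp (- (c * t)))"
      unfolding exp_of_real[symmetric] exp_add[symmetric] by (rule arg_cong)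
    have r: "exp ((c - lam)\<^sup>2 / (4 * g) - c * t) = exp ((c - lam)\<^sup>2 / (4 * g)) * exp (- (c * t))"
      unfolding exp_add[symmetric] by simp
    have "a * b * (i * e) = (a * e) * (i * b)" for a b i e :: complex by simp
    then show ?thesis
      unfolding wgt_def iu exp_add f r of_real_mult[of "exp _" "exp _"] .
  qed
  then have "(\<integral>\<xi>. wgt g lam c \<xi> * exp (freq g c \<xi> * of_real t) \<partial>std_gauss)
     = of_real (exp ((c - lam)\<^sup>2 / (4 * g) - c * t)) * char std_gauss u"
    by (simp add: char_def)
  also have "\<dots> = of_real (exp ((c - lam)\<^sup>2 / (4 * g) - c * t) * exp (- (u\<^sup>2) / 2))"
    by (simp add: char_std_normal_distribution)
  also have "exp ((c - lam)\<^sup>2 / (4 * g) - c * t) * exp (- (u\<^sup>2) / 2) = exp (- g * t\<^sup>2 - lam * t)"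
  proof -
    have "(c - lam)\<^sup>2 / (4 * g) - c * t + - (u\<^sup>2) / 2 = - g * t\<^sup>2 - lam * t"
    proof -
      have "g * (t - m / (2 * g))\<^sup>2 = g * t\<^sup>2 - m * t + m\<^sup>2 / (4 * g)" for m
        using g by (simp add: power2_eq_square field_simps)
      from this[of "c - lam"] have "- (u\<^sup>2) / 2 = - (g * t\<^sup>2 - (c - lam) * t + (c - lam)\<^sup>2 / (4 * g))"
        using u2 by linarith
      then show ?thesis
        by (simp only:) (simp add: algebra_simps)
    qed
    then show ?thesis by (simp only: exp_add[symmetric])
  qed
  finally show ?thesis
    by (simp add: quart_def exp_of_real[symmetric])
qed

lemma quart_deriv: "(quart g lam has_field_derivative (- 2 * of_real g * z - of_real lam) * quart g lam z) (at z)"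
  unfolding quart_def by (auto intro!: derivative_eq_intros simp: algebra_simps)

text \<open>\<open>form_fun\<close> takes complex derivatives, whereas the Fourier formula holds at
  real arguments. Both give the derivative along the real line, and its uniqueness identifies them.
  The first absolute moment of the normal law makes the majorant integrable.\<close>

lemma quart_deriv_eq:
  assumes g: "0 < g"
  shows "deriv (quart g lam) (of_real t) = (\<integral>\<xi>. wgt g lam c \<xi> * (freq g c \<xi> * exp (freq g c \<xi> * of_real t)) \<partial>std_gauss)"
proof -
  \<comment> \<open>The majorant is local: exp(- c h) is in general not bounded over the whole
    line.\<close>
  let ?S = "{t - 1..t + 1}"
  let ?C = "exp ((c - lam)\<^sup>2 / (4 * g)) * exp (\<bar>c\<bar> * (\<bar>t\<bar> + 1))"
  have "((\<lambda>h. \<integral>\<xi>. wgt g lam c \<xi> * exp (freq g c \<xi> * of_real h) \<partial>std_gauss) has_vector_derivative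
     (\<integral>\<xi>. wgt g lam c \<xi> * (freq g c \<xi> * exp (freq g c \<xi> * of_real t)) \<partial>std_gauss)) (at t within ?S)"
  proof (rule has_vector_derivative_integral)
    show "integrable std_gauss (\<lambda>\<xi>. ?C * (sqrt (2 * \<bar>g\<bar>) * \<bar>\<xi>\<bar> + \<bar>c\<bar>))"
      by (rule integrable_stdn_freq_bound)
    fix h \<xi> assume h: "h \<in> ?S"
    have "((\<lambda>h. exp (freq g c \<xi> * h)) has_field_derivative exp (freq g c \<xi> * of_real h) * freq g c \<xi>) (at (of_real h))"
      by (auto intro!: derivative_eq_intros)
    then have "((\<lambda>h. exp (freq g c \<xi> * of_real h)) has_vector_derivative exp (freq g c \<xi> * of_real h) * freq g c \<xi>) (at h within ?S)"
      by (intro has_vector_derivative_real_field)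
    then show "((\<lambda>h. wgt g lam c \<xi> * exp (freq g c \<xi> * of_real h)) has_vector_derivative
        wgt g lam c \<xi> * (freq g c \<xi> * exp (freq g c \<xi> * of_real h))) (at h within ?S)"
      by (subst mult.commute[of "freq g c \<xi>" "exp _"]) (rule has_vector_derivative_mult_right)
    have "- (c * h) \<le> \<bar>c\<bar> * \<bar>h\<bar>" by (metis abs_ge_minus_self abs_mult)
    also have "\<dots> \<le> \<bar>c\<bar> * (\<bar>t\<bar> + 1)" using h by (intro mult_left_mono) auto
    finally have ch: "exp (- (c * h)) \<le> exp (\<bar>c\<bar> * (\<bar>t\<bar> + 1))" by simp
    have "norm (wgt g lam c \<xi> * (freq g c \<xi> * exp (freq g c \<xi> * of_real h)))
       = exp ((c - lam)\<^sup>2 / (4 * g)) * exp (- (c * h)) * norm (freq g c \<xi>)"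
      unfolding norm_mult norm_wgt norm_exp_freq by simp
    also have "\<dots> \<le> ?C * (sqrt (2 * \<bar>g\<bar>) * \<bar>\<xi>\<bar> + \<bar>c\<bar>)"
      using ch by (intro mult_mono norm_freq_le) auto
    finally show "norm (wgt g lam c \<xi> * (freq g c \<xi> * exp (freq g c \<xi> * of_real h))) \<le> ?C * (sqrt (2 * \<bar>g\<bar>) * \<bar>\<xi>\<bar> + \<bar>c\<bar>)" .
  qed (auto simp: integrable_wgt_exp)
  then have 1: "((\<lambda>h. quart g lam (of_real h)) has_vector_derivative
     (\<integral>\<xi>. wgt g lam c \<xi> * (freq g c \<xi> * exp (freq g c \<xi> * of_real t)) \<partial>std_gauss)) (at t within ?S)"
    by (simp only: quart_eq[OF g, symmetric])
  have 2: "((\<lambda>h. quart g lam (of_real h)) has_vector_derivative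
     (- 2 * of_real g * of_real t - of_real lam) * quart g lam (of_real t)) (at t within ?S)"
    by (intro has_vector_derivative_real_field quart_deriv)
  have "(\<integral>\<xi>. wgt g lam c \<xi> * (freq g c \<xi> * exp (freq g c \<xi> * of_real t)) \<partial>std_gauss)
      = (- 2 * of_real g * of_real t - of_real lam) * quart g lam (of_real t)"
    by (rule vector_derivative_unique_within[OF _ 1 2]) (simp add: trivial_limit_within islimpt_Icc)
  then show ?thesis
    by (simp only: DERIV_imp_deriv[OF quart_deriv])
qed

section \<open>Independent frequencies, one for each site\<close>

abbreviation freq_measure :: "('m \<Rightarrow> real) measure" where
  "freq_measure \<equiv> PiM UNIV (\<lambda>_. std_gauss)"

definition total_wgt :: "real \<Rightarrow> real \<Rightarrow> real \<Rightarrow> ('m::finite \<Rightarrow> real) \<Rightarrow> complex" where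
  "total_wgt g lam c \<xi> = (\<Prod>x\<in>UNIV. wgt g lam c (\<xi> x))"

interpretation freq_prod: product_prob_space "\<lambda>_. std_gauss" UNIV
  by unfold_locales

text \<open>A derivative at a site of \<open>S\<close> contributes a factor \<open>freq\<close>
  there, and independence of the frequencies turns the product of one-dimensional integrals into one
  integral.\<close>

lemma prod_quart_eq:
  fixes t :: "'m::finite \<Rightarrow> real"
  assumes g: "0 < g"
  shows "(\<Prod>x\<in>UNIV. if x \<in> S then deriv (quart g lam) (of_real (t x)) else quart g lam (of_real (t x)))
     = (\<integral>\<xi>. total_wgt g lam c \<xi> * (\<Prod>x\<in>S. freq g c (\<xi> x)) * exp (\<Sum>x\<in>UNIV. freq g c (\<xi> x) * of_real (t x)) \<partial>freq_measure)"
    (is "_ = integral\<^sup>L _ ?F")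
    and "integrable freq_measure (\<lambda>\<xi>. total_wgt g lam c \<xi> * (\<Prod>x\<in>S. freq g c (\<xi> x)) * exp (\<Sum>x\<in>UNIV. freq g c (\<xi> x) * of_real (t x)))"
proof -
  let ?f = "\<lambda>x \<xi>. wgt g lam c \<xi> * ((if x \<in> S then freq g c \<xi> else 1) * exp (freq g c \<xi> * of_real (t x)))"
  have F: "?F = (\<lambda>\<xi>. \<Prod>x\<in>UNIV. ?f x (\<xi> x))"
    unfolding fun_eq_iff
  proof
    fix \<xi> :: "'m \<Rightarrow> real"
    have "(\<Prod>x\<in>S. freq g c (\<xi> x)) = (\<Prod>x\<in>UNIV. if x \<in> S then freq g c (\<xi> x) else 1)"
      by (simp add: prod.If_cases)
    then show "?F \<xi> = (\<Prod>x\<in>UNIV. ?f x (\<xi> x))"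
      by (simp add: total_wgt_def prod.distrib exp_sum mult.assoc)
  qed
  have int: "integrable std_gauss (?f x)" for x
    using integrable_wgt_exp[of g lam c "t x"] integrable_wgt_freq_exp[of g lam c "t x"] by (cases "x \<in> S") auto
  show "integrable freq_measure ?F"
    unfolding F by (intro freq_prod.product_integrable_prod int) auto
  have "(\<integral>\<xi>. (\<Prod>x\<in>UNIV. ?f x (\<xi> x)) \<partial>freq_measure) = (\<Prod>x\<in>UNIV. \<integral>\<xi>. ?f x \<xi> \<partial>std_gauss)"
    by (intro freq_prod.product_integral_prod int) auto
  also have "\<dots> = (\<Prod>x\<in>UNIV. if x \<in> S then deriv (quart g lam) (of_real (t x)) else quart g lam (of_real (t x)))"
    by (intro prod.cong) (auto simp: quart_eq[OF g, of _ _ c] quart_deriv_eq[OF g, of _ _ c])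
  finally show "(\<Prod>x\<in>UNIV. if x \<in> S then deriv (quart g lam) (of_real (t x)) else quart g lam (of_real (t x)))
     = integral\<^sup>L freq_measure ?F"
    unfolding F by simp
qed


section \<open>The integral of forms as an average of inverse matrix elements\<close>

definition freq_mat :: "real ^ 'm::finite ^ 'm::finite \<Rightarrow> real \<Rightarrow> real \<Rightarrow> ('m \<Rightarrow> real) \<Rightarrow> complex ^ 'm ^ 'm" where
  "freq_mat A g c \<xi> = (\<chi> x. cmat A $ x - axis x (freq g c (\<xi> x)))"

lemma sesq_freq_mat:
  "sesq (freq_mat A g c \<xi>) z z = sesq (cmat A) z z - (\<Sum>x\<in>UNIV. freq g c (\<xi> x) * (z $ x * cnj (z $ x)))"
proof -
  have "z $ x * freq_mat A g c \<xi> $ x $ y * cnj (z $ y) = z $ x * cmat A $ x $ y * cnj (z $ y)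
      - (if y = x then freq g c (\<xi> x) * (z $ x * cnj (z $ x)) else 0)" for x y
    by (auto simp: freq_mat_def axis_def algebra_simps)
  then show ?thesis by (simp add: sesq_def sum_subtractf)
qed

text \<open>The oscillating part of \<open>freq\<close> is imaginary on the diagonal and drops out
  of the real part. Only \<open>c\<close> counts: it outweighs the sum of the absolute entries of
  \<open>A\<close> with 1 to spare, for all frequencies at once.\<close>

lemma coercive_freq_mat:
  fixes A :: "real ^ 'm::finite ^ 'm::finite"
  assumes c: "1 + (\<Sum>x\<in>UNIV. \<Sum>y\<in>UNIV. \<bar>A $ x $ y\<bar>) \<le> c"
  shows "coercive (freq_mat A g c \<xi>)"
  unfolding coercive_def
proof
  fix z :: "complex ^ 'm"
  let ?n = "\<Sum>x\<in>UNIV. \<Sum>y\<in>UNIV. \<bar>A $ x $ y\<bar>"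
  have "norm (sesq (cmat A) z z) \<le> ?n * (norm z)\<^sup>2"
    using norm_sesq_le[of "cmat A" z z] by (simp add: cmat_def power2_eq_square mult.assoc)
  then have 1: "- (?n * (norm z)\<^sup>2) \<le> Re (sesq (cmat A) z z)"
    using abs_Re_le_cmod[of "sesq (cmat A) z z"] by linarith
  have "Re (freq g c (\<xi> x) * (z $ x * cnj (z $ x))) = - (c * (norm (z $ x))\<^sup>2)" for x
    unfolding complex_norm_square[symmetric] by (simp add: freq_def)
  then have 2: "Re (\<Sum>x\<in>UNIV. freq g c (\<xi> x) * (z $ x * cnj (z $ x))) = - (c * (norm z)\<^sup>2)"
    by (simp add: sum_negf sum_distrib_left[symmetric] norm_vec_def L2_set_def sum_nonneg)
  have "(1 + ?n) * (norm z)\<^sup>2 \<le> c * (norm z)\<^sup>2" using c by (intro mult_right_mono) auto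
  then show "(norm z)\<^sup>2 \<le> Re (sesq (freq_mat A g c \<xi>) z z)"
    using 1 2 by (simp add: sesq_freq_mat algebra_simps)
qed

text \<open>The normalisations cancel as well: at the identity matrix the Gaussian integral is pi to
  the number of sites, and the fermionic coefficient is its reciprocal.\<close>

lemma gauss_I_mform:
  fixes V U :: "complex ^ 'm::{finite,linorder} ^ 'm::{finite,linorder}"
  assumes "coercive V" "U ** V = mat 1"
  shows "mform berezin V * gauss_I V a b = U $ a $ b"
proof -
  have "gauss_Z V * mform berezin V = 1"
    using gauss_Z_mform[OF assms(1) mform_berezin_alternating] by (simp add: mform_berezin_mat_1)
  then show ?thesis by (simp add: gauss_I_eq[OF assms] mult_ac)
qed

lemma measurable_freq_measure_component:
  "(\<lambda>\<xi>. \<xi> x) \<in> borel_measurable (freq_measure :: ('m \<Rightarrow> real) measure)"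
  using measurable_component_singleton[of x UNIV "\<lambda>_. std_gauss"] by simp

lemma measurable_freq_component:
  "(\<lambda>\<xi>. freq g c (\<xi> x)) \<in> borel_measurable (freq_measure :: ('m \<Rightarrow> real) measure)"
  by (rule measurable_compose[OF measurable_freq_measure_component]) measurable

lemma measurable_wgt_component:
  "(\<lambda>\<xi>. wgt g lam c (\<xi> x)) \<in> borel_measurable (freq_measure :: ('m \<Rightarrow> real) measure)"
  by (rule measurable_compose[OF measurable_freq_measure_component]) measurable

lemma measurable_total_wgt [measurable]:
  "(total_wgt g lam c :: ('m::finite \<Rightarrow> real) \<Rightarrow> complex) \<in> borel_measurable freq_measure"
  unfolding total_wgt_def by (intro borel_measurable_prod measurable_wgt_component)

text \<open>For fixed frequencies the integrand over space is Gaussian with matrix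
  \<open>freq_mat\<close>, multiplied by the fermionic coefficient of that same matrix; after
  Fubini, \<open>gauss_I_mform\<close> evaluates it.\<close>

lemma form_fun_integral:
  fixes A :: "real ^ 'm::{finite,linorder} ^ 'm::{finite,linorder}" and g lam c :: real and a b :: 'm
  assumes g: "0 < g" and c: "1 + (\<Sum>x\<in>UNIV. \<Sum>y\<in>UNIV. \<bar>A $ x $ y\<bar>) \<le> c"
    and U: "\<And>\<xi>. U \<xi> ** freq_mat A g c \<xi> = mat 1"
  defines "K \<equiv> form_exp (- S_form A) * \<phi>bar a * \<phi> b * form_fun (\<lambda>t. \<Prod>j\<in>UNIV. quart g lam (t j)) \<tau>"
  shows "form_integrable K" and "form_integral K = (\<integral>\<xi>. total_wgt g lam c \<xi> * U \<xi> $ a $ b \<partial>freq_measure)"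
proof -
  let ?V = "freq_mat A g c"
  let ?m = "\<lambda>\<xi>. total_wgt g lam c \<xi> * mform berezin (?V \<xi>)"
  let ?E = "\<lambda>\<xi> p. exp (- sesq (?V \<xi>) (cvec p) (cvec p)) * (cnj (cvec p $ a) * cvec p $ b)"
  let ?T = "\<lambda>\<xi> p. exp (\<Sum>x\<in>UNIV. freq g c (\<xi> x) * of_real ((norm (cvec p $ x))\<^sup>2))"
  have co: "coercive (?V \<xi>)" for \<xi> by (rule coercive_freq_mat[OF c])
  have E_eq: "?E \<xi> p = exp (- sesq (cmat A) (cvec p) (cvec p)) * (cnj (cvec p $ a) * cvec p $ b) * ?T \<xi> p" for \<xi> p
    unfolding complex_norm_square by (simp add: sesq_freq_mat exp_diff exp_minus divide_inverse mult_ac)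
  have h: "quart g lam field_differentiable at z" for z
    using quart_deriv field_differentiable_def by blast
  \<comment> \<open>Here the Taylor terms of the weight recombine: shifting the diagonal in the
    fermionic coefficient accounts for all sets \<open>S\<close> together.\<close>
  have m_eq: "mform berezin (?V \<xi>) = (\<Sum>S\<in>UNIV. (\<Prod>x\<in>S. freq g c (\<xi> x)) * fermion_coeff (cmat A) S)" for \<xi>
    unfolding freq_mat_def by (rule sum_fermion_coeff[symmetric])
  have K_eq: "coeff K p UNIV = (\<integral>\<xi>. ?m \<xi> * ?E \<xi> p \<partial>freq_measure)" for p
  proof -
    let ?e = "exp (- sesq (cmat A) (cvec p) (cvec p)) * (cnj (cvec p $ a) * cvec p $ b)"
    let ?t = "\<lambda>x. (norm (cvec p $ x))\<^sup>2"
    have t: "cvec p $ x * cnj (cvec p $ x) = of_real (?t x)" for x by (rule complex_norm_square[symmetric])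
    have "coeff K p UNIV = (\<Sum>S\<in>UNIV. ?e * (\<integral>\<xi>. total_wgt g lam c \<xi> * (\<Prod>x\<in>S. freq g c (\<xi> x)) * ?T \<xi> p \<partial>freq_measure)
        * fermion_coeff (cmat A) S)"
      unfolding K_def coeff_integrand[OF h] t prod_quart_eq(1)[OF g, where c=c] ..
    also have "\<dots> = (\<Sum>S\<in>UNIV. \<integral>\<xi>. ?e * (total_wgt g lam c \<xi> * (\<Prod>x\<in>S. freq g c (\<xi> x)) * ?T \<xi> p) * fermion_coeff (cmat A) S \<partial>freq_measure)"
      by simp
    also have "\<dots> = (\<integral>\<xi>. (\<Sum>S\<in>UNIV. ?e * (total_wgt g lam c \<xi> * (\<Prod>x\<in>S. freq g c (\<xi> x)) * ?T \<xi> p) * fermion_coeff (cmat A) S) \<partial>freq_measure)"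
      by (rule Bochner_Integration.integral_sum[symmetric])
         (intro integrable_mult_left integrable_mult_right prod_quart_eq(2)[OF g])
    also have "\<dots> = (\<integral>\<xi>. ?m \<xi> * ?E \<xi> p \<partial>freq_measure)"
      unfolding E_eq m_eq by (simp add: sum_distrib_left sum_distrib_right mult_ac)
    finally show ?thesis .
  qed
  have m_int: "integrable freq_measure ?m"
    unfolding m_eq sum_distrib_left mult.assoc[symmetric]
  proof (intro Bochner_Integration.integrable_sum integrable_mult_left)
    fix S :: "'m set"
    \<comment> \<open>With all arguments 0 the exponential is 1, which leaves the weight times a
      monomial in the frequencies.\<close>
    show "integrable freq_measure (\<lambda>\<xi>. total_wgt g lam c \<xi> * (\<Prod>x\<in>S. freq g c (\<xi> x)))"
      using prod_quart_eq(2)[OF g, where t="\<lambda>_. 0" and S=S and c=c and lam=lam] by simp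
  qed
  have mm: "(\<lambda>\<xi>. mform berezin (?V \<xi>)) \<in> borel_measurable freq_measure"
    unfolding m_eq by (intro borel_measurable_sum borel_measurable_times borel_measurable_prod measurable_freq_component borel_measurable_const)
  have [measurable]: "(\<lambda>z. mform berezin (?V (fst z))) \<in> borel_measurable (freq_measure \<Otimes>\<^sub>M lborel)"
    by (rule measurable_compose[OF measurable_fst mm])
  have [measurable]: "(\<lambda>z. ?E (fst z) (snd z)) \<in> borel_measurable (freq_measure \<Otimes>\<^sub>M lborel)"
  proof -
    have [measurable]: "(\<lambda>z. freq g c (fst z x)) \<in> borel_measurable (freq_measure \<Otimes>\<^sub>M lborel)" for x :: 'm
      by (rule measurable_compose[OF measurable_fst measurable_freq_component])
    have [measurable]: "(\<lambda>z. cvec (snd z) $ x) \<in> borel_measurable (freq_measure \<Otimes>\<^sub>M lborel)" for x :: 'm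
      by measurable
    show ?thesis
      unfolding E_eq by measurable
  qed
  interpret pair_sigma_finite "freq_measure :: ('m \<Rightarrow> real) measure" "lborel :: (real ^ 'm coord) measure"
    by (intro pair_sigma_finite.intro freq_prod.sigma_finite_measure_axioms sigma_finite_lborel)
  let ?H = "\<lambda>(\<xi>, p). ?m \<xi> * ?E \<xi> p"
  have H: "integrable (freq_measure \<Otimes>\<^sub>M lborel) ?H"
  proof (rule Fubini_integrable)
    show "?H \<in> borel_measurable (freq_measure \<Otimes>\<^sub>M lborel)"
      unfolding split_beta by measurable
    have Ei: "integrable lborel (?E \<xi>)" for \<xi>
      by (intro gauss_integrable_quadratic co norm_cvec_mult_le) measurable
    then show "AE \<xi> in freq_measure. integrable lborel (\<lambda>p. ?H (\<xi>, p))" by simp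
    let ?B = "\<integral>p. 2 * exp (- (1 / 2 * (norm p)\<^sup>2)) \<partial>(lborel :: (real ^ 'm coord) measure)"
    \<comment> \<open>The integral \<open>?B\<close> does not depend on the frequencies, since
      coercivity holds with the same constant for all of them; what remains is the integrability of
      \<open>?m\<close>.\<close>
    have bd: "(\<integral>p. norm (?H (\<xi>, p)) \<partial>lborel) \<le> norm (?m \<xi>) * ?B" for \<xi>
    proof -
      have "(\<integral>p. norm (?H (\<xi>, p)) \<partial>lborel) = norm (?m \<xi>) * (\<integral>p. norm (?E \<xi> p) \<partial>lborel)"
        by (simp add: norm_mult mult.assoc del: norm_exp_eq_Re)
      also have "\<dots> \<le> norm (?m \<xi>) * ?B"
        by (intro mult_left_mono integral_mono integrable_norm Ei gauss_quadratic_bound co norm_cvec_mult_le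
            gauss_integrable_bound) auto
      finally show ?thesis .
    qed
    show "integrable freq_measure (\<lambda>\<xi>. \<integral>p. norm (?H (\<xi>, p)) \<partial>lborel)"
    proof (rule Bochner_Integration.integrable_bound)
      show "integrable freq_measure (\<lambda>\<xi>. norm (?m \<xi>) * ?B)"
        by (intro integrable_mult_left integrable_norm m_int)
      show "(\<lambda>\<xi>. \<integral>p. norm (?H (\<xi>, p)) \<partial>lborel) \<in> borel_measurable freq_measure"
        unfolding split_beta fst_conv snd_conv by measurable
      show "AE \<xi> in freq_measure. norm (\<integral>p. norm (?H (\<xi>, p)) \<partial>lborel) \<le> norm (norm (?m \<xi>) * ?B)"
        using bd by (intro AE_I2) (auto intro: order_trans[OF _ abs_ge_self])
    qed
  qed
  show "form_integrable K"
    unfolding form_integrable_def K_eq using integrable_snd[OF H] by simp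
  have "form_integral K = (\<integral>p. \<integral>\<xi>. ?m \<xi> * ?E \<xi> p \<partial>freq_measure \<partial>lborel)"
    unfolding form_integral_def K_eq ..
  also have "\<dots> = (\<integral>\<xi>. \<integral>p. ?m \<xi> * ?E \<xi> p \<partial>lborel \<partial>freq_measure)"
    using Fubini_integral[OF H] by simp
  also have "\<dots> = (\<integral>\<xi>. ?m \<xi> * gauss_I (?V \<xi>) a b \<partial>freq_measure)"
    by (simp add: gauss_I_def)
  also have "\<dots> = (\<integral>\<xi>. total_wgt g lam c \<xi> * U \<xi> $ a $ b \<partial>freq_measure)"
    by (simp only: mult.assoc gauss_I_mform[OF co U])
  finally show "form_integral K = (\<integral>\<xi>. total_wgt g lam c \<xi> * U \<xi> $ a $ b \<partial>freq_measure)" .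
qed

section \<open>The killed Markov chain\<close>

text \<open>Turns the integral over an event into one under the conditional law, where independence
  of the holding times can be expressed.\<close>

lemma integral_uniform_measure:
  fixes f :: "'a \<Rightarrow> complex"
  assumes P: "prob_space M" and E [measurable]: "E \<in> sets M" and pos: "measure M E \<noteq> 0"
    and [measurable]: "f \<in> borel_measurable M"
  shows "(\<integral>x. indicator E x * f x \<partial>M) = of_real (measure M E) * (\<integral>x. f x \<partial>uniform_measure M E)"
proof -
  interpret prob_space M by fact
  have pos': "0 < measure M E" using pos by (simp add: zero_less_measure_iff)
  have "uniform_measure M E = density M (\<lambda>x. ennreal (indicator E x / measure M E))"
    unfolding uniform_measure_def
    using pos' by (intro density_cong) (auto simp: emeasure_eq_measure divide_ennreal ennreal_indicator[symmetric] simp del: ennreal_indicator)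
  then have "(\<integral>x. f x \<partial>uniform_measure M E) = (\<integral>x. (indicator E x / measure M E) *\<^sub>R f x \<partial>M)"
    by (simp add: integral_density)
  also have "\<dots> = (\<integral>x. (indicator E x * f x) / of_real (measure M E) \<partial>M)"
    by (intro Bochner_Integration.integral_cong) (auto simp: scaleR_conv_of_real indicator_def)
  finally show ?thesis using pos by simp
qed

abbreviation exp_law :: "real \<Rightarrow> real measure" where
  "exp_law l \<equiv> density lborel (exponential_density l)"

text \<open>The truncation at 0 matches \<open>discount\<close> and is invisible to a law carried by
  the half-line.\<close>

lemma exp_law_laplace:
  assumes l: "0 < l" and z: "0 \<le> Re z"
  shows "(\<integral>t. exp (- z * of_real (max 0 t)) \<partial>exp_law l) = of_real l / (of_real l + z)"
proof -
  interpret prob_space "exp_law l" by (rule prob_space_exponential_density[OF l])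
  let ?f = "\<lambda>t::real. exp (- z * of_real (max 0 t))"
  let ?g = "\<lambda>t::real. of_real l * exp (- (of_real l + z) * of_real t)"
  let ?G = "\<lambda>t::real. - of_real l / (of_real l + z) * exp (- (of_real l + z) * of_real t)"
  have nz: "of_real l + z \<noteq> 0" using l z by (auto simp: complex_eq_iff)
  have ei: "einterval (ereal 0) \<infinity> = {0<..}" by (auto simp: einterval_def)
  have "integrable (exp_law l) ?f"
    by (rule integrable_const_bound[where B=1]) (use z in auto)
  then have int: "integrable lborel (\<lambda>t. exponential_density l t *\<^sub>R ?f t)"
    using l by (subst (asm) integrable_density) (auto simp: exponential_density_nonneg)
  \<comment> \<open>Equality fails at 0, where the density is \<open>l\<close> but the indicator of
    the open half-line vanishes.\<close>
  have eq: "AE t in lborel. exponential_density l t *\<^sub>R ?f t = indicator {0<..} t *\<^sub>R ?g t"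
    using AE_lborel_singleton[of "0::real"]
  proof eventually_elim
    case (elim t)
    then show ?case
      by (auto simp: exponential_density_def indicator_def scaleR_conv_of_real exp_of_real[symmetric]
          exp_add[symmetric] algebra_simps)
  qed
  have "(\<integral>t. ?f t \<partial>exp_law l) = (\<integral>t. exponential_density l t *\<^sub>R ?f t \<partial>lborel)"
    using l by (subst integral_density) (auto simp: exponential_density_nonneg)
  also have "\<dots> = (\<integral>t. indicator {0<..} t *\<^sub>R ?g t \<partial>lborel)"
    by (intro integral_cong_AE eq) measurable
  also have "\<dots> = (LBINT t=ereal 0..\<infinity>. ?g t)"
    unfolding interval_lebesgue_integral_def set_lebesgue_integral_def ei by simp
  also have "\<dots> = 0 - (- of_real l / (of_real l + z))"
  proof (rule interval_integral_FTC_integrable[where F = ?G])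
    show "(?G has_vector_derivative ?g t) (at t)" for t
    proof -
      have "((\<lambda>t. - of_real l / (of_real l + z) * exp (- (of_real l + z) * t)) has_field_derivative ?g t) (at (of_real t))"
      proof -
        have "((\<lambda>t. - of_real l / s * exp (- s * t)) has_field_derivative of_real l * exp (- s * x)) (at x)"
          if "s \<noteq> 0" for s x :: complex
          using that by (auto intro!: derivative_eq_intros)
        from this[OF nz] show ?thesis .
      qed
      then show ?thesis by (rule has_vector_derivative_real_field)
    qed
    show "isCont ?g t" for t by (intro continuous_intros)
    have "integrable lborel (\<lambda>t. indicator {0<..} t *\<^sub>R ?g t)"
      by (rule Bochner_Integration.integrable_cong_AE_imp[OF int]) (use eq in \<open>auto simp: eq_commute\<close>)
    then show "set_integrable lborel (einterval (ereal 0) \<infinity>) ?g"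
      unfolding set_integrable_def ei .
    have "(?G \<longlongrightarrow> ?G 0) (at_right 0)"
      by (intro tendsto_intros)
    then show "((?G \<circ> real_of_ereal) \<longlongrightarrow> - of_real l / (of_real l + z)) (at_right (ereal 0))"
      unfolding ereal_tendsto_simps1 by simp
    have "((\<lambda>t. norm (?G t)) \<longlongrightarrow> 0) at_top"
    proof -
      have "((\<lambda>t. norm (of_real l / (of_real l + z)) * exp (- ((l + Re z) * t))) \<longlongrightarrow> norm (of_real l / (of_real l + z)) * 0) at_top"
        using l z by (intro tendsto_intros filterlim_compose[OF exp_at_bot] filterlim_uminus_at_bot_at_top[THEN filterlim_compose] filterlim_tendsto_pos_mult_at_top[OF tendsto_const] filterlim_ident) auto
      moreover have "norm (?G t) = norm (of_real l / (of_real l + z)) * exp (- ((l + Re z) * t))" for t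
      proof -
        have "Re (- (of_real l + z) * of_real t) = - ((l + Re z) * t)" by (simp add: algebra_simps)
        then show ?thesis by (simp only: norm_mult norm_exp_eq_Re norm_divide norm_minus_cancel)
      qed
      ultimately show ?thesis by simp
    qed
    then show "((?G \<circ> real_of_ereal) \<longlongrightarrow> 0) (at_left \<infinity>)"
      unfolding ereal_tendsto_simps1 tendsto_norm_zero_iff .
  qed simp
  finally show ?thesis by simp
qed

section \<open>Holding times conditioned on the path\<close>

locale dominant_chain = killed_chain P D J a Y T
  for P :: "'w measure" and D J :: "real ^ 'm::finite ^ 'm" and a :: 'm
    and Y :: "nat \<Rightarrow> 'w \<Rightarrow> 'm option" and T :: "nat \<Rightarrow> 'w \<Rightarrow> real" +
  assumes D_pos: "\<And>x. D $ x $ x > 0"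
    and J_nonneg: "\<And>x y. J $ x $ y \<ge> 0"
    and dominant: "diagonally_dominant D J"
begin

lemmas [measurable] = measurable_Y measurable_T

definition path_event :: "nat \<Rightarrow> (nat \<Rightarrow> 'm option) \<Rightarrow> 'w set" where
  "path_event n y = {\<omega> \<in> space P. \<forall>i\<le>n. Y i \<omega> = y i}"

abbreviation site_path :: "nat \<Rightarrow> (nat \<Rightarrow> 'm) \<Rightarrow> 'w set" where
  "site_path n y \<equiv> path_event n (\<lambda>i. Some (y i))"

lemma path_event_sets [measurable]: "path_event n y \<in> sets P"
  unfolding path_event_def by measurable

text \<open>\<open>holding\<close> prescribes the probabilities of rectangles given the path. Under
  the conditional law this says that the holding times at the visited sites are independent and
  exponential, so the expectation of the product factorises. Times in the cemetery have no
  prescribed law and are excluded by \<open>K\<close>.\<close>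

lemma path_integral:
  fixes F :: "nat \<Rightarrow> real \<Rightarrow> complex" and y :: "nat \<Rightarrow> 'm option" and n :: nat
  assumes F [measurable]: "\<And>i. F i \<in> borel_measurable borel" and bd: "\<And>i t. norm (F i t) \<le> 1"
  defines "K \<equiv> {i. i \<le> n \<and> y i \<noteq> None}"
  shows "(\<integral>\<omega>. indicator (path_event n y) \<omega> * (\<Prod>i\<in>K. F i (T i \<omega>)) \<partial>P)
    = of_real (prob (path_event n y)) * (\<Prod>i\<in>K. \<integral>t. F i t \<partial>exp_law (D $ the (y i) $ the (y i)))"
proof (cases "prob (path_event n y) = 0")
  case True
  then have "AE \<omega> in P. \<omega> \<notin> path_event n y"
    by (simp add: prob_eq_0)
  then have "AE \<omega> in P. indicator (path_event n y) \<omega> * (\<Prod>i\<in>K. F i (T i \<omega>)) = 0"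
    by eventually_elim simp
  then have "(\<integral>\<omega>. indicator (path_event n y) \<omega> * (\<Prod>i\<in>K. F i (T i \<omega>)) \<partial>P) = 0"
    by (rule integral_eq_zero_AE)
  then show ?thesis using True by simp
next
  case False
  let ?E = "path_event n y"
  let ?Q = "uniform_measure P ?E"
  let ?l = "\<lambda>i. exp_law (D $ the (y i) $ the (y i))"
  have fin: "finite K" by (simp add: K_def)
  interpret Q: prob_space ?Q
    using False by (intro prob_space_uniform_measure) (auto simp: emeasure_eq_measure)
  have law: "Q.prob (\<Inter>i\<in>L. T i -` B i \<inter> space ?Q) = (\<Prod>i\<in>L. measure (?l i) (B i))"
    if L: "L \<subseteq> K" "L \<noteq> {}" and B: "\<And>i. i \<in> L \<Longrightarrow> B i \<in> sets borel" for L B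
  proof -
    \<comment> \<open>Indices outside \<open>L\<close> get the whole line, which has probability 1,
      so \<open>holding\<close> covers every subset of \<open>K\<close>.\<close>
    let ?B = "\<lambda>i. if i \<in> L then B i else UNIV"
    have m: "(\<Inter>i\<in>L. T i -` B i \<inter> space P) \<in> sets P"
      using L B fin by (intro sets.finite_INT) (auto intro: finite_subset measurable_sets[OF measurable_T])
    have "?E \<inter> (\<Inter>i\<in>L. T i -` B i \<inter> space P) = {\<omega> \<in> space P. \<forall>i\<le>n. Y i \<omega> = y i \<and> (y i \<noteq> None \<longrightarrow> T i \<omega> \<in> ?B i)}"
      using L by (auto simp: path_event_def K_def split: if_splits)
    then have "prob (?E \<inter> (\<Inter>i\<in>L. T i -` B i \<inter> space P)) = prob ?E * (\<Prod>i\<le>n. case y i of None \<Rightarrow> 1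
                 | Some x \<Rightarrow> measure (exp_law (D $ x $ x)) (?B i))"
      using holding[of ?B n y] B by (simp add: path_event_def)
    also have "(\<Prod>i\<le>n. case y i of None \<Rightarrow> 1 | Some x \<Rightarrow> measure (exp_law (D $ x $ x)) (?B i))
       = (\<Prod>i\<in>L. measure (?l i) (B i))"
    proof (intro prod.mono_neutral_cong_right ballI)
      show "L \<subseteq> {..n}" using L by (auto simp: K_def)
      fix i assume "i \<in> {..n} - L"
      then show "(case y i of None \<Rightarrow> 1 | Some x \<Rightarrow> measure (exp_law (D $ x $ x)) (?B i)) = 1"
        using prob_space.prob_space[OF prob_space_exponential_density[OF D_pos]] by (auto split: option.splits)
    next
      fix i assume "i \<in> L"
      then show "(case y i of None \<Rightarrow> 1 | Some x \<Rightarrow> measure (exp_law (D $ x $ x)) (?B i)) = measure (?l i) (B i)"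
        using L by (auto simp: K_def)
    qed simp
    finally have "prob (?E \<inter> (\<Inter>i\<in>L. T i -` B i \<inter> space P)) / prob ?E = (\<Prod>i\<in>L. measure (?l i) (B i))"
      using False by simp
    moreover have "Q.prob (\<Inter>i\<in>L. T i -` B i \<inter> space P) = prob (?E \<inter> (\<Inter>i\<in>L. T i -` B i \<inter> space P)) / prob ?E"
      using False m by (intro measure_uniform_measure) (auto simp: emeasure_eq_measure)
    ultimately show ?thesis by (simp only: space_uniform_measure)
  qed
  have dist: "distr ?Q borel (T i) = ?l i" if "i \<in> K" for i
  proof (rule measure_eqI)
    interpret R: prob_space "?l i" by (rule prob_space_exponential_density[OF D_pos])
    show "sets (distr ?Q borel (T i)) = sets (?l i)" by simp
    fix B assume "B \<in> sets (distr ?Q borel (T i))"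
    then have B: "B \<in> sets borel" by simp
    have "emeasure (distr ?Q borel (T i)) B = Q.prob (T i -` B \<inter> space ?Q)"
      using B by (subst emeasure_distr) (auto simp: Q.emeasure_eq_measure)
    also have "\<dots> = measure (?l i) B" using law[of "{i}" "\<lambda>_. B"] that B by simp
    finally show "emeasure (distr ?Q borel (T i)) B = emeasure (?l i) B"
      by (simp add: R.emeasure_eq_measure)
  qed
  have "(\<integral>\<omega>. (\<Prod>i\<in>K. F i (T i \<omega>)) \<partial>?Q) = (\<Prod>i\<in>K. \<integral>\<omega>. F i (T i \<omega>) \<partial>?Q)"
  proof (cases "K = {}")
    case True
    then show ?thesis using Q.prob_space by simp
  next
    case False
    have "Q.indep_vars (\<lambda>_. borel) T K"
    proof -
      have ss: "sigma_sets UNIV (sets borel) = sets (borel :: real measure)"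
        using sets.sigma_sets_eq[of "borel :: real measure"] by simp
      show ?thesis
      proof (subst Q.indep_vars_finite[where E="\<lambda>_. sets borel"])
        show "\<forall>A\<in>K \<rightarrow> sets borel. Q.prob (\<Inter>j\<in>K. T j -` A j \<inter> space ?Q) = (\<Prod>j\<in>K. Q.prob (T j -` A j \<inter> space ?Q))"
        proof
          fix A :: "nat \<Rightarrow> real set" assume A: "A \<in> K \<rightarrow> sets borel"
          have "Q.prob (T j -` A j \<inter> space ?Q) = measure (?l j) (A j)" if "j \<in> K" for j
            using law[of "{j}" A] that A by auto
          then show "Q.prob (\<Inter>j\<in>K. T j -` A j \<inter> space ?Q) = (\<Prod>j\<in>K. Q.prob (T j -` A j \<inter> space ?Q))"
            using law[of K A] False A by auto
        qed
      qed (use False fin in \<open>auto simp: ss Int_stable_def\<close>)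
    qed
    then have "Q.indep_vars (\<lambda>_. borel) (\<lambda>i \<omega>. F i (T i \<omega>)) K"
      by (rule Q.indep_vars_compose2) simp
    then show ?thesis
      using fin bd by (intro Q.indep_vars_lebesgue_integral Q.integrable_const_bound[where B=1]) auto
  qed
  also have "\<dots> = (\<Prod>i\<in>K. \<integral>t. F i t \<partial>?l i)"
    by (intro prod.cong refl) (simp add: dist[symmetric] integral_distr)
  finally show ?thesis
    using integral_uniform_measure[OF prob_space_axioms path_event_sets[of n y] False, of "\<lambda>\<omega>. \<Prod>i\<in>K. F i (T i \<omega>)"]
    by simp
qed


section \<open>Almost sure properties of the path\<close>

lemma AE_notin_prob_0: "N \<in> events \<Longrightarrow> prob N = 0 \<Longrightarrow> AE \<omega> in P. \<omega> \<notin> N"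
  by (simp add: prob_eq_0)

lemma path_cover:
  assumes "\<omega> \<in> space P"
  shows "\<exists>y \<in> PiE {..n} (\<lambda>_. UNIV). \<omega> \<in> path_event n y"
  by (rule bexI[of _ "restrict (\<lambda>i. Y i \<omega>) {..n}"]) (use assms in \<open>auto simp: path_event_def\<close>)

lemma finite_paths: "finite (PiE {..n::nat} (\<lambda>_. UNIV :: 'b::finite set))"
  by (intro finite_PiE) auto

lemma AE_start: "AE \<omega> in P. Y 0 \<omega> = Some a"
proof -
  have "prob {\<omega> \<in> space P. Y 0 \<omega> = Some a} = 1"
    using jumps[of 0 "\<lambda>_. Some a"] by simp
  then show ?thesis by (intro AE_I_eq_1) (auto simp: emeasure_eq_measure)
qed

text \<open>There are only finitely many paths of a given length, and by \<open>jumps\<close> each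
  one that leaves the cemetery has probability zero.\<close>

lemma AE_cemetery: "AE \<omega> in P. \<forall>n. Y n \<omega> = None \<longrightarrow> Y (Suc n) \<omega> = None"
  unfolding AE_all_countable
proof
  fix n
  have "AE \<omega> in P. \<forall>y\<in>PiE {..Suc n} (\<lambda>_. UNIV :: 'm option set). y n = None \<and> y (Suc n) \<noteq> None \<longrightarrow> \<omega> \<notin> path_event (Suc n) y"
  proof (intro AE_finite_allI finite_paths AE_impI)
    fix y :: "nat \<Rightarrow> 'm option" assume "y n = None \<and> y (Suc n) \<noteq> None"
    then have "jump_prob D J (y n) (y (Suc n)) = 0" by auto
    then have "prob (path_event (Suc n) y) = 0"
      unfolding path_event_def jumps by auto
    then show "AE \<omega> in P. \<omega> \<notin> path_event (Suc n) y" by (intro AE_notin_prob_0 path_event_sets)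
  qed
  with AE_space show "AE \<omega> in P. Y n \<omega> = None \<longrightarrow> Y (Suc n) \<omega> = None"
  proof eventually_elim
    case (elim \<omega>)
    from path_cover[OF elim(1), of "Suc n"] obtain y where
      "y \<in> PiE {..Suc n} (\<lambda>_. UNIV)" "\<omega> \<in> path_event (Suc n) y" by blast
    with elim(2) show ?case by (auto simp: path_event_def)
  qed
qed

lemma exp_law_neg: "measure (exp_law l) {..<0} = 0"
proof -
  have "(\<lambda>x. ennreal (exponential_density l x) * indicator {..<0} x) = (\<lambda>_. 0)"
    by (auto simp: fun_eq_iff exponential_density_def indicator_def)
  then have "emeasure (exp_law l) {..<0} = 0"
    by (simp add: emeasure_density)
  then show ?thesis by (simp add: measure_def)
qed

lemma AE_holding_nonneg: "AE \<omega> in P. \<forall>n. Y n \<omega> \<noteq> None \<longrightarrow> 0 \<le> T n \<omega>"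
  unfolding AE_all_countable
proof
  fix n :: nat
  \<comment> \<open>Only the last holding time is constrained, to a null set of its exponential
    law.\<close>
  let ?B = "\<lambda>i. if i = n then {..<0} else (UNIV :: real set)"
  let ?N = "\<lambda>y. {\<omega> \<in> space P. \<forall>i\<le>n. Y i \<omega> = y i \<and> (y i \<noteq> None \<longrightarrow> T i \<omega> \<in> ?B i)}"
  have "AE \<omega> in P. \<forall>y\<in>PiE {..n} (\<lambda>_. UNIV :: 'm option set). y n \<noteq> None \<longrightarrow> \<omega> \<notin> ?N y"
  proof (intro AE_finite_allI finite_paths AE_impI)
    fix y :: "nat \<Rightarrow> 'm option" assume "y n \<noteq> None"
    then have "(\<Prod>i\<le>n. case y i of None \<Rightarrow> 1 | Some x \<Rightarrow> measure (exp_law (D $ x $ x)) (?B i)) = 0"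
      by (intro prod_zero bexI[of _ n]) (auto simp: exp_law_neg)
    then have "prob (?N y) = 0"
      by (subst holding) auto
    moreover have "?N y = path_event n y \<inter> {\<omega> \<in> space P. T n \<omega> < 0}"
      using \<open>y n \<noteq> None\<close> by (auto simp: path_event_def)
    then have "?N y \<in> sets P"
      by simp
    ultimately show "AE \<omega> in P. \<omega> \<notin> ?N y" by (intro AE_notin_prob_0)
  qed
  with AE_space show "AE \<omega> in P. Y n \<omega> \<noteq> None \<longrightarrow> 0 \<le> T n \<omega>"
  proof eventually_elim
    case (elim \<omega>)
    from path_cover[OF elim(1), of n] obtain y where
      "y \<in> PiE {..n} (\<lambda>_. UNIV)" "\<omega> \<in> path_event n y" by blast
    show ?case
    proof (intro impI)
      assume "Y n \<omega> \<noteq> None"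
      then have "y n \<noteq> None" using \<open>\<omega> \<in> path_event n y\<close> by (simp add: path_event_def)
      with elim(2) \<open>y \<in> _\<close> have "\<omega> \<notin> ?N y" by blast
      then show "0 \<le> T n \<omega>"
        using elim(1) \<open>\<omega> \<in> path_event n y\<close> by (auto simp: path_event_def split: if_splits)
    qed
  qed
qed

text \<open>Survival is demanded at every earlier step, although absorption holds almost surely: the
  events \<open>dies_at\<close> built in the same way are then disjoint for different
  \<open>n\<close> everywhere, not only up to a null set.\<close>

definition alive_at :: "nat \<Rightarrow> 'm \<Rightarrow> 'w set" where
  "alive_at n b = {\<omega> \<in> space P. (\<forall>i\<le>n. Y i \<omega> \<noteq> None) \<and> Y n \<omega> = Some b}"

definition dies_at :: "nat \<Rightarrow> 'm \<Rightarrow> 'w set" where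
  "dies_at n b = {\<omega> \<in> space P. (\<forall>i\<le>n. Y i \<omega> \<noteq> None) \<and> Y n \<omega> = Some b \<and> Y (Suc n) \<omega> = None}"

text \<open>The holding times are nonnegative only almost surely; truncating them at \<open>0\<close> keeps the
  discount bounded everywhere.\<close>

definition discount :: "('m \<Rightarrow> complex) \<Rightarrow> nat \<Rightarrow> 'w \<Rightarrow> complex" where
  "discount z n \<omega> = (\<Prod>i\<le>n. exp (- z (the (Y i \<omega>)) * of_real (max 0 (T i \<omega>))))"

definition expected_discount :: "('m \<Rightarrow> complex) \<Rightarrow> nat \<Rightarrow> 'm \<Rightarrow> complex" where
  "expected_discount z n b = (\<integral>\<omega>. indicator (alive_at n b) \<omega> * discount z n \<omega> \<partial>P)"

text \<open>The Laplace transform of the holding time at \<open>x\<close>.\<close>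

definition holding_factor :: "('m \<Rightarrow> complex) \<Rightarrow> 'm \<Rightarrow> complex" where
  "holding_factor z x = of_real (D $ x $ x) / (of_real (D $ x $ x) + z x)"

lemma alive_at_sets [measurable]: "alive_at n b \<in> sets P"
  and dies_at_sets [measurable]: "dies_at n b \<in> sets P"
  unfolding alive_at_def dies_at_def by measurable

lemma measurable_discount [measurable]: "discount z n \<in> borel_measurable P"
proof -
  have [measurable]: "(\<lambda>\<omega>. z (the (Y i \<omega>))) \<in> borel_measurable P" for i
    by (rule measurable_compose[OF measurable_Y]) simp
  show ?thesis unfolding discount_def by measurable
qed

lemma norm_discount_le:
  assumes "\<And>x. 0 \<le> Re (z x)"
  shows "norm (discount z n \<omega>) \<le> 1"
  unfolding discount_def prod_norm[symmetric]
  by (rule prod_le_1) (auto intro!: mult_nonneg_nonneg assms)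

lemma integrable_discount:
  assumes "\<And>x. 0 \<le> Re (z x)" "A \<in> sets P"
  shows "integrable P (\<lambda>\<omega>. indicator A \<omega> * discount z n \<omega>)"
proof (rule integrable_const_bound[where B=1])
  show "AE \<omega> in P. norm (indicator A \<omega> * discount z n \<omega>) \<le> 1"
    using norm_discount_le[OF assms(1)] by (auto simp: norm_mult indicator_def)
qed (use assms in measurable)

text \<open>The next state may be a site or the cemetery, so that one formula covers a further jump
  and the death; the cemetery has no holding time to discount.\<close>

definition step_law :: "('m \<Rightarrow> complex) \<Rightarrow> 'm \<Rightarrow> 'm option \<Rightarrow> complex" where
  "step_law z x s = of_real (jump_prob D J (Some x) s) * (case s of None \<Rightarrow> 1 | Some b \<Rightarrow> holding_factor z b)"

definition step_discount :: "('m \<Rightarrow> complex) \<Rightarrow> 'm option \<Rightarrow> real \<Rightarrow> complex" where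
  "step_discount z s t = (case s of None \<Rightarrow> 1 | Some b \<Rightarrow> exp (- z b * of_real (max 0 t)))"

lemma path_discount:
  assumes z: "\<And>x. 0 \<le> Re (z x)"
  shows "(\<integral>\<omega>. indicator (site_path n y) \<omega> * discount z n \<omega> \<partial>P)
    = of_real (prob (site_path n y)) * (\<Prod>i\<le>n. holding_factor z (y i))"
proof -
  have K: "{i. i \<le> n \<and> Some (y i) \<noteq> None} = {..n}" by auto
  have "(\<integral>\<omega>. indicator (site_path n y) \<omega> * discount z n \<omega> \<partial>P)
     = (\<integral>\<omega>. indicator (site_path n y) \<omega> * (\<Prod>i\<le>n. exp (- z (y i) * of_real (max 0 (T i \<omega>)))) \<partial>P)"
    by (intro Bochner_Integration.integral_cong refl) (auto simp: discount_def indicator_def path_event_def intro!: prod.cong)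
  also have "\<dots> = of_real (prob (site_path n y)) * (\<Prod>i\<le>n. \<integral>t. exp (- z (y i) * of_real (max 0 t)) \<partial>exp_law (D $ y i $ y i))"
    using path_integral[of "\<lambda>i t. exp (- z (y i) * of_real (max 0 t))" n "\<lambda>i. Some (y i)"] z
    unfolding K by simp
  finally show ?thesis
    by (simp only: exp_law_laplace[OF D_pos z] holding_factor_def)
qed

text \<open>The Markov property for discounted paths: lengthening a path by \<open>s\<close>
  multiplies its probability by a jump probability and its product of Laplace transforms by at most
  one further factor.\<close>

lemma path_step:
  assumes z: "\<And>x. 0 \<le> Re (z x)"
  shows "(\<integral>\<omega>. indicator (site_path n y \<inter> {\<omega>. Y (Suc n) \<omega> = s}) \<omega>
      * (discount z n \<omega> * step_discount z s (T (Suc n) \<omega>)) \<partial>P)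
    = step_law z (y n) s * (\<integral>\<omega>. indicator (site_path n y) \<omega> * discount z n \<omega> \<partial>P)"
proof -
  let ?y = "\<lambda>i. if i \<le> n then Some (y i) else s"
  let ?F = "\<lambda>i t. if i \<le> n then exp (- z (y i) * of_real (max 0 t)) else step_discount z s t"
  let ?K = "{i. i \<le> Suc n \<and> ?y i \<noteq> None}"
  have E: "site_path n y \<inter> {\<omega>. Y (Suc n) \<omega> = s} = path_event (Suc n) ?y"
    by (auto simp: path_event_def le_Suc_eq)
  have sd [measurable]: "step_discount z s \<in> borel_measurable borel"
    unfolding step_discount_def by (cases s) simp_all
  have sd1: "norm (step_discount z s t) \<le> 1" for t
    using z by (cases s) (simp_all add: step_discount_def)
  have F_meas: "?F i \<in> borel_measurable borel" for i by (cases "i \<le> n") simp_all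
  have F1: "norm (?F i t) \<le> 1" for i t using z sd1 by auto
  have K: "?K = (if s = None then {..n} else {..Suc n})"
    by (auto simp: le_Suc_eq)
  \<comment> \<open>The last index is dropped exactly when \<open>s\<close> is the cemetery.\<close>
  have prodK: "(\<Prod>i\<in>?K. f i) = (\<Prod>i\<le>n. f i) * (if s = None then 1 else f (Suc n))" for f :: "nat \<Rightarrow> complex"
    unfolding K by simp
  have prob: "prob (path_event (Suc n) ?y) = prob (site_path n y) * jump_prob D J (Some (y n)) s"
    unfolding path_event_def jumps by (simp add: prod.lessThan_Suc)
  have "(\<integral>\<omega>. indicator (site_path n y \<inter> {\<omega>. Y (Suc n) \<omega> = s}) \<omega>
      * (discount z n \<omega> * step_discount z s (T (Suc n) \<omega>)) \<partial>P)
     = (\<integral>\<omega>. indicator (path_event (Suc n) ?y) \<omega> * (\<Prod>i\<in>?K. ?F i (T i \<omega>)) \<partial>P)"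
  proof (intro Bochner_Integration.integral_cong refl)
    fix \<omega>
    show "indicator (site_path n y \<inter> {\<omega>. Y (Suc n) \<omega> = s}) \<omega>
        * (discount z n \<omega> * step_discount z s (T (Suc n) \<omega>))
       = indicator (path_event (Suc n) ?y) \<omega> * (\<Prod>i\<in>?K. ?F i (T i \<omega>))"
    proof (cases "\<omega> \<in> path_event (Suc n) ?y")
      case True
      have "discount z n \<omega> = (\<Prod>i\<le>n. ?F i (T i \<omega>))"
        unfolding discount_def
      proof (intro prod.cong refl)
        fix i assume "i \<in> {..n}"
        moreover from this have "Y i \<omega> = Some (y i)" using True by (auto simp: path_event_def dest: spec[of _ i])
        ultimately show "exp (- z (the (Y i \<omega>)) * of_real (max 0 (T i \<omega>))) = ?F i (T i \<omega>)" by simp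
      qed
      moreover have "step_discount z s (T (Suc n) \<omega>) = (if s = None then 1 else ?F (Suc n) (T (Suc n) \<omega>))"
        by (simp add: step_discount_def)
      ultimately show ?thesis unfolding E prodK by simp
    qed (simp add: E)
  qed
  also have "\<dots> = of_real (prob (path_event (Suc n) ?y)) * (\<Prod>i\<in>?K. \<integral>t. ?F i t \<partial>exp_law (D $ the (?y i) $ the (?y i)))"
    by (rule path_integral[of ?F "Suc n" ?y]) (fact F_meas F1)+
  also have "\<dots> = of_real (prob (path_event (Suc n) ?y)) * ((\<Prod>i\<le>n. holding_factor z (y i)) * (case s of None \<Rightarrow> 1 | Some b \<Rightarrow> holding_factor z b))"
  proof -
    let ?I = "\<lambda>i. \<integral>t. ?F i t \<partial>exp_law (D $ the (?y i) $ the (?y i))"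
    have "?I i = holding_factor z (y i)" if "i \<in> {..n}" for i
      using that exp_law_laplace[OF D_pos z, of "y i" "y i"] by (simp add: holding_factor_def)
    then have A: "(\<Prod>i\<le>n. ?I i) = (\<Prod>i\<le>n. holding_factor z (y i))" by (rule prod.cong[OF refl])
    have B: "(if s = None then 1 else ?I (Suc n)) = (case s of None \<Rightarrow> 1 | Some b \<Rightarrow> holding_factor z b)"
    proof (cases s)
      case (Some b)
      then have "?I (Suc n) = (\<integral>t. exp (- z b * of_real (max 0 t)) \<partial>exp_law (D $ b $ b))"
        by (simp add: step_discount_def)
      also have "\<dots> = holding_factor z b" unfolding holding_factor_def by (rule exp_law_laplace[OF D_pos z])
      finally show ?thesis using Some by simp
    qed simp
    show ?thesis unfolding prodK A B ..
  qed
  finally have *: "(\<integral>\<omega>. indicator (site_path n y \<inter> {\<omega>. Y (Suc n) \<omega> = s}) \<omega>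
      * (discount z n \<omega> * step_discount z s (T (Suc n) \<omega>)) \<partial>P)
    = of_real (prob (path_event (Suc n) ?y)) * ((\<Prod>i\<le>n. holding_factor z (y i)) * (case s of None \<Rightarrow> 1 | Some b \<Rightarrow> holding_factor z b))" .
  have "p * j * (r * c) = j * c * (p * r)" for p j r c :: complex by simp
  then show ?thesis
    unfolding * path_discount[OF z] step_law_def prob of_real_mult .
qed


text \<open>Extensional functions represent each path once, which makes the decomposition of
  \<open>alive_at\<close> finite and disjoint.\<close>

definition paths_to :: "nat \<Rightarrow> 'm \<Rightarrow> (nat \<Rightarrow> 'm) set" where
  "paths_to n b = {y \<in> PiE {..n} (\<lambda>_. UNIV). y n = b}"

lemma finite_paths_to [simp]: "finite (paths_to n b)"
  unfolding paths_to_def by (rule finite_subset[OF _ finite_paths[of n]]) auto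

lemma indicator_alive_at:
  assumes "\<omega> \<in> space P"
  shows "(indicator (alive_at n b) \<omega> :: complex) = (\<Sum>y\<in>paths_to n b. indicator (site_path n y) \<omega>)"
proof (cases "\<omega> \<in> alive_at n b")
  case True
  define y0 where "y0 = restrict (\<lambda>i. the (Y i \<omega>)) {..n}"
  have Y: "Y i \<omega> = Some (y0 i)" if "i \<le> n" for i
    using True that by (auto simp: alive_at_def y0_def)
  have y0: "y0 \<in> paths_to n b"
    using True by (auto simp: paths_to_def y0_def alive_at_def)
  have "indicator (site_path n y) \<omega> = (if y = y0 then 1 else 0 :: complex)" if "y \<in> paths_to n b" for y
  proof (cases "y = y0")
    case True
    then show ?thesis using Y assms by (auto simp: path_event_def)
  next
    case False
    have "\<exists>i\<le>n. y i \<noteq> y0 i"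
    proof (rule ccontr)
      assume "\<not> (\<exists>i\<le>n. y i \<noteq> y0 i)"
      then have "y = y0"
        using that y0 unfolding paths_to_def mem_Collect_eq by (intro PiE_ext[of y "{..n}" _ y0]) auto
      with False show False ..
    qed
    then have "\<omega> \<notin> site_path n y" using Y by (auto simp: path_event_def)
    then show ?thesis using False by simp
  qed
  then have "(\<Sum>y\<in>paths_to n b. indicator (site_path n y) \<omega>) = (\<Sum>y\<in>paths_to n b. if y = y0 then 1 else 0 :: complex)"
    by (intro sum.cong refl)
  then show ?thesis using True y0 by simp
next
  case False
  have "\<omega> \<notin> site_path n y" if "y \<in> paths_to n b" for y
    using False that assms by (auto simp: path_event_def alive_at_def paths_to_def)
  then have "(\<Sum>y\<in>paths_to n b. indicator (site_path n y) \<omega> :: complex) = 0"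
    by (intro sum.neutral) simp
  then show ?thesis using False by simp
qed

lemma integral_alive_at:
  assumes g: "integrable P g"
  shows "(\<integral>\<omega>. indicator (alive_at n b) \<omega> * g \<omega> \<partial>P)
    = (\<Sum>y\<in>paths_to n b. \<integral>\<omega>. indicator (site_path n y) \<omega> * (g \<omega> :: complex) \<partial>P)"
proof -
  have "(\<integral>\<omega>. indicator (alive_at n b) \<omega> * g \<omega> \<partial>P)
      = (\<integral>\<omega>. (\<Sum>y\<in>paths_to n b. indicator (site_path n y) \<omega> * g \<omega>) \<partial>P)"
    by (intro Bochner_Integration.integral_cong refl) (simp add: indicator_alive_at sum_distrib_right)
  also have "\<dots> = (\<Sum>y\<in>paths_to n b. \<integral>\<omega>. indicator (site_path n y) \<omega> * g \<omega> \<partial>P)"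
  proof (rule Bochner_Integration.integral_sum)
    fix y
    show "integrable P (\<lambda>\<omega>. indicator (site_path n y) \<omega> * g \<omega>)"
      by (rule Bochner_Integration.integrable_bound[OF g]) (use g in \<open>auto simp: indicator_def norm_mult\<close>)
  qed
  finally show ?thesis .
qed

lemma measurable_step_discount [measurable]: "step_discount z s \<in> borel_measurable borel"
  unfolding step_discount_def by (cases s) simp_all

lemma norm_step_discount_le:
  assumes "\<And>x. 0 \<le> Re (z x)"
  shows "norm (step_discount z s t) \<le> 1"
  using assms by (cases s) (simp_all add: step_discount_def)

lemma integrable_step:
  assumes z: "\<And>x. 0 \<le> Re (z x)"
  shows "integrable P (\<lambda>\<omega>. indicator {\<omega>. Y (Suc n) \<omega> = s} \<omega> * (discount z n \<omega> * step_discount z s (T (Suc n) \<omega>)))"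
proof (rule integrable_const_bound[where B=1])
  show "AE \<omega> in P. norm (indicator {\<omega>. Y (Suc n) \<omega> = s} \<omega> * (discount z n \<omega> * step_discount z s (T (Suc n) \<omega>))) \<le> 1"
    using mult_le_one[OF norm_discount_le[OF z] norm_ge_zero norm_step_discount_le[OF z]]
    by (auto simp: norm_mult indicator_def)
  have [measurable]: "(\<lambda>\<omega>. indicator {\<omega>. Y (Suc n) \<omega> = s} \<omega> :: complex) \<in> borel_measurable P"
    using measurable_compose[OF measurable_Y[of "Suc n"], of "\<lambda>y. of_bool (y = s) :: complex" borel]
    by (simp add: indicator_def)
  show "(\<lambda>\<omega>. indicator {\<omega>. Y (Suc n) \<omega> = s} \<omega> * (discount z n \<omega> * step_discount z s (T (Suc n) \<omega>))) \<in> borel_measurable P"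
    by measurable
qed

lemma integral_step:
  assumes z: "\<And>x. 0 \<le> Re (z x)"
  shows "(\<integral>\<omega>. indicator (alive_at n x) \<omega> * (indicator {\<omega>. Y (Suc n) \<omega> = s} \<omega> * (discount z n \<omega> * step_discount z s (T (Suc n) \<omega>))) \<partial>P)
    = step_law z x s * expected_discount z n x"
proof -
  have d: "integrable P (discount z n)"
    by (rule integrable_const_bound[where B=1]) (use norm_discount_le[OF z] in auto)
  have "(\<integral>\<omega>. indicator (alive_at n x) \<omega> * (indicator {\<omega>. Y (Suc n) \<omega> = s} \<omega> * (discount z n \<omega> * step_discount z s (T (Suc n) \<omega>))) \<partial>P)
     = (\<Sum>y\<in>paths_to n x. step_law z (y n) s * (\<integral>\<omega>. indicator (site_path n y) \<omega> * discount z n \<omega> \<partial>P))"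
    unfolding integral_alive_at[OF integrable_step[OF z]]
  proof (intro sum.cong refl)
    fix y
    show "(\<integral>\<omega>. indicator (site_path n y) \<omega> * (indicator {\<omega>. Y (Suc n) \<omega> = s} \<omega> * (discount z n \<omega> * step_discount z s (T (Suc n) \<omega>))) \<partial>P)
       = step_law z (y n) s * (\<integral>\<omega>. indicator (site_path n y) \<omega> * discount z n \<omega> \<partial>P)"
      using path_step[OF z, of n y s] by (simp only: indicator_inter_arith mult.assoc)
  qed
  also have "\<dots> = (\<Sum>y\<in>paths_to n x. step_law z x s * (\<integral>\<omega>. indicator (site_path n y) \<omega> * discount z n \<omega> \<partial>P))"
    by (intro sum.cong refl) (simp add: paths_to_def)
  also have "\<dots> = step_law z x s * expected_discount z n x"
    unfolding expected_discount_def integral_alive_at[OF d] sum_distrib_left ..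
  finally show ?thesis .
qed

lemma integral_dies_at:
  assumes z: "\<And>x. 0 \<le> Re (z x)"
  shows "(\<integral>\<omega>. indicator (dies_at n b) \<omega> * discount z n \<omega> \<partial>P)
    = of_real (jump_prob D J (Some b) None) * expected_discount z n b"
proof -
  have "dies_at n b = alive_at n b \<inter> {\<omega>. Y (Suc n) \<omega> = None}"
    by (auto simp: dies_at_def alive_at_def)
  then have "(\<integral>\<omega>. indicator (dies_at n b) \<omega> * discount z n \<omega> \<partial>P)
    = (\<integral>\<omega>. indicator (alive_at n b) \<omega> * (indicator {\<omega>. Y (Suc n) \<omega> = None} \<omega> * (discount z n \<omega> * step_discount z None (T (Suc n) \<omega>))) \<partial>P)"
    by (simp add: step_discount_def indicator_inter_arith mult.assoc)
  also have "\<dots> = of_real (jump_prob D J (Some b) None) * expected_discount z n b"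
    by (simp only: integral_step[OF z]) (simp add: step_law_def)
  finally show ?thesis .
qed

text \<open>The expectation is split by the site at step \<open>n\<close>. As a row vector in
  \<open>b\<close>, the expected discount is multiplied by the matrix of jump probabilities and by
  the diagonal matrix of holding factors, which is the recursion of a Neumann series.\<close>

lemma expected_discount_Suc:
  assumes z: "\<And>x. 0 \<le> Re (z x)"
  shows "expected_discount z (Suc n) b
    = (\<Sum>x\<in>UNIV. expected_discount z n x * of_real (J $ x $ b / D $ x $ x)) * holding_factor z b"
proof -
  let ?I = "\<lambda>x \<omega>. indicator (alive_at n x) \<omega> * (indicator {\<omega>. Y (Suc n) \<omega> = Some b} \<omega> * (discount z n \<omega> * step_discount z (Some b) (T (Suc n) \<omega>)))"
  have "indicator (alive_at (Suc n) b) \<omega> * discount z (Suc n) \<omega> = (\<Sum>x\<in>UNIV. ?I x \<omega>)" for \<omega>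
  proof (cases "\<omega> \<in> alive_at (Suc n) b")
    case True
    then have "Y n \<omega> \<noteq> None" by (simp add: alive_at_def)
    then obtain x where x: "Y n \<omega> = Some x" by auto
    have "indicator (alive_at n x') \<omega> = (if x' = x then 1 else 0 :: complex)" for x'
      using True x by (auto simp: alive_at_def indicator_def)
    then have "(\<Sum>x'\<in>UNIV. ?I x' \<omega>) = (\<Sum>x'\<in>UNIV. if x' = x then ?I x \<omega> else 0)"
      by (intro sum.cong refl) auto
    also have "\<dots> = ?I x \<omega>" by simp
    also have "\<dots> = discount z (Suc n) \<omega>"
      using True x by (auto simp: alive_at_def discount_def step_discount_def indicator_def)
    finally show ?thesis using True by simp
  next
    case False
    have "?I x \<omega> = 0" for x
      using False by (auto simp: alive_at_def indicator_def le_Suc_eq)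
    then have "(\<Sum>x\<in>UNIV. ?I x \<omega>) = 0" by (intro sum.neutral) blast
    then show ?thesis using False by simp
  qed
  then have "expected_discount z (Suc n) b = (\<integral>\<omega>. (\<Sum>x\<in>UNIV. ?I x \<omega>) \<partial>P)"
    by (simp only: expected_discount_def)
  also have "\<dots> = (\<Sum>x\<in>UNIV. \<integral>\<omega>. ?I x \<omega> \<partial>P)"
  proof (rule Bochner_Integration.integral_sum)
    fix x
    note int = integrable_step[OF z, of n "Some b"]
    show "integrable P (?I x)"
      by (rule Bochner_Integration.integrable_bound[OF int])
         (use borel_measurable_integrable[OF int] in \<open>auto simp: indicator_def norm_mult\<close>)
  qed
  also have "\<dots> = (\<Sum>x\<in>UNIV. step_law z x (Some b) * expected_discount z n x)"
    unfolding integral_step[OF z] ..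
  also have "\<dots> = (\<Sum>x\<in>UNIV. expected_discount z n x * of_real (J $ x $ b / D $ x $ x)) * holding_factor z b"
    by (simp add: step_law_def sum_distrib_left sum_distrib_right mult_ac)
  finally show ?thesis .
qed

lemma expected_discount_0:
  assumes z: "\<And>x. 0 \<le> Re (z x)"
  shows "expected_discount z 0 b = (if a = b then holding_factor z a else 0)"
proof -
  have E: "alive_at 0 b = path_event 0 (\<lambda>i. Some b)"
    by (auto simp: alive_at_def path_event_def)
  have "prob (path_event 0 (\<lambda>i. Some b)) = of_bool (a = b)"
    unfolding path_event_def jumps by auto
  then show ?thesis
    unfolding expected_discount_def E path_discount[OF z] by simp
qed

section \<open>Geometric decay from diagonal dominance\<close>

definition contraction :: real where
  "contraction = (MAX x. \<Sum>y\<in>UNIV. \<bar>J $ x $ y / D $ x $ x\<bar>)"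

lemma contraction: "(\<Sum>y\<in>UNIV. J $ x $ y / D $ x $ x) \<le> contraction" "contraction < 1" "0 \<le> contraction"
proof -
  have "(\<Sum>y\<in>UNIV. \<bar>J $ x $ y / D $ x $ x\<bar>) \<le> contraction" for x
    unfolding contraction_def by (rule Max_ge) auto
  moreover have "\<bar>J $ x $ y / D $ x $ x\<bar> = J $ x $ y / D $ x $ x" for x y
    using J_nonneg[of x y] D_pos[of x] by simp
  ultimately have *: "(\<Sum>y\<in>UNIV. J $ x $ y / D $ x $ x) \<le> contraction" for x by simp
  show "(\<Sum>y\<in>UNIV. J $ x $ y / D $ x $ x) \<le> contraction" by (rule *)
  have "0 \<le> (\<Sum>y\<in>UNIV. J $ x $ y / D $ x $ x)"
    using J_nonneg D_pos by (intro sum_nonneg divide_nonneg_pos) auto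
  then show "0 \<le> contraction" using * order_trans by blast
  show "contraction < 1"
    using dominant by (simp add: diagonally_dominant_def contraction_def)
qed

lemma jump_prob_None_pos: "0 < jump_prob D J (Some b) None"
  using contraction(1)[of b] contraction(2) by simp

text \<open>The discount with exponent 0 is 1, so the recursion for expected discounts specialises
  to survival probabilities.\<close>

lemma prob_alive_at_Suc:
  "prob (alive_at (Suc n) b) = (\<Sum>x\<in>UNIV. prob (alive_at n x) * (J $ x $ b / D $ x $ x))"
proof -
  have e: "expected_discount (\<lambda>_. 0) n b = of_real (prob (alive_at n b))" for n b
  proof -
    have "expected_discount (\<lambda>_. 0) n b = (\<integral>\<omega>. of_real (indicator (alive_at n b) \<omega>) \<partial>P)"
      unfolding expected_discount_def
      by (intro Bochner_Integration.integral_cong refl) (simp add: discount_def indicator_def)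
    then show ?thesis by (simp only: integral_complex_of_real) simp
  qed
  have "holding_factor (\<lambda>_. 0) b = 1" using D_pos[of b] by (simp add: holding_factor_def)
  then have "complex_of_real (prob (alive_at (Suc n) b)) = of_real (\<Sum>x\<in>UNIV. prob (alive_at n x) * (J $ x $ b / D $ x $ x))"
    using expected_discount_Suc[of "\<lambda>_. 0" n b] by (simp add: e)
  then show ?thesis by (simp only: of_real_eq_iff)
qed

text \<open>Dominance bounds the row sums of the jump matrix and says nothing on its columns. It is
  therefore the total mass of the row vector of survival probabilities that shrinks by
  \<open>contraction\<close> at each step.\<close>

lemma sum_prob_alive_at: "(\<Sum>b\<in>UNIV. prob (alive_at n b)) \<le> contraction ^ n"
proof (induction n)
  case 0
  have "disjoint_family (alive_at 0)" by (auto simp: disjoint_family_on_def alive_at_def)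
  then have "(\<Sum>b\<in>UNIV. prob (alive_at 0 b)) = prob (\<Union>b. alive_at 0 b)"
    by (intro finite_measure_finite_Union[symmetric]) auto
  also have "\<dots> \<le> 1" by (rule prob_le_1)
  finally show ?case by simp
next
  case (Suc n)
  have "(\<Sum>b\<in>UNIV. prob (alive_at (Suc n) b)) = (\<Sum>x\<in>UNIV. prob (alive_at n x) * (\<Sum>b\<in>UNIV. J $ x $ b / D $ x $ x))"
    unfolding prob_alive_at_Suc sum_distrib_left by (rule sum.swap)
  also have "\<dots> \<le> (\<Sum>x\<in>UNIV. prob (alive_at n x) * contraction)"
    by (intro sum_mono mult_left_mono contraction) auto
  also have "\<dots> \<le> contraction ^ n * contraction"
    unfolding sum_distrib_right[symmetric] by (intro mult_right_mono Suc contraction)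
  finally show ?case by (simp add: mult.commute)
qed

lemma prob_alive_at_le: "prob (alive_at n b) \<le> contraction ^ n"
  using sum_prob_alive_at[of n] member_le_sum[of b UNIV "\<lambda>b. prob (alive_at n b)"] by simp

lemma norm_expected_discount_le:
  assumes z: "\<And>x. 0 \<le> Re (z x)"
  shows "norm (expected_discount z n b) \<le> contraction ^ n"
proof -
  have "norm (expected_discount z n b) \<le> (\<integral>\<omega>. norm (indicator (alive_at n b) \<omega> * discount z n \<omega>) \<partial>P)"
    unfolding expected_discount_def by (rule integral_norm_bound)
  also have "\<dots> \<le> (\<integral>\<omega>. indicator (alive_at n b) \<omega> \<partial>P)"
  proof (rule integral_mono)
    show "integrable P (\<lambda>\<omega>. norm (indicator (alive_at n b) \<omega> * discount z n \<omega>))"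
      by (intro integrable_norm integrable_discount z alive_at_sets)
    show "norm (indicator (alive_at n b) \<omega> * discount z n \<omega>) \<le> indicator (alive_at n b) \<omega>" for \<omega>
      using norm_discount_le[OF z] by (auto simp: indicator_def norm_mult)
  qed (simp add: integrable_indicator_iff emeasure_eq_measure)
  also have "\<dots> = prob (alive_at n b)" by simp
  also have "\<dots> \<le> contraction ^ n" by (rule prob_alive_at_le)
  finally show ?thesis .
qed

lemma summable_expected_discount:
  assumes z: "\<And>x. 0 \<le> Re (z x)"
  shows "summable (\<lambda>n. expected_discount z n b)"
  by (rule summable_comparison_test'[OF summable_geometric[of contraction]])
     (use contraction norm_expected_discount_le[OF z] in auto)

lemma AE_absorbed: "AE \<omega> in P. \<exists>n. Y n \<omega> = None"
proof -
  let ?N = "{\<omega> \<in> space P. \<forall>n. Y n \<omega> \<noteq> None}"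
  have N: "?N \<in> sets P" by measurable
  have "prob ?N \<le> contraction ^ n" for n
  proof -
    have "?N \<subseteq> (\<Union>b. alive_at n b)" by (auto simp: alive_at_def)
    then have "prob ?N \<le> prob (\<Union>b. alive_at n b)" by (intro finite_measure_mono) auto
    also have "\<dots> \<le> (\<Sum>b\<in>UNIV. prob (alive_at n b))"
      by (intro finite_measure_subadditive_finite) auto
    also have "\<dots> \<le> contraction ^ n" by (rule sum_prob_alive_at)
    finally show ?thesis .
  qed
  moreover have "(\<lambda>n. contraction ^ n) \<longlonglongrightarrow> 0"
    using contraction by (intro LIMSEQ_realpow_zero) auto
  ultimately have "prob ?N \<le> 0"
    by (intro LIMSEQ_le_const[of "\<lambda>n. contraction ^ n"]) auto
  then have "prob ?N = 0" by (simp add: antisym)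
  from AE_notin_prob_0[OF N this] AE_space show ?thesis by eventually_elim auto
qed

text \<open>The Neumann series of the resolvent, read off row \<open>a\<close>.\<close>

lemma expected_discount_sums:
  fixes V U :: "complex ^ 'm ^ 'm"
  assumes z: "\<And>x. 0 \<le> Re (z x)"
    and V: "\<And>x y. V $ x $ y = (if x = y then of_real (D $ x $ x) + z x else 0) - of_real (J $ x $ y)"
    and U: "V ** U = mat 1"
  shows "(\<lambda>n. expected_discount z n b) sums (of_real (D $ b $ b) * U $ a $ b)"
proof -
  define S where "S b = (\<Sum>n. expected_discount z n b)" for b
  have S: "(\<lambda>n. expected_discount z n b) sums S b" for b
    unfolding S_def using summable_expected_discount[OF z] by (rule summable_sums)
  have nz: "of_real (D $ b $ b) + z b \<noteq> 0" "complex_of_real (D $ b $ b) \<noteq> 0" for b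
    using D_pos[of b] z[of b] by (auto simp: complex_eq_iff)
  \<comment> \<open>Dividing the summed recursion by the holding factor clears the denominator D +
    z; it then says that the row vector S / D times \<open>V\<close> is the unit vector at
    \<open>a\<close>.\<close>
  have row: "(\<Sum>x\<in>UNIV. S x / of_real (D $ x $ x) * V $ x $ b) = (if a = b then 1 else 0)" for b
  proof -
    have "(\<lambda>n. expected_discount z (Suc n) b) sums (S b - expected_discount z 0 b)"
      using S[of b] by (simp add: sums_Suc_iff[of "\<lambda>n. expected_discount z n b"])
    moreover have "(\<lambda>n. expected_discount z (Suc n) b) sums ((\<Sum>x\<in>UNIV. S x * of_real (J $ x $ b / D $ x $ x)) * holding_factor z b)"
      unfolding expected_discount_Suc[OF z] by (intro sums_mult2 sums_sum S)
    ultimately have "S b - expected_discount z 0 b = (\<Sum>x\<in>UNIV. S x * of_real (J $ x $ b / D $ x $ x)) * holding_factor z b"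
      by (rule sums_unique2)
    then have A: "(S b - expected_discount z 0 b) / holding_factor z b = (\<Sum>x\<in>UNIV. S x * of_real (J $ x $ b / D $ x $ x))"
      using nz[of b] by (simp add: holding_factor_def field_simps)
    have B: "(S b - expected_discount z 0 b) / holding_factor z b
        = S b / of_real (D $ b $ b) * (of_real (D $ b $ b) + z b) - (if a = b then 1 else 0)"
    proof -
      have r: "holding_factor z b \<noteq> 0" using nz[of b] by (simp add: holding_factor_def)
      have "expected_discount z 0 b = (if a = b then 1 else 0) * holding_factor z b"
        by (simp add: expected_discount_0[OF z])
      then have "(S b - expected_discount z 0 b) / holding_factor z b = S b / holding_factor z b - (if a = b then 1 else 0)"
      proof -
        have "(u - k * q) / q = u / q - k" if "q \<noteq> 0" for u k q :: complex
          using that by (simp add: diff_divide_distrib)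
        from this[OF r] show ?thesis using \<open>expected_discount z 0 b = _\<close> by (simp only:)
      qed
      moreover have "S b / holding_factor z b = S b / of_real (D $ b $ b) * (of_real (D $ b $ b) + z b)"
        by (simp add: holding_factor_def)
      ultimately show ?thesis by (simp only:)
    qed
    have eq: "S b / of_real (D $ b $ b) * (of_real (D $ b $ b) + z b) - (\<Sum>x\<in>UNIV. S x * of_real (J $ x $ b / D $ x $ x)) = (if a = b then 1 else 0)"
    proof -
      have "W - R = \<delta>" if "q = R" "q = W - \<delta>" for q R W \<delta> :: complex
        using that by (simp add: algebra_simps)
      from this[OF A B] show ?thesis .
    qed
    have "(\<Sum>x\<in>UNIV. S x / of_real (D $ x $ x) * V $ x $ b)
       = (\<Sum>x\<in>UNIV. (if x = b then S b / of_real (D $ b $ b) * (of_real (D $ b $ b) + z b) else 0) - S x * of_real (J $ x $ b / D $ x $ x))"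
      by (intro sum.cong refl) (simp add: V algebra_simps)
    also have "\<dots> = (if a = b then 1 else 0)"
    proof -
      have delta: "(\<Sum>x\<in>UNIV. if x = b then q else 0) = q" for q :: complex by simp
      show ?thesis unfolding sum_subtractf delta by (rule eq)
    qed
    finally show ?thesis .
  qed
  have "S b / of_real (D $ b $ b) = (\<Sum>x\<in>UNIV. S x / of_real (D $ x $ x) * (V ** U) $ x $ b)"
    by (simp add: U mat_def if_distrib[of "\<lambda>t. _ * t"] cong: if_cong)
  also have "\<dots> = (\<Sum>x\<in>UNIV. \<Sum>y\<in>UNIV. S x / of_real (D $ x $ x) * V $ x $ y * U $ y $ b)"
    by (simp add: matrix_matrix_mult_def sum_distrib_left mult.assoc)
  also have "\<dots> = (\<Sum>y\<in>UNIV. (\<Sum>x\<in>UNIV. S x / of_real (D $ x $ x) * V $ x $ y) * U $ y $ b)"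
    unfolding sum_distrib_right by (rule sum.swap)
  also have "\<dots> = (\<Sum>y\<in>UNIV. if a = y then U $ y $ b else 0)"
    unfolding row by (intro sum.cong) auto
  also have "\<dots> = U $ a $ b" by simp
  finally have "S b = of_real (D $ b $ b) * U $ a $ b" using nz(2)[of b] by (simp add: field_simps)
  then show ?thesis using S[of b] by simp
qed

end

section \<open>Local times and conclusion\<close>

context
  fixes Y :: "nat \<Rightarrow> 'w \<Rightarrow> 'm::finite option" and T :: "nat \<Rightarrow> 'w \<Rightarrow> real" and \<omega> :: 'w and n :: nat
  assumes alive: "\<And>i. i \<le> n \<Longrightarrow> Y i \<omega> \<noteq> None" and dead: "\<And>k. n < k \<Longrightarrow> Y k \<omega> = None"
    and T_nonneg: "\<And>i. i \<le> n \<Longrightarrow> 0 \<le> T i \<omega>"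
begin

lemma death_index_eq: "death_index Y \<omega> = Suc n"
  unfolding death_index_def
proof (rule Least_equality)
  fix k assume "Y k \<omega> = None"
  then show "Suc n \<le> k" using alive[of k] by (cases "k \<le> n") auto
qed (simp add: dead)

lemma jump_time_mono:
  assumes "i \<le> k" "k \<le> Suc n"
  shows "jump_time T i \<omega> \<le> jump_time T k \<omega>"
  unfolding jump_time_def by (rule sum_mono2) (use assms T_nonneg in auto)

text \<open>The sojourn intervals are half-open, so a vanishing holding time gives an empty
  interval, and nonnegativity of the times is enough for every \<open>s\<close> to lie in at most
  one of them.\<close>

lemma local_time_eq: "local_time Y T x \<omega> = (\<Sum>i\<le>n. if Y i \<omega> = Some x then T i \<omega> else 0)"
proof -
  let ?\<tau> = "\<lambda>i. jump_time T i \<omega>"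
  let ?soj = "\<lambda>s i. Y i \<omega> \<noteq> None \<and> ?\<tau> i \<le> s \<and> s < ?\<tau> (Suc i)"
  have soj_le: "i \<le> n" if "?soj s i" for s i
    using that dead[of i] by (meson not_le)
  have not_less: False if "?soj s i" "?soj s k" "i < k" for s i k
    using that soj_le[OF that(2)] jump_time_mono[of "Suc i" k] by auto
  have uniq: "i = k" if "?soj s i" "?soj s k" for s i k
    using not_less[OF that] not_less[OF that(2,1)] by (meson linorder_neqE_nat)
  have eq: "indicat_real {0..} s * indicat_real {s. chain_at Y T s \<omega> = Some x} s
     = (\<Sum>i\<le>n. if Y i \<omega> = Some x then indicat_real {?\<tau> i..<?\<tau> (Suc i)} s else 0)" for s
  proof (cases "\<exists>i. ?soj s i")
    case True
    then obtain k where k: "?soj s k" by blast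
    have least: "(LEAST i. ?soj s i) = k"
      using k uniq by (intro Least_equality) auto
    have "chain_at Y T s \<omega> = Y k \<omega>"
      unfolding chain_at_def Let_def using True least by simp
    moreover have "0 \<le> s"
      using k jump_time_mono[of 0 k] soj_le[OF k] by (simp add: jump_time_def)
    moreover have "(\<Sum>i\<le>n. if Y i \<omega> = Some x then indicat_real {?\<tau> i..<?\<tau> (Suc i)} s else 0)
        = (\<Sum>i\<le>n. if i = k then (if Y k \<omega> = Some x then 1 else 0) else 0)"
    proof (intro sum.cong refl)
      fix i assume "i \<in> {..n}"
      show "(if Y i \<omega> = Some x then indicat_real {?\<tau> i..<?\<tau> (Suc i)} s else 0) = (if i = k then (if Y k \<omega> = Some x then 1 else 0) else 0)"
      proof (cases "i = k")
        case True
        then show ?thesis using k by (simp add: indicator_def)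
      next
        case False
        then have "\<not> ?soj s i" using k uniq by blast
        then show ?thesis using False by (auto simp: indicator_def)
      qed
    qed
    ultimately show ?thesis using soj_le[OF k] by (simp add: indicator_def)
  next
    case False
    then have "chain_at Y T s \<omega> = None" unfolding chain_at_def Let_def by (rule if_not_P)
    moreover have "(\<Sum>i\<le>n. if Y i \<omega> = Some x then indicat_real {?\<tau> i..<?\<tau> (Suc i)} s else 0) = 0"
      using False by (intro sum.neutral) (auto simp: indicator_def)
    ultimately show ?thesis by simp
  qed
  have \<tau>_Suc: "?\<tau> (Suc i) - ?\<tau> i = T i \<omega>" for i by (simp add: jump_time_def)
  have int: "has_bochner_integral lborel (\<lambda>s. if Y i \<omega> = Some x then indicat_real {?\<tau> i..<?\<tau> (Suc i)} s else 0)
      (if Y i \<omega> = Some x then T i \<omega> else 0)" if "i \<le> n" for i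
  proof -
    have "?\<tau> i \<le> ?\<tau> (Suc i)" using that by (intro jump_time_mono) auto
    then have "has_bochner_integral lborel (indicat_real {?\<tau> i..<?\<tau> (Suc i)}) (measure lborel {?\<tau> i..<?\<tau> (Suc i)})"
      by (intro has_bochner_integral_real_indicator) auto
    then show ?thesis using \<open>?\<tau> i \<le> ?\<tau> (Suc i)\<close> 
      by (cases "Y i \<omega> = Some x") (simp_all add: \<tau>_Suc has_bochner_integral_zero)
  qed
  have "has_bochner_integral lborel (\<lambda>s. \<Sum>i\<le>n. if Y i \<omega> = Some x then indicat_real {?\<tau> i..<?\<tau> (Suc i)} s else 0)
      (\<Sum>i\<le>n. if Y i \<omega> = Some x then T i \<omega> else 0)"
    by (intro has_bochner_integral_sum int) simp
  then show ?thesis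
    unfolding local_time_def set_lebesgue_integral_def real_scaleR_def eq
    by (rule has_bochner_integral_integral_eq)
qed

lemma lifetime_eq: "lifetime Y T \<omega> = (\<Sum>x\<in>UNIV. local_time Y T x \<omega>)"
proof -
  have "(\<Sum>x\<in>UNIV. local_time Y T x \<omega>) = (\<Sum>i\<le>n. \<Sum>x\<in>UNIV. if Y i \<omega> = Some x then T i \<omega> else 0)"
    unfolding local_time_eq by (rule sum.swap)
  also have "\<dots> = (\<Sum>i\<le>n. T i \<omega>)"
  proof (intro sum.cong refl)
    fix i assume "i \<in> {..n}"
    then obtain y where "Y i \<omega> = Some y" using alive[of i] by auto
    then show "(\<Sum>x\<in>UNIV. if Y i \<omega> = Some x then T i \<omega> else 0) = T i \<omega>" by simp
  qed
  finally show ?thesis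
    by (simp add: lifetime_def death_index_eq jump_time_def lessThan_Suc_atMost)
qed

text \<open>The lifetime is the sum of the local times, so the weight is a product over sites of
  functions of one local time each.\<close>

lemma wsaw_weight_eq:
  "complex_of_real (wsaw_weight Y T g lam b \<omega>)
    = (if Y n \<omega> = Some b then \<Prod>x\<in>UNIV. quart g lam (of_real (local_time Y T x \<omega>)) else 0)"
proof -
  let ?L = "\<lambda>x. local_time Y T x \<omega>"
  have "(\<Prod>x\<in>UNIV. quart g lam (of_real (?L x))) = of_real (\<Prod>x\<in>UNIV. exp (- g * (?L x)\<^sup>2 - lam * ?L x))"
    by (simp add: quart_def exp_of_real[symmetric])
  also have "(\<Prod>x\<in>UNIV. exp (- g * (?L x)\<^sup>2 - lam * ?L x)) = exp (\<Sum>x\<in>UNIV. - g * (?L x)\<^sup>2 - lam * ?L x)"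
    by (simp add: exp_sum)
  also have "(\<Sum>x\<in>UNIV. - g * (?L x)\<^sup>2 - lam * ?L x) = - g * (\<Sum>x\<in>UNIV. (?L x)\<^sup>2) + - lam * (\<Sum>x\<in>UNIV. ?L x)"
    by (simp only: sum_distrib_left sum.distrib[symmetric]) simp
  finally have "(\<Prod>x\<in>UNIV. quart g lam (of_real (?L x)))
      = of_real (exp (- g * (\<Sum>x\<in>UNIV. (?L x)\<^sup>2)) * exp (- lam * lifetime Y T \<omega>))"
    by (simp only: exp_add lifetime_eq)
  then show ?thesis
    by (simp add: wsaw_weight_def last_state_def death_index_eq indicator_def)
qed

end


section \<open>Exchanging the chain with the frequencies\<close>

context dominant_chain
begin

text \<open>A stand-in for the local time of a path that dies after step \<open>n\<close>:
  nonnegative everywhere, evidently measurable, and almost surely equal to the local time for such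
  paths.\<close>

definition occupation :: "nat \<Rightarrow> 'w \<Rightarrow> 'm \<Rightarrow> real" where
  "occupation n \<omega> x = (\<Sum>i\<le>n. if Y i \<omega> = Some x then max 0 (T i \<omega>) else 0)"

lemma occupation_nonneg: "0 \<le> occupation n \<omega> x"
  unfolding occupation_def by (intro sum_nonneg) simp

lemma measurable_occupation [measurable]: "(\<lambda>\<omega>. occupation n \<omega> x) \<in> borel_measurable P"
  unfolding occupation_def by measurable

lemma dies_at_unique:
  assumes n: "\<omega> \<in> dies_at n b" and k: "\<omega> \<in> dies_at k b"
  shows "k = n"
proof -
  have "Y (Suc n) \<omega> = None" "Y (Suc k) \<omega> = None" using n k by (simp_all add: dies_at_def)
  then have "\<not> Suc n \<le> k" "\<not> Suc k \<le> n"
    using n k unfolding dies_at_def by blast+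
  then show ?thesis by simp
qed

text \<open>Almost surely there is one last step before the cemetery, so the series has at most one
  nonzero term, selected by \<open>dies_at\<close>.\<close>

lemma AE_wsaw_weight:
  "AE \<omega> in P. (\<lambda>n. indicator (dies_at n b) \<omega> * (\<Prod>x\<in>UNIV. quart g lam (of_real (occupation n \<omega> x))))
     sums complex_of_real (wsaw_weight Y T g lam b \<omega>)"
  using AE_start AE_cemetery AE_holding_nonneg AE_absorbed AE_space
proof eventually_elim
  case (elim \<omega>)
  define N where "N = (LEAST n. Y n \<omega> = None)"
  have YN: "Y N \<omega> = None" unfolding N_def using elim(4) by (rule LeastI_ex)
  have before: "Y i \<omega> \<noteq> None" if "i < N" for i using that unfolding N_def by (rule not_less_Least)
  have after: "Y (N + k) \<omega> = None" for k
    by (induction k) (use YN elim(2) in auto)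
  \<comment> \<open>The chain starts in \<open>a\<close>, so the death index has a predecessor
    \<open>n\<close>, the step at which the last site is occupied.\<close>
  have "N \<noteq> 0" using YN elim(1) by (metis option.distinct(1))
  then obtain n where n: "N = Suc n" by (cases N) auto
  have alive: "Y i \<omega> \<noteq> None" if "i \<le> n" for i using that before by (simp add: n)
  have dead: "Y k \<omega> = None" if "n < k" for k
    using after[of "k - N"] that by (simp add: n)
  have T: "0 \<le> T i \<omega>" if "i \<le> n" for i using alive[OF that] elim(3) by blast
  have L: "local_time Y T x \<omega> = occupation n \<omega> x" for x
    unfolding occupation_def
    by (subst local_time_eq[of n Y \<omega> T]) (use alive dead T in \<open>auto intro!: sum.cong\<close>)
  have w: "complex_of_real (wsaw_weight Y T g lam b \<omega>)
      = (if Y n \<omega> = Some b then \<Prod>x\<in>UNIV. quart g lam (of_real (occupation n \<omega> x)) else 0)"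
    unfolding L[symmetric] by (rule wsaw_weight_eq) (use alive dead T in auto)
  have "\<omega> \<notin> dies_at k b" if "k \<noteq> n" for k
    using that alive[of "Suc k"] dead[of k] by (cases "k < n") (auto simp: dies_at_def)
  then have "(\<lambda>k. indicator (dies_at k b) \<omega> * (\<Prod>x\<in>UNIV. quart g lam (of_real (occupation k \<omega> x))))
      sums (\<Sum>k\<in>{n}. indicator (dies_at k b) \<omega> * (\<Prod>x\<in>UNIV. quart g lam (of_real (occupation k \<omega> x))))"
    by (intro sums_finite) auto
  moreover have "\<omega> \<in> dies_at n b \<longleftrightarrow> Y n \<omega> = Some b"
    using alive dead[of "Suc n"] elim(5) by (auto simp: dies_at_def)
  ultimately show ?case by (cases "Y n \<omega> = Some b") (simp_all add: w)
qed

text \<open>The same exponent, collected by site on the left and by step on the right.\<close>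

lemma exp_occupation:
  assumes "\<omega> \<in> dies_at n b"
  shows "exp (\<Sum>x\<in>UNIV. k x * complex_of_real (occupation n \<omega> x)) = discount (\<lambda>x. - k x) n \<omega>"
proof -
  have "(\<Sum>x\<in>UNIV. k x * complex_of_real (occupation n \<omega> x))
     = (\<Sum>i\<le>n. \<Sum>x\<in>UNIV. if Y i \<omega> = Some x then k x * of_real (max 0 (T i \<omega>)) else 0)"
    unfolding occupation_def of_real_sum sum_distrib_left
    by (subst sum.swap) (intro sum.cong refl, auto)
  also have "\<dots> = (\<Sum>i\<le>n. k (the (Y i \<omega>)) * of_real (max 0 (T i \<omega>)))"
  proof (intro sum.cong refl)
    fix i assume "i \<in> {..n}"
    then obtain y where "Y i \<omega> = Some y" using assms by (auto simp: dies_at_def)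
    then show "(\<Sum>x\<in>UNIV. if Y i \<omega> = Some x then k x * complex_of_real (max 0 (T i \<omega>)) else 0)
        = k (the (Y i \<omega>)) * of_real (max 0 (T i \<omega>))" by simp
  qed
  finally show ?thesis by (simp add: discount_def exp_sum)
qed

lemma norm_total_wgt: "norm (total_wgt g lam c \<xi>) = exp ((c - lam)\<^sup>2 / (4 * g)) ^ CARD('m)"
  for \<xi> :: "'m \<Rightarrow> real"
  unfolding total_wgt_def prod_norm[symmetric] norm_wgt by simp

text \<open>Fubini for the chain and the frequencies. As \<open>c\<close> and the occupations are
  nonnegative, the Fourier integrand is bounded by the constant modulus of the weight. The factor
  \<open>contraction ^ n\<close> in the last claim comes from survival up to step \<open>n\<close>
  and makes the sum over \<open>n\<close> converge.\<close>

lemma integral_dies_at_quart: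
  assumes g: "0 < g" and c: "0 \<le> c"
  shows "(\<integral>\<omega>. indicator (dies_at n b) \<omega> * (\<Prod>x\<in>UNIV. quart g lam (of_real (occupation n \<omega> x))) \<partial>P)
    = of_real (jump_prob D J (Some b) None) * (\<integral>\<xi>. total_wgt g lam c \<xi> * expected_discount (\<lambda>x. - freq g c (\<xi> x)) n b \<partial>freq_measure)"
      (is "?I1")
    and "integrable P (\<lambda>\<omega>. indicator (dies_at n b) \<omega> * (\<Prod>x\<in>UNIV. quart g lam (of_real (occupation n \<omega> x))))" (is "?I2")
    and "integrable freq_measure (\<lambda>\<xi>. total_wgt g lam c \<xi> * expected_discount (\<lambda>x. - freq g c (\<xi> x)) n b)" (is "?I3")
    and "norm (\<integral>\<omega>. norm (indicator (dies_at n b) \<omega> * (\<Prod>x\<in>UNIV. quart g lam (of_real (occupation n \<omega> x)))) \<partial>P)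
      \<le> exp ((c - lam)\<^sup>2 / (4 * g)) ^ CARD('m) * contraction ^ n" (is "?I4")
proof -
  let ?C = "exp ((c - lam)\<^sup>2 / (4 * g)) ^ CARD('m)"
  let ?q = "\<lambda>\<omega>. \<Prod>x\<in>UNIV. quart g lam (of_real (occupation n \<omega> x))"
  let ?h = "\<lambda>\<omega> \<xi>. total_wgt g lam c \<xi> * exp (\<Sum>x\<in>UNIV. freq g c (\<xi> x) * of_real (occupation n \<omega> x))"
  let ?G = "\<lambda>\<omega> \<xi>. indicator (dies_at n b) \<omega> * ?h \<omega> \<xi>"
  have q: "?q \<omega> = (\<integral>\<xi>. ?h \<omega> \<xi> \<partial>freq_measure)" for \<omega>
    using prod_quart_eq(1)[OF g, where S="{}" and t="occupation n \<omega>" and c=c and lam=lam] by simp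
  have z: "0 \<le> Re (- freq g c (\<xi> x))" for \<xi> :: "'m \<Rightarrow> real" and x
    using c by (simp add: freq_def)
  have h: "norm (?h \<omega> \<xi>) \<le> ?C" for \<omega> \<xi>
  proof -
    have "norm (exp (\<Sum>x\<in>UNIV. freq g c (\<xi> x) * of_real (occupation n \<omega> x))) = exp (\<Sum>x\<in>UNIV. - (c * occupation n \<omega> x))"
      by (simp add: freq_def)
    also have "\<dots> \<le> 1"
      using c occupation_nonneg by (simp add: sum_nonpos)
    finally show ?thesis unfolding norm_mult norm_total_wgt by (intro mult_left_le) auto
  qed
  have fin: "emeasure P (alive_at n b) < \<infinity>"
    by (simp add: emeasure_eq_measure)
  interpret PQ: pair_prob_space P "freq_measure :: ('m \<Rightarrow> real) measure" ..
  have [measurable]: "(\<lambda>p. freq g c (snd p x)) \<in> borel_measurable (P \<Otimes>\<^sub>M freq_measure)" for x :: 'm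
    by (rule measurable_compose[OF measurable_snd measurable_freq_component])
  have H: "integrable (P \<Otimes>\<^sub>M freq_measure) (case_prod ?G)"
  proof (rule PQ.P.integrable_const_bound[where B="?C"])
    show "AE p in P \<Otimes>\<^sub>M freq_measure. norm (case_prod ?G p) \<le> ?C"
      using h by (auto simp: split_beta norm_mult indicator_def)
    show "case_prod ?G \<in> borel_measurable (P \<Otimes>\<^sub>M freq_measure)"
      unfolding split_beta by measurable
  qed
  have E: "(\<integral>\<omega>. ?G \<omega> \<xi> \<partial>P) = of_real (jump_prob D J (Some b) None) * (total_wgt g lam c \<xi> * expected_discount (\<lambda>x. - freq g c (\<xi> x)) n b)" for \<xi>
  proof -
    have "(\<integral>\<omega>. ?G \<omega> \<xi> \<partial>P) = (\<integral>\<omega>. total_wgt g lam c \<xi> * (indicator (dies_at n b) \<omega> * discount (\<lambda>x. - freq g c (\<xi> x)) n \<omega>) \<partial>P)"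
      by (intro Bochner_Integration.integral_cong refl) (auto simp: indicator_def exp_occupation)
    also have "\<dots> = total_wgt g lam c \<xi> * (of_real (jump_prob D J (Some b) None) * expected_discount (\<lambda>x. - freq g c (\<xi> x)) n b)"
      by (simp only: integral_mult_right_zero integral_dies_at[OF z[of \<xi>]])
    finally show ?thesis by (simp only: mult.left_commute)
  qed
  have F: "(\<integral>\<xi>. ?G \<omega> \<xi> \<partial>freq_measure) = indicator (dies_at n b) \<omega> * ?q \<omega>" for \<omega>
    by (simp add: q)
  show ?I1
    using PQ.Fubini_integral[OF H] unfolding E F unfolding integral_mult_right_zero by (rule sym)
  show int: ?I2
    using PQ.integrable_fst[OF H] unfolding F .
  have "integrable freq_measure (\<lambda>\<xi>. \<integral>\<omega>. ?G \<omega> \<xi> \<partial>P)"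
    by (rule PQ.integrable_snd[OF H])
  \<comment> \<open>The killing probability is positive by dominance, so the scalar in
    \<open>E\<close> can be divided out.\<close>
  then have "integrable freq_measure (\<lambda>\<xi>. inverse (of_real (jump_prob D J (Some b) None)) * (of_real (jump_prob D J (Some b) None)
      * (total_wgt g lam c \<xi> * expected_discount (\<lambda>x. - freq g c (\<xi> x)) n b)))"
    unfolding E by (rule integrable_mult_right)
  moreover have inv: "inverse (of_real (jump_prob D J (Some b) None)) * complex_of_real (jump_prob D J (Some b) None) = 1"
    using jump_prob_None_pos[of b] by (simp del: jump_prob.simps)
  ultimately show ?I3
    by (simp only: mult.assoc[symmetric] inv mult_1_left)
  have qle: "norm (?q \<omega>) \<le> ?C" for \<omega>
  proof -
    have "norm (?q \<omega>) \<le> (\<integral>\<xi>. norm (?h \<omega> \<xi>) \<partial>(freq_measure :: ('m \<Rightarrow> real) measure))"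
      unfolding q by (rule integral_norm_bound)
    also have "\<dots> \<le> ?C"
      using h by (intro freq_prod.integral_le_const) (auto intro: integrable_norm prod_quart_eq(2)[OF g, where S="{}", simplified])
    finally show ?thesis .
  qed
  have "(\<integral>\<omega>. norm (indicator (dies_at n b) \<omega> * ?q \<omega>) \<partial>P) \<le> (\<integral>\<omega>. ?C * indicator (alive_at n b) \<omega> \<partial>P)"
  proof (rule integral_mono)
    show "integrable P (\<lambda>\<omega>. norm (indicator (dies_at n b) \<omega> * ?q \<omega>))"
      by (rule integrable_norm[OF int])
    show "integrable P (\<lambda>\<omega>. ?C * indicator (alive_at n b) \<omega>)"
      by (intro integrable_mult_right integrable_real_indicator) (use fin in auto)
    fix \<omega>
    have "dies_at n b \<subseteq> alive_at n b" by (auto simp: dies_at_def alive_at_def)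
    then show "norm (indicator (dies_at n b) \<omega> * ?q \<omega>) \<le> ?C * indicator (alive_at n b) \<omega>"
      using qle[of \<omega>] by (auto simp: norm_mult split: split_indicator)
  qed
  also have "\<dots> = ?C * prob (alive_at n b)" by simp
  also have "\<dots> \<le> ?C * contraction ^ n" by (intro mult_left_mono prob_alive_at_le) auto
  finally show ?I4 by simp
qed

text \<open>The geometric bound lets the sum over the step of death be exchanged with both
  integrals. For each choice of frequencies the sum is then the Neumann series with exponent -
  \<open>freq\<close>, whose real part is \<open>c\<close>.\<close>

lemma integral_wsaw_weight:
  assumes g: "0 < g" and c: "0 \<le> c" and converges: "integrable P (wsaw_weight Y T g lam b)"
    and V: "\<And>\<xi> x y. V \<xi> $ x $ y = (if x = y then of_real (D $ x $ x) - freq g c (\<xi> x) else 0) - of_real (J $ x $ y)"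
    and U: "\<And>\<xi>. V \<xi> ** U \<xi> = mat 1"
  shows "complex_of_real (\<integral>\<omega>. wsaw_weight Y T g lam b \<omega> \<partial>P)
    = of_real (D $ b $ b * jump_prob D J (Some b) None) * (\<integral>\<xi>. total_wgt g lam c \<xi> * U \<xi> $ a $ b \<partial>freq_measure)"
proof -
  let ?C = "exp ((c - lam)\<^sup>2 / (4 * g)) ^ CARD('m)"
  let ?f = "\<lambda>n \<omega>. indicator (dies_at n b) \<omega> * (\<Prod>x\<in>UNIV. quart g lam (of_real (occupation n \<omega> x)))"
  let ?e = "\<lambda>n \<xi>. total_wgt g lam c \<xi> * expected_discount (\<lambda>x. - freq g c (\<xi> x)) n b"
  let ?j = "jump_prob D J (Some b) None"
  note facts = integral_dies_at_quart[OF g c, where b=b and lam=lam]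
  have geo: "summable (\<lambda>n. ?C * contraction ^ n)"
    using contraction by (intro summable_mult summable_geometric) auto
  have z: "0 \<le> Re (- freq g c (\<xi> x))" for \<xi> :: "'m \<Rightarrow> real" and x
    using c by (simp add: freq_def)
  have "(\<lambda>n. integral\<^sup>L P (?f n)) sums (\<integral>\<omega>. (\<Sum>n. ?f n \<omega>) \<partial>P)"
  proof (rule sums_integral)
    show "integrable P (?f n)" for n by (rule facts)
    show "AE \<omega> in P. summable (\<lambda>n. norm (?f n \<omega>))"
    proof (rule AE_I2)
      fix \<omega>
      have "finite {n. \<omega> \<in> dies_at n b}"
      proof (cases "\<exists>n. \<omega> \<in> dies_at n b")
        case True
        then obtain n where "\<omega> \<in> dies_at n b" ..
        then have "{n. \<omega> \<in> dies_at n b} \<subseteq> {n}" using dies_at_unique by blast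
        then show ?thesis by (rule finite_subset) simp
      qed simp
      then show "summable (\<lambda>n. norm (?f n \<omega>))"
        by (rule summable_finite) auto
    qed
    show "summable (\<lambda>n. \<integral>\<omega>. norm (?f n \<omega>) \<partial>P)"
      by (rule summable_comparison_test'[OF geo]) (rule facts)
  qed
  moreover have "(\<integral>\<omega>. (\<Sum>n. ?f n \<omega>) \<partial>P) = (\<integral>\<omega>. of_real (wsaw_weight Y T g lam b \<omega>) \<partial>P)"
  proof (rule integral_cong_AE)
    show "(\<lambda>\<omega>. \<Sum>n. ?f n \<omega>) \<in> borel_measurable P"
      using borel_measurable_integrable[OF facts(2)] by measurable
    \<comment> \<open>The weight involves an integral over time; its measurability is read off from
      its integrability.\<close>
    show "(\<lambda>\<omega>. complex_of_real (wsaw_weight Y T g lam b \<omega>)) \<in> borel_measurable P"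
      using borel_measurable_integrable[OF converges] by measurable
    show "AE \<omega> in P. (\<Sum>n. ?f n \<omega>) = of_real (wsaw_weight Y T g lam b \<omega>)"
      using AE_wsaw_weight[of b g lam] by eventually_elim (rule sums_unique[symmetric])
  qed
  ultimately have 1: "(\<lambda>n. of_real ?j * integral\<^sup>L freq_measure (?e n)) sums complex_of_real (\<integral>\<omega>. wsaw_weight Y T g lam b \<omega> \<partial>P)"
    by (simp only: facts(1) integral_complex_of_real)
  have e: "norm (?e n \<xi>) \<le> ?C * contraction ^ n" for n \<xi>
    unfolding norm_mult norm_total_wgt by (intro mult_left_mono norm_expected_discount_le z) auto
  have "(\<lambda>n. integral\<^sup>L freq_measure (?e n)) sums (\<integral>\<xi>. (\<Sum>n. ?e n \<xi>) \<partial>freq_measure)"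
  proof (rule sums_integral)
    show "integrable freq_measure (?e n)" for n by (rule facts)
    show "AE \<xi> in freq_measure. summable (\<lambda>n. norm (?e n \<xi>))"
      using e by (intro AE_I2 summable_comparison_test'[OF geo]) simp
    show "summable (\<lambda>n. \<integral>\<xi>. norm (?e n \<xi>) \<partial>freq_measure)"
    proof (rule summable_comparison_test'[OF geo])
      fix n
      have "(\<integral>\<xi>. norm (?e n \<xi>) \<partial>freq_measure) \<le> ?C * contraction ^ n"
        using e by (intro freq_prod.integral_le_const integrable_norm facts) auto
      then show "norm (\<integral>\<xi>. norm (?e n \<xi>) \<partial>freq_measure) \<le> ?C * contraction ^ n" by simp
    qed
  qed
  moreover have "(\<Sum>n. ?e n \<xi>) = of_real (D $ b $ b) * (total_wgt g lam c \<xi> * U \<xi> $ a $ b)" for \<xi>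
  proof -
    have "(\<lambda>n. ?e n \<xi>) sums (total_wgt g lam c \<xi> * (of_real (D $ b $ b) * U \<xi> $ a $ b))"
      by (intro sums_mult expected_discount_sums[OF z _ U]) (simp add: V)
    from sums_unique[OF this] show ?thesis by (simp add: mult_ac)
  qed
  ultimately have "(\<lambda>n. of_real ?j * integral\<^sup>L freq_measure (?e n)) sums
      (of_real ?j * (of_real (D $ b $ b) * (\<integral>\<xi>. total_wgt g lam c \<xi> * U \<xi> $ a $ b \<partial>freq_measure)))"
    by (intro sums_mult) simp
  from sums_unique2[OF 1 this] show ?thesis by (simp only: of_real_mult mult_ac)
qed

end

theorem theorem5p1:
  fixes D J A :: "real ^ 'm::{finite,linorder} ^ 'm::{finite,linorder}" and g lam :: real and a b :: 'm
    and P :: "'w measure" and Y :: "nat \<Rightarrow> 'w \<Rightarrow> 'm option" and T :: "nat \<Rightarrow> 'w \<Rightarrow> real"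
  assumes D_diagonal: "\<And>x y. x \<noteq> y \<Longrightarrow> D $ x $ y = 0"
    and D_pos: "\<And>x. D $ x $ x > 0"
    and J_zero_diagonal: "\<And>x. J $ x $ x = 0"
    and J_nonneg: "\<And>x y. J $ x $ y \<ge> 0"
    and dominant: "diagonally_dominant D J"
    and A: "A = D - J"
    and g: "g > 0"
    and chain: "killed_chain P D J a Y T"
    and converges: "integrable P (wsaw_weight Y T g lam b)"
  shows "let K = form_exp (- S_form A) * \<phi>bar a * \<phi> b
           * form_fun (\<lambda>t. exp (- complex_of_real g * (\<Sum>x\<in>UNIV. (t x)\<^sup>2)
                                - complex_of_real lam * (\<Sum>x\<in>UNIV. t x))) \<tau>
         in form_integrable K \<and>
            complex_of_real (G_wsaw P D J Y T g lam b) = form_integral K"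
proof -
  interpret dominant_chain P D J a Y T
    using chain D_pos J_nonneg dominant by (intro dominant_chain.intro dominant_chain_axioms.intro)
  \<comment> \<open>The sum of the absolute entries controls the form of \<open>A\<close>, and the
    added 1 is the coercivity constant; nonnegativity of \<open>c\<close> is what the chain
    needs.\<close>
  define c where "c = 1 + (\<Sum>x\<in>UNIV. \<Sum>y\<in>UNIV. \<bar>A $ x $ y\<bar>)"
  have c: "0 \<le> c" unfolding c_def by (intro add_nonneg_nonneg sum_nonneg) auto
  have "coercive (freq_mat A g c \<xi>)" for \<xi>
    by (rule coercive_freq_mat) (simp add: c_def)
  then have "\<exists>U. U ** freq_mat A g c \<xi> = mat 1 \<and> freq_mat A g c \<xi> ** U = mat 1" for \<xi>
    using coercive_invertible by blast
  then obtain U where U: "\<And>\<xi>. U \<xi> ** freq_mat A g c \<xi> = mat 1" "\<And>\<xi>. freq_mat A g c \<xi> ** U \<xi> = mat 1"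
    by metis
  \<comment> \<open>The exponent is a sum over sites, so the weight factorises into functions of
    single arguments, the shape that \<open>coeff_integrand\<close> handles.\<close>
  have F: "(\<lambda>t. exp (- complex_of_real g * (\<Sum>x\<in>UNIV. (t x)\<^sup>2) - complex_of_real lam * (\<Sum>x\<in>UNIV. t x)))
     = (\<lambda>t :: 'm \<Rightarrow> complex. \<Prod>x\<in>UNIV. quart g lam (t x))"
    by (simp add: fun_eq_iff quart_def exp_sum[symmetric] sum_subtractf sum_negf sum_distrib_left)
  \<comment> \<open>Entrywise this is the matrix of the Neumann series for the chain, with exponent
    - \<open>freq\<close> at each site.\<close>
  have V: "freq_mat A g c \<xi> $ x $ y = (if x = y then of_real (D $ x $ x) - freq g c (\<xi> x) else 0) - of_real (J $ x $ y)"
    for \<xi> x y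
    using D_diagonal[of x y] by (simp add: freq_mat_def cmat_def A axis_def)
  \<comment> \<open>The prefactor of the two-point function cancels the killing probability of the
    last step and the rate \<open>D $ b $ b\<close> from the sum of the expected discounts.\<close>
  have "complex_of_real (G_wsaw P D J Y T g lam b) = (\<integral>\<xi>. total_wgt g lam c \<xi> * U \<xi> $ a $ b \<partial>freq_measure)"
    unfolding G_wsaw_def of_real_mult integral_wsaw_weight[OF g c converges V U(2)]
    using D_pos[of b] jump_prob_None_pos[of b] by (simp del: jump_prob.simps)
  then show ?thesis
    unfolding Let_def F
    using form_fun_integral[OF g, where A=A and c=c and U=U and lam=lam and a=a and b=b] U(1) by (simp add: c_def)
qed

end
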